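(* Let $G=(G,\tau_G)$ be a weakly almost periodic group. (i) Given $\tau\in\overline{\mathcal T}(G)$, one has $\mathcal W^\tau(G)=\mathcal W(G)\cdot E(\tau)$. Moreover $$\mathcal I(\tau)=\{u\in\mathcal W(G):u\cdot E(\tau)=0\}$$ is an Eberlein-de Leeuw-Glicksberg ideal of $\mathcal W(G)$ for which $\mathcal W^\tau(G)$ is its linear complement; hence $\mathcal W(G)=\mathcal W^\tau(G)\oplus\mathcal I(\tau)$. (ii) Any Eberlein-de Leeuw-Glicksberg ideal $\mathcal J$ of $\mathcal W(G)$ is of the form $\mathcal J=\mathcal I(\tau)$ for some $\tau\in\overline{\mathcal T}(G)$.
   Context: For a topological group $(G,\tau_G)$, $\mathcal C_\beta(G)$ is the C*-algebra of bounded continuous complex functions with uniform norm; $(u\cdot s)(t)=u(st)$ and $(s\cdot u)(t)=u(ts)$ for $s,t\in G$. $\mathcal W(G)$ is the C*-algebra of weakly almost periodic functions: those $u\in\mathcal C_\beta(G)$ for which the weak closure of $u\cdot G$ is weakly compact. $\varepsilon^{\mathcal W}:G\to\mathcal W(G)^*$ is the evaluation map, and $G^{\mathcal W}=\overline{\varepsilon^{\mathcal W}(G)}^{w^*}$ is the Gelfand spectrum of $\mathcal W(G)$, a compact semitopological semigroup (separately continuous product) with $\varepsilon^{\mathcal W}$ a homomorphism. For $s\in G^{\mathcal W}$ and $u\in\mathcal W(G)$, $(u\cdot s)(t)=\lim_iu(s_it)$ for $t\in G$, where $(s_i)$ is any net in $G$ with $s=\lim_i\varepsilon^{\mathcal W}(s_i)$.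 $\sigma(X,\mathcal F)$ denotes the initial topology. $\mathcal T(G)=\{\tau\subseteq\tau_G:\tau\text{ is a group topology with }\tau=\sigma(G,\mathcal W^\tau(G))\}$, where $\mathcal W^\tau(G)=\{u\in\mathcal W(G):u\text{ is }\tau\text{-continuous}\}$. $G$ is weakly almost periodic if $\tau_G$ is Hausdorff and $\tau_G\in\mathcal T(G)$. For $\tau\in\mathcal T(G)$, $\eta_\tau:G\to G_\tau$ is the canonical map into the completion $G_\tau$ of $G/\overline{\{e_G\}}^\tau$ in the two-sided uniformity; $\eta_\tau^{\mathcal W}:G^{\mathcal W}\to G_\tau^{\mathcal W}$ is the unique continuous homomorphism extending it (with $G_\tau^{\mathcal W}$ the weakly almost periodic compactification of $G_\tau$), and $e_\tau^{\mathcal W}$ is the identity of $G_\tau^{\mathcal W}$. $\mathrm{ZE}(G^{\mathcal W})$ is the set of central idempotents of $G^{\mathcal W}$, with $e_1\le e_2$ iff $e_1e_2=e_1$. The map $T:\mathrm{ZE}(G^{\mathcal W})\to\mathcal T(G)$ is $T(e)=\sigma(G,\{\eta_e\})$, where $\eta_e:G\to G^{\mathcal W}$, $\eta_e(s)=e\,\varepsilon^{\mathcal W}(s)$. The map $E:\mathcal T(G)\to\mathrm{ZE}(G^{\mathcal W})$ sends $\tau$ to the minimal idempotent of the closed semigroup $S_\tau=(\eta_\tau^{\mathcal W})^{-1}(\{e_\tau^{\mathcal W}\})$. $\overline{\mathcal T}(G)=T(\mathrm{ZE}(G^{\mathcal W}))$, and $E$ restricted to $\overline{\mathcal T}(G)$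 is a bijection onto $\mathrm{ZE}(G^{\mathcal W})$ with inverse $T$. An Eberlein-de Leeuw-Glicksberg ideal of $\mathcal W(G)$ is a proper closed ideal $\mathcal J$ which is translation invariant and for which there is a C*-subalgebra $\mathcal A$ of $\mathcal W(G)$ that is a closed linear complement of $\mathcal J$. ($\mathcal J=\{0\}$ is allowed.)
   Formalization: In the definition of an Eberlein-de Leeuw-Glicksberg ideal, the complementary C*-subalgebra is also required to be translation invariant; without this (ii) fails, e.g. for the ideal C_0(G) with G = SL_2(Q_p) x SL_2(Q_p). *)

theory Defs
  imports "HOL-Analysis.Analysis" "HOL-Algebra.Coset"
begin

section \<open>Topological groups\<close>

definition topological_group :: "('a, 'm) monoid_scheme \<Rightarrow> 'a topology \<Rightarrow> bool" where
  "topological_group G \<tau> \<longleftrightarrow>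
     group G \<and> topspace \<tau> = carrier G \<and>
     continuous_map (prod_topology \<tau> \<tau>) \<tau> (\<lambda>(x, y). x \<otimes>\<^bsub>G\<^esub> y) \<and>
     continuous_map \<tau> \<tau> (\<lambda>x. inv\<^bsub>G\<^esub> x)"

text \<open>The initial topology on \<open>X\<close> for a family \<open>\<F>\<close> of maps into the space \<open>Y\<close>.\<close>

definition initial_topology :: "'a set \<Rightarrow> 'b topology \<Rightarrow> ('a \<Rightarrow> 'b) set \<Rightarrow> 'a topology" where
  "initial_topology X Y \<F> =
     topology_generated_by (insert X {f -` U \<inter> X | f U. f \<in> \<F> \<and> openin Y U})"


section \<open>Bounded continuous functions and weak topologies\<close>

text \<open>Functions on the underlying set of a space are encoded as functions on the whole type that
  vanish outside it. Pointwise operations and suprema over the type then agree with those over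
  the space.\<close>

definition bounded_continuous :: "'a topology \<Rightarrow> ('a \<Rightarrow> complex) set" where
  "bounded_continuous \<tau> =
     {u. continuous_map \<tau> euclidean u \<and> bounded (range u) \<and> (\<forall>t. t \<notin> topspace \<tau> \<longrightarrow> u t = 0)}"

definition uniform_norm :: "('a \<Rightarrow> complex) \<Rightarrow> real" where
  "uniform_norm u = (SUP t. cmod (u t))"

definition linear_subspace :: "('a \<Rightarrow> complex) set \<Rightarrow> bool" where
  "linear_subspace X \<longleftrightarrow>
     (\<lambda>t. 0) \<in> X \<and>
     (\<forall>u\<in>X. \<forall>v\<in>X. (\<lambda>t. u t + v t) \<in> X) \<and>
     (\<forall>c. \<forall>u\<in>X. (\<lambda>t. c * u t) \<in> X)"

text \<open>Closedness in the uniform norm, for sets of bounded continuous functions.\<close>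

definition norm_closed :: "('a \<Rightarrow> complex) set \<Rightarrow> bool" where
  "norm_closed X \<longleftrightarrow>
     (\<forall>f u. (\<forall>n::nat. f n \<in> X) \<and> uniform_limit UNIV f u sequentially \<longrightarrow> u \<in> X)"

text \<open>The Banach space dual of a space \<open>X\<close> of bounded functions; functionals are only relevant
  on \<open>X\<close>, hence \<open>extensional\<close>.\<close>

definition dual :: "('a \<Rightarrow> complex) set \<Rightarrow> (('a \<Rightarrow> complex) \<Rightarrow> complex) set" where
  "dual X =
     {\<phi> \<in> extensional X.
        (\<forall>u\<in>X. \<forall>v\<in>X. \<phi> (\<lambda>t. u t + v t) = \<phi> u + \<phi> v) \<and>
        (\<forall>c. \<forall>u\<in>X. \<phi> (\<lambda>t. c * u t) = c * \<phi> u) \<and>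
        (\<exists>K. \<forall>u\<in>X. cmod (\<phi> u) \<le> K * uniform_norm u)}"

definition weak_topology :: "('a \<Rightarrow> complex) set \<Rightarrow> ('a \<Rightarrow> complex) topology" where
  "weak_topology X = initial_topology X euclidean (dual X)"

definition weak_star_topology ::
  "('a \<Rightarrow> complex) set \<Rightarrow> (('a \<Rightarrow> complex) \<Rightarrow> complex) topology" where
  "weak_star_topology X = subtopology (product_topology (\<lambda>_. euclidean) X) (dual X)"


section \<open>Weakly almost periodic functions\<close>

text \<open>\<open>(u \<cdot> s)(t) = u (s t)\<close> and \<open>(s \<cdot> u)(t) = u (t s)\<close>.\<close>

definition translate_r :: "('a, 'm) monoid_scheme \<Rightarrow> ('a \<Rightarrow> complex) \<Rightarrow> 'a \<Rightarrow> ('a \<Rightarrow> complex)" where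
  "translate_r G u s = (\<lambda>t. if t \<in> carrier G then u (s \<otimes>\<^bsub>G\<^esub> t) else 0)"

definition translate_l :: "('a, 'm) monoid_scheme \<Rightarrow> 'a \<Rightarrow> ('a \<Rightarrow> complex) \<Rightarrow> ('a \<Rightarrow> complex)" where
  "translate_l G s u = (\<lambda>t. if t \<in> carrier G then u (t \<otimes>\<^bsub>G\<^esub> s) else 0)"

definition wap :: "('a, 'm) monoid_scheme \<Rightarrow> 'a topology \<Rightarrow> ('a \<Rightarrow> complex) set" where
  "wap G \<tau> =
     {u \<in> bounded_continuous \<tau>.
        compactin (weak_topology (bounded_continuous \<tau>))
          (weak_topology (bounded_continuous \<tau>) closure_of (translate_r G u ` carrier G))}"

definition wap_at :: "('a, 'm) monoid_scheme \<Rightarrow> 'a topology \<Rightarrow> 'a topology \<Rightarrow> ('a \<Rightarrow> complex) set" where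
  "wap_at G \<tau>\<^sub>G \<tau> = {u \<in> wap G \<tau>\<^sub>G. continuous_map \<tau> euclidean u}"


section \<open>The weakly almost periodic compactification\<close>

definition wap_eval ::
  "('a, 'm) monoid_scheme \<Rightarrow> 'a topology \<Rightarrow> 'a \<Rightarrow> (('a \<Rightarrow> complex) \<Rightarrow> complex)" where
  "wap_eval G \<tau> s = (\<lambda>u\<in>wap G \<tau>. u s)"

definition wap_points ::
  "('a, 'm) monoid_scheme \<Rightarrow> 'a topology \<Rightarrow> (('a \<Rightarrow> complex) \<Rightarrow> complex) set" where
  "wap_points G \<tau> = weak_star_topology (wap G \<tau>) closure_of (wap_eval G \<tau> ` carrier G)"

definition wap_topology ::
  "('a, 'm) monoid_scheme \<Rightarrow> 'a topology \<Rightarrow> (('a \<Rightarrow> complex) \<Rightarrow> complex) topology" where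
  "wap_topology G \<tau> = subtopology (weak_star_topology (wap G \<tau>)) (wap_points G \<tau>)"

text \<open>The trace on the group of the neighbourhood filter of a point \<open>s\<close> of the compactification:
  a net \<open>(s\<^sub>i)\<close> in the group satisfies \<open>\<epsilon>(s\<^sub>i) \<rightarrow> s\<close> iff its tail filter is finer than this one.
  So the limit along it is the common limit over all such nets.\<close>

definition approach ::
  "('a, 'm) monoid_scheme \<Rightarrow> 'a topology \<Rightarrow> (('a \<Rightarrow> complex) \<Rightarrow> complex) \<Rightarrow> 'a filter" where
  "approach G \<tau> s =
     inf (filtercomap (wap_eval G \<tau>) (nhdsin (wap_topology G \<tau>) s)) (principal (carrier G))"

definition wap_translate ::
  "('a, 'm) monoid_scheme \<Rightarrow> 'a topology \<Rightarrow> ('a \<Rightarrow> complex) \<Rightarrow> (('a \<Rightarrow> complex) \<Rightarrow> complex) \<Rightarrow>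
     ('a \<Rightarrow> complex)" where
  "wap_translate G \<tau> u s =
     (\<lambda>t. if t \<in> carrier G then Lim (approach G \<tau> s) (\<lambda>r. u (r \<otimes>\<^bsub>G\<^esub> t)) else 0)"

text \<open>The separately continuous product is determined by \<open>\<epsilon>(r) \<epsilon>(t) = \<epsilon>(r t)\<close>. If
  \<open>\<epsilon>(s\<^sub>i) \<rightarrow> p\<close> and \<open>\<epsilon>(t\<^sub>j) \<rightarrow> q\<close>, then \<open>(p q)(u) = lim\<^sub>j lim\<^sub>i u (s\<^sub>i t\<^sub>j) = lim\<^sub>j (u \<cdot> p)(t\<^sub>j) = q (u \<cdot> p)\<close>.\<close>

definition wap_compactification ::
  "('a, 'm) monoid_scheme \<Rightarrow> 'a topology \<Rightarrow> (('a \<Rightarrow> complex) \<Rightarrow> complex) monoid" where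
  "wap_compactification G \<tau> =
     \<lparr>carrier = wap_points G \<tau>,
      monoid.mult = (\<lambda>p q. \<lambda>u\<in>wap G \<tau>. q (wap_translate G \<tau> u p)),
      one = wap_eval G \<tau> \<one>\<^bsub>G\<^esub>\<rparr>"

definition central_idempotents ::
  "('a, 'm) monoid_scheme \<Rightarrow> 'a topology \<Rightarrow> (('a \<Rightarrow> complex) \<Rightarrow> complex) set" where
  "central_idempotents G \<tau> =
     (let K = wap_compactification G \<tau> in
      {e \<in> carrier K. e \<otimes>\<^bsub>K\<^esub> e = e \<and> (\<forall>s\<in>carrier K. e \<otimes>\<^bsub>K\<^esub> s = s \<otimes>\<^bsub>K\<^esub> e)})"


section \<open>Weakly almost periodic topologies\<close>

definition wap_group_topologies ::
  "('a, 'm) monoid_scheme \<Rightarrow> 'a topology \<Rightarrow> 'a topology set" where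
  "wap_group_topologies G \<tau>\<^sub>G =
     {\<tau>. topological_group G \<tau> \<and> (\<forall>U. openin \<tau> U \<longrightarrow> openin \<tau>\<^sub>G U) \<and>
         \<tau> = initial_topology (carrier G) euclidean (wap_at G \<tau>\<^sub>G \<tau>)}"

definition weakly_almost_periodic_group :: "('a, 'm) monoid_scheme \<Rightarrow> 'a topology \<Rightarrow> bool" where
  "weakly_almost_periodic_group G \<tau>\<^sub>G \<longleftrightarrow>
     topological_group G \<tau>\<^sub>G \<and> Hausdorff_space \<tau>\<^sub>G \<and> \<tau>\<^sub>G \<in> wap_group_topologies G \<tau>\<^sub>G"

definition T_map ::
  "('a, 'm) monoid_scheme \<Rightarrow> 'a topology \<Rightarrow> (('a \<Rightarrow> complex) \<Rightarrow> complex) \<Rightarrow> 'a topology" where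
  "T_map G \<tau>\<^sub>G e =
     initial_topology (carrier G) (wap_topology G \<tau>\<^sub>G)
       {\<lambda>s. e \<otimes>\<^bsub>wap_compactification G \<tau>\<^sub>G\<^esub> wap_eval G \<tau>\<^sub>G s}"

definition T_bar :: "('a, 'm) monoid_scheme \<Rightarrow> 'a topology \<Rightarrow> 'a topology set" where
  "T_bar G \<tau>\<^sub>G = T_map G \<tau>\<^sub>G ` central_idempotents G \<tau>\<^sub>G"


section \<open>Completion in the two-sided uniformity\<close>

definition two_sided_entourage :: "('a, 'm) monoid_scheme \<Rightarrow> 'a set \<Rightarrow> ('a \<times> 'a) set" where
  "two_sided_entourage H U =
     {(x, y). x \<in> carrier H \<and> y \<in> carrier H \<and>
        inv\<^bsub>H\<^esub> x \<otimes>\<^bsub>H\<^esub> y \<in> U \<and> y \<otimes>\<^bsub>H\<^esub> inv\<^bsub>H\<^esub> x \<in> U}"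

definition unit_nbhds :: "('a, 'm) monoid_scheme \<Rightarrow> 'a topology \<Rightarrow> 'a set set" where
  "unit_nbhds H \<tau> = {U. openin \<tau> U \<and> \<one>\<^bsub>H\<^esub> \<in> U}"

definition two_sided_cauchy :: "('a, 'm) monoid_scheme \<Rightarrow> 'a topology \<Rightarrow> 'a filter \<Rightarrow> bool" where
  "two_sided_cauchy H \<tau> F \<longleftrightarrow>
     F \<noteq> bot \<and> F \<le> principal (carrier H) \<and>
     (\<forall>U\<in>unit_nbhds H \<tau>. \<exists>A. eventually (\<lambda>x. x \<in> A) F \<and> A \<times> A \<subseteq> two_sided_entourage H U)"

text \<open>The completion consists of the minimal Cauchy filters. Minimality refers to the sets a
  filter contains; in the order on \<open>filter\<close> these are the maximal ones.\<close>

definition completion_points :: "('a, 'm) monoid_scheme \<Rightarrow> 'a topology \<Rightarrow> 'a filter set" where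
  "completion_points H \<tau> =
     {F. two_sided_cauchy H \<tau> F \<and> (\<forall>F'. two_sided_cauchy H \<tau> F' \<and> F \<le> F' \<longrightarrow> F' = F)}"

definition completion :: "('a, 'm) monoid_scheme \<Rightarrow> 'a topology \<Rightarrow> 'a filter monoid" where
  "completion H \<tau> =
     \<lparr>carrier = completion_points H \<tau>,
      monoid.mult = (\<lambda>F F'. THE K. K \<in> completion_points H \<tau> \<and>
                filtermap (\<lambda>(x, y). x \<otimes>\<^bsub>H\<^esub> y) (F \<times>\<^sub>F F') \<le> K),
      one = nhdsin \<tau> \<one>\<^bsub>H\<^esub>\<rparr>"

definition completion_entourage ::
  "('a, 'm) monoid_scheme \<Rightarrow> 'a topology \<Rightarrow> 'a set \<Rightarrow> ('a filter \<times> 'a filter) set" where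
  "completion_entourage H \<tau> U =
     {(F, F'). F \<in> completion_points H \<tau> \<and> F' \<in> completion_points H \<tau> \<and>
        (\<exists>A. eventually (\<lambda>x. x \<in> A) F \<and> eventually (\<lambda>x. x \<in> A) F' \<and>
             A \<times> A \<subseteq> two_sided_entourage H U)}"

definition completion_topology ::
  "('a, 'm) monoid_scheme \<Rightarrow> 'a topology \<Rightarrow> 'a filter topology" where
  "completion_topology H \<tau> =
     topology (\<lambda>S. S \<subseteq> completion_points H \<tau> \<and>
       (\<forall>F\<in>S. \<exists>U\<in>unit_nbhds H \<tau>. \<forall>F'. (F, F') \<in> completion_entourage H \<tau> U \<longrightarrow> F' \<in> S))"

lemma openin_completion_topology:
  assumes "topspace \<tau> = carrier H" "\<one>\<^bsub>H\<^esub> \<in> carrier H"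
  shows "openin (completion_topology H \<tau>) S \<longleftrightarrow>
    S \<subseteq> completion_points H \<tau> \<and>
      (\<forall>F\<in>S. \<exists>U\<in>unit_nbhds H \<tau>. \<forall>F'. (F, F') \<in> completion_entourage H \<tau> U \<longrightarrow> F' \<in> S)"
proof -
  let ?P = "\<lambda>S. S \<subseteq> completion_points H \<tau> \<and>
      (\<forall>F\<in>S. \<exists>U\<in>unit_nbhds H \<tau>. \<forall>F'. (F, F') \<in> completion_entourage H \<tau> U \<longrightarrow> F' \<in> S)"
  have int: "?P (S \<inter> S')" if S: "?P S" and S': "?P S'" for S S'
  proof (intro conjI ballI)
    show "S \<inter> S' \<subseteq> completion_points H \<tau>" using S by blast
    fix F assume F: "F \<in> S \<inter> S'"
    obtain U where U: "U \<in> unit_nbhds H \<tau>"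
        "\<forall>F'. (F, F') \<in> completion_entourage H \<tau> U \<longrightarrow> F' \<in> S" using F S by blast
    obtain V where V: "V \<in> unit_nbhds H \<tau>"
        "\<forall>F'. (F, F') \<in> completion_entourage H \<tau> V \<longrightarrow> F' \<in> S'" using F S' by blast
    have "two_sided_entourage H (U \<inter> V) \<subseteq> two_sided_entourage H U"
      "two_sided_entourage H (U \<inter> V) \<subseteq> two_sided_entourage H V"
      by (auto simp: two_sided_entourage_def)
    then have "completion_entourage H \<tau> (U \<inter> V) \<subseteq> completion_entourage H \<tau> U"
      "completion_entourage H \<tau> (U \<inter> V) \<subseteq> completion_entourage H \<tau> V"
      unfolding completion_entourage_def by blast+
    then have "\<forall>F'. (F, F') \<in> completion_entourage H \<tau> (U \<inter> V) \<longrightarrow> F' \<in> S \<inter> S'"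
      using U(2) V(2) by blast
    moreover have "U \<inter> V \<in> unit_nbhds H \<tau>" using U(1) V(1) by (auto simp: unit_nbhds_def)
    ultimately show "\<exists>U\<in>unit_nbhds H \<tau>. \<forall>F'. (F, F') \<in> completion_entourage H \<tau> U \<longrightarrow> F' \<in> S \<inter> S'"
      by blast
  qed
  have "?P (\<Union>\<K>)" if "\<forall>S\<in>\<K>. ?P S" for \<K>
    using that by (meson Sup_least Union_iff)
  with int have "istopology ?P" unfolding istopology_def by blast
  then show ?thesis unfolding completion_topology_def by (simp add: topology_inverse')
qed

definition unit_closure :: "('a, 'm) monoid_scheme \<Rightarrow> 'a topology \<Rightarrow> 'a set" where
  "unit_closure G \<tau> = \<tau> closure_of {\<one>\<^bsub>G\<^esub>}"

definition separated_quotient :: "('a, 'm) monoid_scheme \<Rightarrow> 'a topology \<Rightarrow> 'a set monoid" where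
  "separated_quotient G \<tau> = G Mod unit_closure G \<tau>"

definition quotient_topology :: "('a, 'm) monoid_scheme \<Rightarrow> 'a topology \<Rightarrow> 'a set topology" where
  "quotient_topology G \<tau> =
     topology (\<lambda>S. S \<subseteq> carrier (separated_quotient G \<tau>) \<and>
       openin \<tau> {x \<in> topspace \<tau>. unit_closure G \<tau> #>\<^bsub>G\<^esub> x \<in> S})"

lemma openin_quotient_topology:
  "openin (quotient_topology G \<tau>) S \<longleftrightarrow>
     S \<subseteq> carrier (separated_quotient G \<tau>) \<and>
     openin \<tau> {x \<in> topspace \<tau>. unit_closure G \<tau> #>\<^bsub>G\<^esub> x \<in> S}"
proof -
  let ?f = "\<lambda>x. unit_closure G \<tau> #>\<^bsub>G\<^esub> x"
  let ?P = "\<lambda>S. S \<subseteq> carrier (separated_quotient G \<tau>) \<and> openin \<tau> {x \<in> topspace \<tau>. ?f x \<in> S}"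
  have int: "?P (S \<inter> S')" if "?P S" "?P S'" for S S'
  proof -
    have "{x \<in> topspace \<tau>. ?f x \<in> S \<inter> S'} =
        {x \<in> topspace \<tau>. ?f x \<in> S} \<inter> {x \<in> topspace \<tau>. ?f x \<in> S'}" by blast
    with that show ?thesis by auto
  qed
  have un: "?P (\<Union>\<K>)" if "\<forall>S\<in>\<K>. ?P S" for \<K>
  proof -
    have "{x \<in> topspace \<tau>. ?f x \<in> \<Union>\<K>} = (\<Union>S\<in>\<K>. {x \<in> topspace \<tau>. ?f x \<in> S})" by blast
    moreover have "openin \<tau> (\<Union>S\<in>\<K>. {x \<in> topspace \<tau>. ?f x \<in> S})" using that by blast
    moreover have "\<Union>\<K> \<subseteq> carrier (separated_quotient G \<tau>)" using that by blast
    ultimately show ?thesis by simp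
  qed
  from int un have "istopology ?P" unfolding istopology_def by blast
  then show ?thesis unfolding quotient_topology_def by (simp add: topology_inverse')
qed

abbreviation G_completion :: "('a, 'm) monoid_scheme \<Rightarrow> 'a topology \<Rightarrow> 'a set filter monoid" where
  "G_completion G \<tau> \<equiv> completion (separated_quotient G \<tau>) (quotient_topology G \<tau>)"

abbreviation G_completion_topology ::
  "('a, 'm) monoid_scheme \<Rightarrow> 'a topology \<Rightarrow> 'a set filter topology" where
  "G_completion_topology G \<tau> \<equiv> completion_topology (separated_quotient G \<tau>) (quotient_topology G \<tau>)"

definition eta :: "('a, 'm) monoid_scheme \<Rightarrow> 'a topology \<Rightarrow> 'a \<Rightarrow> 'a set filter" where
  "eta G \<tau> s = nhdsin (quotient_topology G \<tau>) (unit_closure G \<tau> #>\<^bsub>G\<^esub> s)"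


section \<open>The map \<open>E\<close>\<close>

definition eta_wap ::
  "('a, 'm) monoid_scheme \<Rightarrow> 'a topology \<Rightarrow> 'a topology \<Rightarrow>
     (('a \<Rightarrow> complex) \<Rightarrow> complex) \<Rightarrow> (('a set filter \<Rightarrow> complex) \<Rightarrow> complex)" where
  "eta_wap G \<tau>\<^sub>G \<tau> =
     (let K = wap_compactification G \<tau>\<^sub>G;
          K' = wap_compactification (G_completion G \<tau>) (G_completion_topology G \<tau>) in
      THE h. h \<in> extensional (carrier K) \<and> h \<in> hom K K' \<and>
        continuous_map (wap_topology G \<tau>\<^sub>G)
          (wap_topology (G_completion G \<tau>) (G_completion_topology G \<tau>)) h \<and>
        (\<forall>s\<in>carrier G. h (wap_eval G \<tau>\<^sub>G s) =
           wap_eval (G_completion G \<tau>) (G_completion_topology G \<tau>) (eta G \<tau> s)))"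

definition S_semigroup ::
  "('a, 'm) monoid_scheme \<Rightarrow> 'a topology \<Rightarrow> 'a topology \<Rightarrow> (('a \<Rightarrow> complex) \<Rightarrow> complex) set" where
  "S_semigroup G \<tau>\<^sub>G \<tau> =
     {s \<in> carrier (wap_compactification G \<tau>\<^sub>G).
        eta_wap G \<tau>\<^sub>G \<tau> s =
          \<one>\<^bsub>wap_compactification (G_completion G \<tau>) (G_completion_topology G \<tau>)\<^esub>}"

text \<open>Idempotents that need not commute are ordered by \<open>f \<le> e\<close> iff \<open>e f = f e = f\<close>.\<close>

definition minimal_idempotent :: "('s, 'm) monoid_scheme \<Rightarrow> 's set \<Rightarrow> 's \<Rightarrow> bool" where
  "minimal_idempotent K S e \<longleftrightarrow>
     e \<in> S \<and> e \<otimes>\<^bsub>K\<^esub> e = e \<and>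
     (\<forall>f\<in>S. f \<otimes>\<^bsub>K\<^esub> f = f \<and> e \<otimes>\<^bsub>K\<^esub> f = f \<and> f \<otimes>\<^bsub>K\<^esub> e = f \<longrightarrow> f = e)"

definition E_map ::
  "('a, 'm) monoid_scheme \<Rightarrow> 'a topology \<Rightarrow> 'a topology \<Rightarrow> (('a \<Rightarrow> complex) \<Rightarrow> complex)" where
  "E_map G \<tau>\<^sub>G \<tau> =
     (THE e. minimal_idempotent (wap_compactification G \<tau>\<^sub>G) (S_semigroup G \<tau>\<^sub>G \<tau>) e)"


section \<open>Eberlein-de Leeuw-Glicksberg ideals\<close>

definition translation_invariant :: "('a, 'm) monoid_scheme \<Rightarrow> ('a \<Rightarrow> complex) set \<Rightarrow> bool" where
  "translation_invariant G X \<longleftrightarrow>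
     (\<forall>u\<in>X. \<forall>s\<in>carrier G. translate_r G u s \<in> X \<and> translate_l G s u \<in> X)"

definition cstar_subalgebra :: "('a \<Rightarrow> complex) set \<Rightarrow> ('a \<Rightarrow> complex) set \<Rightarrow> bool" where
  "cstar_subalgebra W A \<longleftrightarrow>
     A \<subseteq> W \<and> linear_subspace A \<and> norm_closed A \<and>
     (\<forall>u\<in>A. \<forall>v\<in>A. (\<lambda>t. u t * v t) \<in> A) \<and>
     (\<forall>u\<in>A. (\<lambda>t. cnj (u t)) \<in> A)"

definition closed_ideal :: "('a \<Rightarrow> complex) set \<Rightarrow> ('a \<Rightarrow> complex) set \<Rightarrow> bool" where
  "closed_ideal W J \<longleftrightarrow>
     J \<subseteq> W \<and> linear_subspace J \<and> norm_closed J \<and>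
     (\<forall>u\<in>W. \<forall>v\<in>J. (\<lambda>t. u t * v t) \<in> J)"

definition direct_sum :: "('a \<Rightarrow> complex) set \<Rightarrow> ('a \<Rightarrow> complex) set \<Rightarrow> ('a \<Rightarrow> complex) set \<Rightarrow> bool" where
  "direct_sum W A J \<longleftrightarrow>
     linear_subspace A \<and> linear_subspace J \<and>
     A \<inter> J = {\<lambda>t. 0} \<and> W = {\<lambda>t. a t + j t | a j. a \<in> A \<and> j \<in> J}"

text \<open>Translation invariance is required of the decomposition, that is, of the ideal and of its
  complement. Without it on the complement, the ideals would not correspond to central idempotents.
  Let \<open>G = SL\<^sub>2(\<rat>\<^sub>p) \<times> SL\<^sub>2(\<rat>\<^sub>p)\<close>. The compactification of \<open>G\<close> is the product of the one-point
  compactifications \<open>K\<^sub>1\<close>, \<open>K\<^sub>2\<close> of the two factors, which is metrizable and zero-dimensional. So it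
  retracts onto the union \<open>I\<close> of \<open>{\<infinity>} \<times> K\<^sub>2\<close> and \<open>K\<^sub>1 \<times> {\<infinity>}\<close>, and composition with a retraction
  makes \<open>C(I)\<close> a C*-subalgebra complementing the translation invariant ideal of functions vanishing
  on \<open>I\<close>; but \<open>I\<close> is not of the form \<open>e (K\<^sub>1 \<times> K\<^sub>2)\<close> for an idempotent \<open>e\<close>.\<close>

definition EdLG_decomposition ::
  "('a, 'm) monoid_scheme \<Rightarrow> 'a topology \<Rightarrow> ('a \<Rightarrow> complex) set \<Rightarrow> ('a \<Rightarrow> complex) set \<Rightarrow> bool" where
  "EdLG_decomposition G \<tau>\<^sub>G A J \<longleftrightarrow>
     closed_ideal (wap G \<tau>\<^sub>G) J \<and> J \<noteq> wap G \<tau>\<^sub>G \<and> translation_invariant G J \<and>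
     cstar_subalgebra (wap G \<tau>\<^sub>G) A \<and> translation_invariant G A \<and>
     direct_sum (wap G \<tau>\<^sub>G) A J"

definition EdLG_ideal :: "('a, 'm) monoid_scheme \<Rightarrow> 'a topology \<Rightarrow> ('a \<Rightarrow> complex) set \<Rightarrow> bool" where
  "EdLG_ideal G \<tau>\<^sub>G J \<longleftrightarrow> (\<exists>A. EdLG_decomposition G \<tau>\<^sub>G A J)"

definition I_ideal :: "('a, 'm) monoid_scheme \<Rightarrow> 'a topology \<Rightarrow> 'a topology \<Rightarrow> ('a \<Rightarrow> complex) set" where
  "I_ideal G \<tau>\<^sub>G \<tau> = {u \<in> wap G \<tau>\<^sub>G. wap_translate G \<tau>\<^sub>G u (E_map G \<tau>\<^sub>G \<tau>) = (\<lambda>t. 0)}"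

end

theory Submission
  imports Defs
begin

text \<open>Grothendieck's criterion is the starting point: a bounded continuous function \<open>u\<close> is weakly
  almost periodic iff \<open>lim\<^sub>A lim\<^sub>B u(s t) = lim\<^sub>B lim\<^sub>A u(s t)\<close> for all ultrafilters \<open>A\<close>, \<open>B\<close> on the group
  (\<open>wap_iff_double_limit_property\<close>). The points of the compactification are the functionals
  \<open>u \<mapsto> lim\<^sub>F u\<close>, their product is the iterated limit, and \<open>u \<cdot> p\<close> is a limit of translates of \<open>u\<close>
  along an ultrafilter. Since limits along ultrafilters respect sums, products and conjugates,
  \<open>u \<mapsto> u \<cdot> p\<close> is a homomorphism for every \<open>p\<close>.

  For a central idempotent \<open>e\<close> the map \<open>u \<mapsto> u \<cdot> e\<close> is therefore a multiplicative projection. It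
  commutes with both translations, the right ones because \<open>e\<close> is central, so its kernel is a translation
  invariant ideal and its range a complementary algebra. The range consists of the w.a.p. functions
  continuous for \<open>T(e)\<close>: the functions \<open>u \<cdot> e\<close> are the coordinates of \<open>\<eta>\<^sub>e\<close>, and conversely a net in the
  group that converges to \<open>e\<close> converges to \<open>1\<close> in \<open>T(e)\<close>, because \<open>e e = e\<close>, so that \<open>u \<cdot> e = u\<close> for
  every \<open>T(e)\<close>-continuous \<open>u\<close> (\<open>wap_at_T_map\<close>). This needs \<open>T(e)\<close> to be a group topology.

  In the other direction the projection \<open>P\<close> of a decomposition is multiplicative, as it projects onto
  an algebra along an ideal. So \<open>u \<mapsto> (P u)(1)\<close> is a character and hence a point \<open>e\<close> of the
  compactification (\<open>character_is_wap_point\<close>). Invariance of the decomposition under translations gives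
  \<open>u \<cdot> e = P u\<close>, and then \<open>P P = P\<close> and invariance on the other side make \<open>e\<close> a central idempotent
  (\<open>EdLG_ideal_annihilator\<close>).

  What remains is \<open>E(T(e)) = e\<close>. Every \<open>T(e)\<close>-continuous w.a.p. function is the pullback of a w.a.p.
  function on the completion, so the semigroup \<open>S\<close> of \<open>T(e)\<close> consists of the \<open>s\<close> that agree with \<open>1\<close>
  on all \<open>u \<cdot> e\<close>, which means \<open>e s = e\<close>. The only minimal idempotent of that semigroup is \<open>e\<close>.

  Two facts about iterated limits carry the analysis. If they commute, pointwise convergence to a
  limit is weak convergence (\<open>interchange_functional_continuity\<close>); this is proved without integral
  representations, by Simons' convexity argument. If they commute for \<open>u(s t)\<close> on a group, then \<open>u(s t) \<rightarrow> u(t)\<close> for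
  every \<open>t\<close> implies that the convergence is uniform in \<open>t\<close> (\<open>uniform_left_translation\<close>). The second fact
  makes \<open>T(e)\<close> a group topology and extends w.a.p. functions to the completion.\<close>

section \<open>Ultrafilters\<close>

definition ultrafilter_on :: "'a set \<Rightarrow> 'a filter \<Rightarrow> bool" where
  "ultrafilter_on X F \<longleftrightarrow> F \<noteq> bot \<and> F \<le> principal X \<and>
     (\<forall>P. eventually P F \<or> eventually (\<lambda>x. \<not> P x) F)"

lemma ultrafilter_onD:
  assumes "ultrafilter_on X F"
  shows "F \<noteq> bot" "eventually (\<lambda>x. x \<in> X) F"
    "\<not> eventually P F \<longleftrightarrow> eventually (\<lambda>x. \<not> P x) F"
proof -
  show nb: "F \<noteq> bot" and "eventually (\<lambda>x. x \<in> X) F"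
    using assms by (auto simp: ultrafilter_on_def le_principal)
  have "\<not> (eventually P F \<and> eventually (\<lambda>x. \<not> P x) F)"
    using nb eventually_conj[of P F "\<lambda>x. \<not> P x"] by (auto simp: eventually_False)
  then show "\<not> eventually P F \<longleftrightarrow> eventually (\<lambda>x. \<not> P x) F"
    using assms unfolding ultrafilter_on_def by blast
qed

lemma ultrafilter_below:
  fixes F :: "'a filter"
  assumes "F \<noteq> bot"
  obtains U where "U \<le> F" "\<And>X. F \<le> principal X \<Longrightarrow> ultrafilter_on X U"
proof -
  define \<A> where "\<A> = {U. U \<noteq> bot \<and> U \<le> F}"
  have "\<exists>U\<in>\<A>. \<forall>V\<in>\<A>. U \<ge> V \<longrightarrow> V = U"
  proof (rule predicate_Zorn)
    show "partial_order_on \<A> (relation_of (\<lambda>x y. y \<le> x) \<A>)"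
      by (auto simp: partial_order_on_def preorder_on_def refl_on_def trans_def antisym_def
          relation_of_def)
    fix C assume C: "C \<in> Chains (relation_of (\<lambda>x y. y \<le> x) \<A>)"
    then have sub: "C \<subseteq> \<A>" and chain: "\<And>A B. A \<in> C \<Longrightarrow> B \<in> C \<Longrightarrow> A \<le> B \<or> B \<le> A"
      unfolding Chains_def relation_of_def by blast+
    show "\<exists>u\<in>\<A>. \<forall>a\<in>C. u \<le> a"
    proof (cases "C = {}")
      case True
      then show ?thesis using assms by (auto simp: \<A>_def)
    next
      case False
      have "\<not> eventually (\<lambda>_. False) (Inf C)"
      proof (subst eventually_Inf_base[OF False])
        show "\<exists>x\<in>C. x \<le> inf A B" if "A \<in> C" "B \<in> C" for A B
          using chain[OF that] that by (metis inf.absorb1 inf.absorb2 order_refl)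
        show "\<not> (\<exists>b\<in>C. eventually (\<lambda>_. False) b)"
          using sub by (auto simp: \<A>_def eventually_False)
      qed
      then have "Inf C \<noteq> bot" by (simp add: eventually_False)
      moreover have "Inf C \<le> F"
        using False sub by (metis (mono_tags, lifting) Inf_lower2 \<A>_def all_not_in_conv mem_Collect_eq subsetD)
      ultimately show ?thesis by (auto simp: \<A>_def intro: Inf_lower)
    qed
  qed
  then obtain U where U: "U \<noteq> bot" "U \<le> F" and max: "\<And>V. V \<noteq> bot \<Longrightarrow> V \<le> F \<Longrightarrow> V \<le> U \<Longrightarrow> V = U"
    unfolding \<A>_def by auto
  have "eventually P U \<or> eventually (\<lambda>x. \<not> P x) U" for P
  proof (cases "inf U (principal {x. P x}) = bot")
    case True
    then have "eventually (\<lambda>x. \<not> P x) U"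
      by (simp add: trivial_limit_def eventually_inf_principal)
    then show ?thesis ..
  next
    case False
    then have "inf U (principal {x. P x}) = U"
      using U by (intro max) (auto intro: le_infI1)
    then have "U \<le> principal {x. P x}" by (metis inf_le2)
    then show ?thesis by (simp add: le_principal)
  qed
  then have "ultrafilter_on X U" if "F \<le> principal X" for X
    unfolding ultrafilter_on_def using U that by (meson order_trans)
  with U that show ?thesis by blast
qed

lemma ultrafilter_on_filtermap:
  assumes "ultrafilter_on X F" "\<And>x. x \<in> X \<Longrightarrow> g x \<in> Y"
  shows "ultrafilter_on Y (filtermap g F)"
proof -
  have "eventually (\<lambda>x. g x \<in> Y) F"
    using ultrafilter_onD(2)[OF assms(1)] by eventually_elim (rule assms(2))
  with assms(1) show ?thesis
    by (auto simp: ultrafilter_on_def filtermap_bot_iff le_principal eventually_filtermap)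
qed

lemma ultrafilter_on_mono:
  assumes "ultrafilter_on X F" "eventually (\<lambda>x. x \<in> Y) F"
  shows "ultrafilter_on Y F"
  using assms by (simp add: ultrafilter_on_def le_principal)

lemma ultrafilter_on_principal: "x \<in> X \<Longrightarrow> ultrafilter_on X (principal {x})"
  by (auto simp: ultrafilter_on_def eventually_principal principal_eq_bot_iff)

text \<open>An ultrafilter converges wherever compactness provides a cluster point.\<close>

lemma ultrafilter_tendsto:
  fixes f :: "'a \<Rightarrow> complex"
  assumes F: "ultrafilter_on X F" and bd: "\<And>x. x \<in> X \<Longrightarrow> cmod (f x) \<le> K"
  shows "(f \<longlongrightarrow> Lim F f) F"
proof -
  have "eventually (\<lambda>x. f x \<in> cball 0 K) F"
    using ultrafilter_onD(2)[OF F] by eventually_elim (simp add: bd)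
  then have "eventually (\<lambda>z. z \<in> cball 0 K) (filtermap f F)"
    by (simp add: eventually_filtermap)
  moreover have "filtermap f F \<noteq> bot" using ultrafilter_onD(1)[OF F] by (simp add: filtermap_bot_iff)
  moreover have "compact (cball (0::complex) K)" by simp
  ultimately obtain l where l: "inf (nhds l) (filtermap f F) \<noteq> bot"
    unfolding compact_filter by blast
  have "(f \<longlongrightarrow> l) F"
  proof (rule topological_tendstoI)
    fix S assume S: "open S" "l \<in> S"
    show "eventually (\<lambda>x. f x \<in> S) F"
    proof (rule ccontr)
      assume "\<not> ?thesis"
      then have "eventually (\<lambda>x. f x \<notin> S) F" using ultrafilter_onD(3)[OF F] by blast
      then have "eventually (\<lambda>z. z \<notin> S) (filtermap f F)" by (simp add: eventually_filtermap)
      moreover have "eventually (\<lambda>z. z \<in> S) (nhds l)" using S eventually_nhds by blast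
      ultimately have "eventually (\<lambda>z. False) (inf (nhds l) (filtermap f F))"
        unfolding eventually_inf by blast
      with l show False by (simp add: eventually_False)
    qed
  qed
  then show ?thesis using tendsto_Lim[of F f l] ultrafilter_onD(1)[OF F] by simp
qed

lemma ultrafilter_Lim_eqI:
  fixes f :: "'a \<Rightarrow> complex"
  assumes "ultrafilter_on X F" "(f \<longlongrightarrow> l) F"
  shows "Lim F f = l"
  using tendsto_Lim assms ultrafilter_onD(1) by blast

lemma Lim_cong_on:
  fixes f :: "'a \<Rightarrow> complex"
  assumes "ultrafilter_on X F" "\<And>x. x \<in> X \<Longrightarrow> f x = g x"
  shows "Lim F f = Lim F g"
proof -
  have "eventually (\<lambda>x. f x = g x) F"
    using ultrafilter_onD(2)[OF assms(1)] by eventually_elim (rule assms(2))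
  then have "(f \<longlongrightarrow> l) F \<longleftrightarrow> (g \<longlongrightarrow> l) F" for l by (rule tendsto_cong)
  then show ?thesis by (simp add: Topological_Spaces.Lim_def)
qed

lemma Lim_filtermap: "Lim (filtermap g F) f = Lim F (\<lambda>x. f (g x))"
  by (simp add: Topological_Spaces.Lim_def filterlim_filtermap)

lemma Lim_norm_le:
  fixes f :: "'a \<Rightarrow> complex"
  assumes F: "ultrafilter_on X F" and bd: "\<And>x. x \<in> X \<Longrightarrow> cmod (f x) \<le> K"
  shows "cmod (Lim F f) \<le> K"
proof (rule tendsto_upperbound[OF tendsto_norm[OF ultrafilter_tendsto[OF F bd]]])
  show "eventually (\<lambda>x. cmod (f x) \<le> K) F"
    using ultrafilter_onD(2)[OF F] by eventually_elim (rule bd)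
qed (use ultrafilter_onD(1)[OF F] in auto)

lemma Lim_const_ultrafilter: "ultrafilter_on X F \<Longrightarrow> Lim F (\<lambda>_. c :: complex) = c"
  by (rule ultrafilter_Lim_eqI) auto

lemma Lim_principal: "Lim (principal {x}) f = (f x :: complex)"
  by (intro tendsto_Lim) (auto simp: principal_eq_bot_iff tendsto_principal_singleton)

lemma eventually_by_ultrafilters:
  assumes "\<And>U. U \<le> N \<Longrightarrow> ultrafilter_on UNIV U \<Longrightarrow> eventually P U"
  shows "eventually P N"
proof (rule ccontr)
  assume "\<not> eventually P N"
  then have "inf N (principal {x. \<not> P x}) \<noteq> bot"
    by (simp add: trivial_limit_def eventually_inf_principal)
  then obtain U where U: "U \<le> inf N (principal {x. \<not> P x})"
    "\<And>X. inf N (principal {x. \<not> P x}) \<le> principal X \<Longrightarrow> ultrafilter_on X U"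
    by (rule ultrafilter_below) blast
  have "ultrafilter_on UNIV U" by (rule U(2)) simp
  moreover have "eventually (\<lambda>x. \<not> P x) U" "U \<le> N" using U(1) by (auto simp: le_principal)
  ultimately show False using assms[of U] ultrafilter_onD(3)[of UNIV U P] by blast
qed

text \<open>The tensor product of two ultrafilters, pushed forward along a binary map; iterated limits
  are limits along it.\<close>

definition tensor_filter :: "('a \<Rightarrow> 'b \<Rightarrow> 'c) \<Rightarrow> 'a filter \<Rightarrow> 'b filter \<Rightarrow> 'c filter" where
  "tensor_filter m A B = Abs_filter (\<lambda>P. eventually (\<lambda>b. eventually (\<lambda>a. P (m a b)) A) B)"

lemma eventually_tensor_filter:
  "eventually P (tensor_filter m A B) \<longleftrightarrow> eventually (\<lambda>b. eventually (\<lambda>a. P (m a b)) A) B"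
  unfolding tensor_filter_def
proof (rule eventually_Abs_filter, rule is_filter.intro)
  fix P Q
  assume PQ: "\<forall>\<^sub>F b in B. \<forall>\<^sub>F a in A. P (m a b)"
  {
    assume "\<forall>\<^sub>F b in B. \<forall>\<^sub>F a in A. Q (m a b)"
    with PQ show "\<forall>\<^sub>F b in B. \<forall>\<^sub>F a in A. P (m a b) \<and> Q (m a b)"
      by eventually_elim (rule eventually_conj)
  }
  assume "\<forall>x. P x \<longrightarrow> Q x"
  with PQ show "\<forall>\<^sub>F b in B. \<forall>\<^sub>F a in A. Q (m a b)"
    by (auto elim!: eventually_mono)
qed simp

lemma ultrafilter_on_tensor_filter:
  assumes A: "ultrafilter_on X A" and B: "ultrafilter_on Y B"
    and m: "\<And>a b. a \<in> X \<Longrightarrow> b \<in> Y \<Longrightarrow> m a b \<in> Z"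
  shows "ultrafilter_on Z (tensor_filter m A B)"
  unfolding ultrafilter_on_def
proof (intro conjI allI)
  have "\<not> eventually (\<lambda>_. False) (tensor_filter m A B)"
    unfolding eventually_tensor_filter
    using ultrafilter_onD(1)[OF A] ultrafilter_onD(1)[OF B] by (simp add: eventually_False)
  then show "tensor_filter m A B \<noteq> bot" by (simp add: eventually_False)
  have "eventually (\<lambda>b. eventually (\<lambda>a. m a b \<in> Z) A) B"
    using ultrafilter_onD(2)[OF B]
  proof eventually_elim
    case (elim b)
    show ?case using ultrafilter_onD(2)[OF A] by eventually_elim (simp add: m elim)
  qed
  then show "tensor_filter m A B \<le> principal Z" by (simp add: le_principal eventually_tensor_filter)
  show "eventually P (tensor_filter m A B) \<or> eventually (\<lambda>x. \<not> P x) (tensor_filter m A B)" for P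
    by (simp only: eventually_tensor_filter ultrafilter_onD(3)[OF A, symmetric]
        ultrafilter_onD(3)[OF B, symmetric]) blast
qed

lemma Lim_tensor_filter:
  fixes f :: "'c \<Rightarrow> complex"
  assumes A: "ultrafilter_on X A" and B: "ultrafilter_on Y B"
    and m: "\<And>a b. a \<in> X \<Longrightarrow> b \<in> Y \<Longrightarrow> m a b \<in> Z"
    and bd: "\<And>z. z \<in> Z \<Longrightarrow> cmod (f z) \<le> K"
  shows "Lim (tensor_filter m A B) f = Lim B (\<lambda>b. Lim A (\<lambda>a. f (m a b)))"
proof -
  let ?T = "tensor_filter m A B"
  have T: "ultrafilter_on Z ?T" by (rule ultrafilter_on_tensor_filter[OF A B m])
  let ?l = "Lim ?T f"
  have in_bd: "cmod (Lim A (\<lambda>a. f (m a b))) \<le> K" if "b \<in> Y" for b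
    by (rule Lim_norm_le[OF A]) (simp add: bd m that)
  have "((\<lambda>b. Lim A (\<lambda>a. f (m a b))) \<longlongrightarrow> ?l) B"
  proof (rule tendstoI)
    fix e :: real assume "e > 0"
    then have "eventually (\<lambda>z. dist (f z) ?l < e/2) ?T"
      using tendstoD[OF ultrafilter_tendsto[OF T bd], where e = "e/2"] by simp
    then have "eventually (\<lambda>b. eventually (\<lambda>a. dist (f (m a b)) ?l < e/2) A) B"
      by (simp add: eventually_tensor_filter)
    with ultrafilter_onD(2)[OF B]
    show "eventually (\<lambda>b. dist (Lim A (\<lambda>a. f (m a b))) ?l < e) B"
    proof eventually_elim
      case (elim b)
      have "((\<lambda>a. f (m a b)) \<longlongrightarrow> Lim A (\<lambda>a. f (m a b))) A"
        by (rule ultrafilter_tendsto[OF A, where K = K]) (simp add: bd m elim)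
      then have "((\<lambda>a. dist (f (m a b)) ?l) \<longlongrightarrow> dist (Lim A (\<lambda>a. f (m a b))) ?l) A"
        by (intro tendsto_intros)
      then have "dist (Lim A (\<lambda>a. f (m a b))) ?l \<le> e/2"
      proof (rule tendsto_upperbound)
        show "eventually (\<lambda>a. dist (f (m a b)) ?l \<le> e/2) A"
          using elim(2) by eventually_elim simp
      qed (use ultrafilter_onD(1)[OF A] in auto)
      then show ?case using \<open>e > 0\<close> by simp
    qed
  qed
  then show ?thesis using ultrafilter_Lim_eqI[OF B] by simp
qed

section \<open>Interchanging iterated limits\<close>

text \<open>Grothendieck's double limit property, with ultrafilters instead of sequences. For bounded \<open>w\<close>
  all the limits exist, so the equation is a statement about \<open>w\<close> alone.\<close>

definition interchange :: "'a set \<Rightarrow> 'b set \<Rightarrow> ('a \<Rightarrow> 'b \<Rightarrow> complex) \<Rightarrow> bool" where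
  "interchange X Y w \<longleftrightarrow> (\<forall>A B. ultrafilter_on X A \<and> ultrafilter_on Y B \<longrightarrow>
     Lim A (\<lambda>x. Lim B (\<lambda>y. w x y)) = Lim B (\<lambda>y. Lim A (\<lambda>x. w x y)))"

lemma interchangeD:
  "interchange X Y w \<Longrightarrow> ultrafilter_on X A \<Longrightarrow> ultrafilter_on Y B \<Longrightarrow>
    Lim A (\<lambda>x. Lim B (\<lambda>y. w x y)) = Lim B (\<lambda>y. Lim A (\<lambda>x. w x y))"
  by (simp add: interchange_def)

text \<open>Total boundedness of the values, one function at a time: a finite cover of the values of one
  function splits \<open>Y\<close> into finitely many parts, and the induction hypothesis applies to each part.\<close>

lemma finite_net_for_finite_family:
  fixes \<Phi> :: "('b \<Rightarrow> complex) set"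
  assumes "finite \<Phi>" "e > 0" "\<And>f y. f \<in> \<Phi> \<Longrightarrow> y \<in> Y \<Longrightarrow> cmod (f y) \<le> C"
  shows "\<exists>T. finite T \<and> T \<subseteq> Y \<and> (\<forall>y\<in>Y. \<exists>y'\<in>T. \<forall>f\<in>\<Phi>. cmod (f y - f y') < e)"
  using assms(1,3)
proof (induction arbitrary: Y)
  case empty
  show ?case
  proof (cases "Y = {}")
    case False
    then obtain y where "y \<in> Y" by blast
    then show ?thesis by (intro exI[of _ "{y}"]) auto
  qed auto
next
  case (insert f \<Phi>)
  have "compact (cball (0::complex) C)" by simp
  then have "\<forall>r>0. \<exists>Z. finite Z \<and> cball (0::complex) C \<subseteq> (\<Union>z\<in>Z. ball z r)"
    unfolding compact_eq_totally_bounded by blast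
  then obtain Z where Z: "finite Z" "cball (0::complex) C \<subseteq> (\<Union>z\<in>Z. ball z (e/2))"
    using half_gt_zero[OF \<open>e > 0\<close>] by blast
  define Yz where "Yz z = {y\<in>Y. f y \<in> ball z (e/2)}" for z
  have "\<exists>T. finite T \<and> T \<subseteq> Yz z \<and> (\<forall>y\<in>Yz z. \<exists>y'\<in>T. \<forall>f\<in>\<Phi>. cmod (f y - f y') < e)" for z
    using insert.prems by (intro insert.IH) (auto simp: Yz_def)
  then obtain T where T: "\<And>z. finite (T z)" "\<And>z. T z \<subseteq> Yz z"
    "\<And>z y. y \<in> Yz z \<Longrightarrow> \<exists>y'\<in>T z. \<forall>f\<in>\<Phi>. cmod (f y - f y') < e"
    by metis
  have "\<exists>y'\<in>(\<Union>z\<in>Z. T z). \<forall>f\<in>insert f \<Phi>. cmod (f y - f y') < e" if y: "y \<in> Y" for y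
  proof -
    have "f y \<in> cball 0 C" using insert.prems[of f y] y by simp
    then obtain z where z: "z \<in> Z" "f y \<in> ball z (e/2)" using Z(2) by blast
    then have yz: "y \<in> Yz z" using y by (simp add: Yz_def)
    then obtain y' where y': "y' \<in> T z" "\<forall>f\<in>\<Phi>. cmod (f y - f y') < e" using T(3) by blast
    have "f y' \<in> ball z (e/2)" using T(2)[of z] y'(1) by (auto simp: Yz_def)
    then have "dist (f y) (f y') < e" using z(2) dist_triangle_half_r[of z "f y" e "f y'"] by simp
    with y' z(1) show ?thesis by (auto simp: dist_norm)
  qed
  moreover have "finite (\<Union>z\<in>Z. T z)" "(\<Union>z\<in>Z. T z) \<subseteq> Y"
    using Z(1) T(1,2) by (auto simp: Yz_def)
  ultimately show ?case by blast
qed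

text \<open>Finite dyadic convex combinations of the tail. Midpoints suffice, since the only infinite
  combinations that matter below have the weights \<open>1/2, 1/4, 1/8, \<dots>\<close>.\<close>

inductive_set tail_means :: "(nat \<Rightarrow> 'b \<Rightarrow> real) \<Rightarrow> nat \<Rightarrow> ('b \<Rightarrow> real) set"
  for f n where
  member: "n \<le> k \<Longrightarrow> f k \<in> tail_means f n"
| mean: "g \<in> tail_means f n \<Longrightarrow> h \<in> tail_means f n \<Longrightarrow> (\<lambda>y. (g y + h y) / 2) \<in> tail_means f n"

lemma tail_means_antimono:
  assumes "g \<in> tail_means f n" "m \<le> n" shows "g \<in> tail_means f m"
  using assms by induction (auto intro: tail_means.intros)

lemma tail_means_bounds:
  assumes "g \<in> tail_means f n" "\<And>k. n \<le> k \<Longrightarrow> 0 \<le> f k y \<and> f k y \<le> (C::real)"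
  shows "0 \<le> g y \<and> g y \<le> C"
  using assms by induction auto

lemma tail_means_eventually_less:
  assumes "g \<in> tail_means f n" "\<And>k. n \<le> k \<Longrightarrow> eventually (\<lambda>y. f k y < d) H"
  shows "eventually (\<lambda>y. g y < d) H"
  using assms(1)
proof induction
  case (mean g h)
  from mean.IH show ?case by eventually_elim auto
qed (rule assms(2))

text \<open>A version of Simons' inequality, which replaces dominated convergence. Choose means \<open>g\<^sub>n\<close> of
  the \<open>n\<close>-th tail such that \<open>h\<^sub>n + g\<^sub>n / 2\<^sup>n\<close> has almost minimal supremum, where
  \<open>h\<^sub>n = \<Sum>\<^sub>k\<^sub><\<^sub>n g\<^sub>k / 2\<^sup>k\<^sup>+\<^sup>1\<close>, and let \<open>S\<close> be the supremum of \<open>h = lim h\<^sub>n\<close>. As \<open>h - h\<^sub>n\<close> is \<open>2\<^sup>-\<^sup>n\<close> times a limit of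
  competitors for \<open>g\<^sub>n\<close>, minimality bounds \<open>h\<^sub>n + g\<^sub>n / 2\<^sup>n = 2 h\<^sub>n\<^sub>+\<^sub>1 - h\<^sub>n\<close> by \<open>S\<close>, up to a small error. At a
  point where \<open>h\<close> is almost \<open>S\<close> this says that \<open>2\<^sup>n (h - h\<^sub>n)\<close> hardly decreases as \<open>n\<close> grows, so
  at \<open>n = 0\<close> it is at most its value at any later \<open>n\<close>. There it is an average of the \<open>g\<^sub>k\<close> with
  \<open>k \<ge> n\<close>, which are small along an ultrafilter of such points. So \<open>S\<close> is small, and so is \<open>g\<^sub>0\<close>.\<close>

lemma small_tail_mean:
  fixes f :: "nat \<Rightarrow> 'b \<Rightarrow> real"
  assumes Y: "Y \<noteq> {}" and bd: "\<And>n y. y \<in> Y \<Longrightarrow> 0 \<le> f n y \<and> f n y \<le> C"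
    and lim: "\<And>H d. ultrafilter_on Y H \<Longrightarrow> d > 0 \<Longrightarrow>
      eventually (\<lambda>n. eventually (\<lambda>y. f n y < d) H) sequentially"
    and "e > 0"
  shows "\<exists>g\<in>tail_means f 0. \<forall>y\<in>Y. g y \<le> e"
proof -
  define d where "d = e / 6"
  have d: "d > 0" using \<open>e > 0\<close> by (simp add: d_def)
  obtain y0 where y0: "y0 \<in> Y" using Y by blast
  have C: "C \<ge> 0" using bd[OF y0] by (meson order_trans)
  define S where "S u = (SUP y\<in>Y. u y)" for u :: "'b \<Rightarrow> real"
  define h where "h g n y = (\<Sum>k<n. g k y / 2^(k+1))" for g :: "nat \<Rightarrow> 'b \<Rightarrow> real" and n y
  have tb: "0 \<le> r y \<and> r y \<le> C" if "r \<in> tail_means f n" "y \<in> Y" for r n y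
    using tail_means_bounds[OF that(1)] bd[OF that(2)] by blast
  have S_upper: "u y \<le> S u" if "y \<in> Y" "\<And>y. y \<in> Y \<Longrightarrow> u y \<le> B" for u y B
    unfolding S_def using that by (intro cSUP_upper bdd_aboveI2[of _ _ B])
  have S_least: "S u \<le> B" if "\<And>y. y \<in> Y \<Longrightarrow> u y \<le> B" for u B
    unfolding S_def using Y that by (intro cSUP_least)
  have h_bound: "0 \<le> h g n y \<and> h g n y \<le> C * (1 - 1/2^n)"
    if "y \<in> Y" "\<And>k. k < n \<Longrightarrow> g k \<in> tail_means f k" for g n y
    using that(2)
  proof (induction n)
    case (Suc n)
    have "0 \<le> g n y" "g n y \<le> C" using tb[OF _ that(1)] Suc.prems by blast+
    then have "g n y / 2^(n+1) \<le> C / 2^(n+1)" "0 \<le> g n y / 2^(n+1)"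
      by (auto intro: divide_right_mono)
    moreover have "h g (Suc n) y = h g n y + g n y / 2^(n+1)" by (simp add: h_def)
    moreover have "C * (1 - 1/2^Suc n) = C * (1 - 1/2^n) + C / 2^(n+1)" by (simp add: field_simps)
    moreover have "0 \<le> h g n y \<and> h g n y \<le> C * (1 - 1/2^n)" using Suc by simp
    ultimately show ?case by linarith
  qed (simp add: h_def)
  \<comment> \<open>the errors \<open>d/4\<^sup>n\<^sup>+\<^sup>1\<close> stay summable after multiplication by \<open>2\<^sup>n\<close>\<close>
  have "\<exists>g. \<forall>n. g n \<in> tail_means f n \<and> (\<forall>r\<in>tail_means f n.
      S (\<lambda>y. h g n y + g n y / 2^n) \<le> S (\<lambda>y. h g n y + r y / 2^n) + d / 4^(n+1))"
  proof (rule dependent_wellorder_choice)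
    fix r and g g' :: "nat \<Rightarrow> 'b \<Rightarrow> real" and n :: nat
    assume eq: "\<And>k. k < n \<Longrightarrow> g k = g' k"
    then have "h g n = h g' n" by (auto simp: h_def fun_eq_iff)
    then show "(r \<in> tail_means f n \<and> (\<forall>q\<in>tail_means f n.
        S (\<lambda>y. h g n y + r y / 2^n) \<le> S (\<lambda>y. h g n y + q y / 2^n) + d / 4^(n+1))) =
      (r \<in> tail_means f n \<and> (\<forall>q\<in>tail_means f n.
        S (\<lambda>y. h g' n y + r y / 2^n) \<le> S (\<lambda>y. h g' n y + q y / 2^n) + d / 4^(n+1)))"
      by simp
  next
    fix n :: nat and g :: "nat \<Rightarrow> 'b \<Rightarrow> real"
    assume g: "\<And>k. k < n \<Longrightarrow> g k \<in> tail_means f k \<and> (\<forall>r\<in>tail_means f k.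
        S (\<lambda>y. h g k y + g k y / 2^k) \<le> S (\<lambda>y. h g k y + r y / 2^k) + d / 4^(k+1))"
    define \<Sigma> where "\<Sigma> r = S (\<lambda>y. h g n y + r y / 2^n)" for r
    have "0 \<le> \<Sigma> r" if r: "r \<in> tail_means f n" for r
    proof -
      have "0 \<le> h g n y0 + r y0 / 2^n"
        using h_bound[OF y0, of n g] g tb[OF r y0] by simp
      also have "\<dots> \<le> \<Sigma> r"
        unfolding \<Sigma>_def
      proof (rule S_upper[OF y0, where B = "C * (1 - 1/2^n) + C / 2^n"])
        show "h g n y + r y / 2^n \<le> C * (1 - 1/2^n) + C / 2^n" if "y \<in> Y" for y
          using h_bound[OF that, of n g] g tb[OF r that]
          by (intro add_mono divide_right_mono) auto
      qed
      finally show ?thesis .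
    qed
    then have bdd: "bdd_below (\<Sigma> ` tail_means f n)" by (intro bdd_belowI2[where m = 0])
    have ne: "\<Sigma> ` tail_means f n \<noteq> {}" using tail_means.member[of n n f] by blast
    have "Inf (\<Sigma> ` tail_means f n) < Inf (\<Sigma> ` tail_means f n) + d / 4^(n+1)" using d by simp
    then obtain r where r: "r \<in> tail_means f n" "\<Sigma> r < Inf (\<Sigma> ` tail_means f n) + d / 4^(n+1)"
      using cInf_lessD[OF ne] by blast
    have "\<Sigma> r \<le> \<Sigma> q + d / 4^(n+1)" if "q \<in> tail_means f n" for q
      using r(2) cInf_lower[OF _ bdd, of "\<Sigma> q"] that by fastforce
    with r(1) show "\<exists>r. r \<in> tail_means f n \<and> (\<forall>q\<in>tail_means f n.
        S (\<lambda>y. h g n y + r y / 2^n) \<le> S (\<lambda>y. h g n y + q y / 2^n) + d / 4^(n+1))"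
      unfolding \<Sigma>_def by blast
  qed
  then obtain g where g: "\<And>n. g n \<in> tail_means f n" and opt: "\<And>n r. r \<in> tail_means f n \<Longrightarrow>
      S (\<lambda>y. h g n y + g n y / 2^n) \<le> S (\<lambda>y. h g n y + r y / 2^n) + d / 4^(n+1)"
    by blast
  have g_bd: "0 \<le> g n y" "g n y \<le> C" if "y \<in> Y" for n y using tb[OF g that] by auto
  have h_mono: "h g n y \<le> h g (n + m) y" if "y \<in> Y" for n m y
    by (induction m) (simp_all add: h_def add_increasing2 g_bd(1)[OF that])
  have h_gap: "h g (n + m) y \<le> h g n y + B / 2^n"
    if "y \<in> Y" "B \<ge> 0" "\<And>k. n \<le> k \<Longrightarrow> k < n + m \<Longrightarrow> g k y \<le> B" for n m y B
  proof -
    have "h g (n + m) y \<le> h g n y + B / 2^n * (1 - 1/2^m)"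
      using that(3)
    proof (induction m)
      case (Suc m)
      have "g (n+m) y / 2^(n+m+1) \<le> B / 2^(n+m+1)"
        using Suc.prems[of "n+m"] by (intro divide_right_mono) auto
      moreover have "h g (n + Suc m) y = h g (n+m) y + g (n+m) y / 2^(n+m+1)" by (simp add: h_def)
      moreover have "B / 2^n * (1 - 1/2^Suc m) = B / 2^n * (1 - 1/2^m) + B / 2^(n+m+1)"
        by (simp add: field_simps power_add)
      moreover have "h g (n + m) y \<le> h g n y + B / 2^n * (1 - 1/2^m)" using Suc by simp
      ultimately show ?case by linarith
    qed simp
    also have "\<dots> \<le> h g n y + B / 2^n * 1"
      using that(2) by (intro add_left_mono mult_left_mono) auto
    finally show ?thesis by simp
  qed
  define hh where "hh y = (SUP n. h g n y)" for y
  have h_bdd: "bdd_above (range (\<lambda>n. h g n y))" if "y \<in> Y" for y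
  proof (rule bdd_aboveI2)
    fix n
    show "h g n y \<le> C" using h_gap[OF that C, of 0 n] g_bd[OF that] by (simp add: h_def)
  qed
  have h_le: "h g n y \<le> hh y" if "y \<in> Y" for n y
    unfolding hh_def by (rule cSUP_upper[OF _ h_bdd[OF that]]) simp
  have hh_le: "hh y \<le> h g n y + C / 2^n" if "y \<in> Y" for n y
    unfolding hh_def
  proof (rule cSUP_least)
    fix m
    show "h g m y \<le> h g n y + C / 2^n"
    proof (cases "m \<le> n")
      case True
      then have "h g m y \<le> h g n y" using h_mono[OF that, of m "n - m"] by simp
      moreover have "0 \<le> C / 2^n" using C by simp
      ultimately show ?thesis by linarith
    next
      case False
      then show ?thesis using h_gap[OF that C, of n "m - n"] g_bd[OF that] by simp
    qed
  qed simp
  have hh_C: "hh y \<le> C" if "y \<in> Y" for y using hh_le[OF that, of 0] by (simp add: h_def)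
  have hh_S: "hh y \<le> S hh" if "y \<in> Y" for y using S_upper[OF that hh_C] .
  \<comment> \<open>\<open>r\<close> is the average of \<open>g\<^sub>n, \<dots>, g\<^sub>n\<^sub>+\<^sub>m\<close> with weights \<open>1/2, 1/4, \<dots>\<close>, the last one doubled\<close>
  have shift: "\<exists>r\<in>tail_means f n. \<forall>y. h g n y + r y / 2^n = h g (n + m) y + g (n + m) y / 2^(n+m)" for n m
  proof (induction m arbitrary: n)
    case 0
    show ?case using g by auto
  next
    case (Suc m)
    obtain r where r: "r \<in> tail_means f (Suc n)"
      "\<And>y. h g (Suc n) y + r y / 2^Suc n = h g (Suc n + m) y + g (Suc n + m) y / 2^(Suc n+m)"
      using Suc.IH[of "Suc n"] by blast
    have "(\<lambda>y. (g n y + r y) / 2) \<in> tail_means f n"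
      by (intro tail_means.mean g tail_means_antimono[OF r(1)]) simp
    moreover have "h g n y + (g n y + r y) / 2 / 2^n = h g (Suc n) y + r y / 2^Suc n" for y
      by (simp add: h_def field_simps)
    ultimately show ?case using r(2) by (intro bexI[of _ "\<lambda>y. (g n y + r y) / 2"]) simp_all
  qed
  have key: "h g n y + g n y / 2^n \<le> S hh + d / 4^(n+1)" if y: "y \<in> Y" for n y
  proof -
    have *: "h g n y + g n y / 2^n \<le> S hh + C / 2^m + d / 4^(n+1)" for m
    proof -
      obtain r where r: "r \<in> tail_means f n"
        "\<And>y. h g n y + r y / 2^n = h g (n + m) y + g (n + m) y / 2^(n+m)" using shift by blast
      have "h g n y + g n y / 2^n \<le> S (\<lambda>y. h g n y + g n y / 2^n)"
      proof (rule S_upper[OF y, where B = "C + C"])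
        fix z assume z: "z \<in> Y"
        have "g n z / 2^n \<le> g n z / 1"
          using g_bd[OF z] by (intro divide_left_mono) auto
        then show "h g n z + g n z / 2^n \<le> C + C"
          using h_le[OF z, of n] hh_C[OF z] g_bd(2)[OF z, of n] by simp
      qed
      also have "\<dots> \<le> S (\<lambda>y. h g n y + r y / 2^n) + d / 4^(n+1)" by (rule opt[OF r(1)])
      also have "S (\<lambda>y. h g n y + r y / 2^n) \<le> S hh + C / 2^m"
      proof (rule S_least)
        fix z assume z: "z \<in> Y"
        have "g (n+m) z / 2^(n+m) \<le> C / 2^m"
          using g_bd[OF z] C by (intro frac_le) auto
        then show "h g n z + r z / 2^n \<le> S hh + C / 2^m"
          using r(2)[of z] h_le[OF z, of "n+m"] hh_S[OF z] by linarith
      qed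
      finally show ?thesis by simp
    qed
    have "(\<lambda>m. S hh + C / 2^m + d / 4^(n+1)) \<longlonglongrightarrow> S hh + 0 + d / 4^(n+1)"
      by (intro tendsto_intros LIMSEQ_divide_realpow_zero) simp
    then show ?thesis using * by (intro LIMSEQ_le_const) auto
  qed
  \<comment> \<open>ultrafilters below \<open>H0\<close> are the points where \<open>h\<close> attains its supremum\<close>
  define H0 where "H0 = (INF \<eta>\<in>{0<..}. principal {y\<in>Y. hh y > S hh - \<eta>})"
  have ev_H0: "eventually P H0 \<longleftrightarrow> (\<exists>\<eta>\<in>{0<..}. \<forall>y\<in>Y. hh y > S hh - \<eta> \<longrightarrow> P y)" for P
    unfolding H0_def
  proof (subst eventually_INF_base)
    fix a b :: real assume "a \<in> {0<..}" "b \<in> {0<..}"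
    then show "\<exists>x\<in>{0<..}. principal {y \<in> Y. S hh - x < hh y}
        \<le> inf (principal {y \<in> Y. S hh - a < hh y}) (principal {y \<in> Y. S hh - b < hh y})"
      by (intro bexI[of _ "min a b"]) auto
  qed (auto simp: eventually_principal intro: exI[of _ 1])
  have "\<exists>y\<in>Y. hh y > S hh - \<eta>" if "\<eta> > 0" for \<eta>
  proof -
    have "bdd_above (hh ` Y)" using hh_C by (intro bdd_aboveI2)
    from less_cSUP_iff[OF Y this, of "S hh - \<eta>"] that show ?thesis by (simp add: S_def)
  qed
  then have "\<not> eventually (\<lambda>_. False) H0" by (auto simp: ev_H0)
  then have "H0 \<noteq> bot" by (simp add: eventually_False)
  moreover have "H0 \<le> principal Y" by (auto simp: le_principal ev_H0 intro: exI[of _ 1])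
  ultimately obtain H where H: "H \<le> H0" "ultrafilter_on Y H"
    by (metis ultrafilter_below)
  obtain n where n: "\<And>k. n \<le> k \<Longrightarrow> eventually (\<lambda>y. f k y < d) H"
    using lim[OF H(2) d] unfolding eventually_sequentially by blast
  have gn: "eventually (\<lambda>y. g k y < d) H" if "n \<le> k" for k
    using tail_means_eventually_less[OF g, of k d H] n that by simp
  have "(\<lambda>m. C / 2^m) \<longlonglongrightarrow> 0" by (rule LIMSEQ_divide_realpow_zero) simp
  from order_tendstoD(2)[OF this d] obtain m where m: "C / 2^m < d"
    unfolding eventually_sequentially by blast
  define \<eta> where "\<eta> = d / 2^n"
  have "eventually (\<lambda>y. y \<in> Y) H" by (rule ultrafilter_onD(2)[OF H(2)])
  moreover have "eventually (\<lambda>y. hh y > S hh - \<eta>) H"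
    using d by (intro filter_leD[OF H(1)]) (auto simp: ev_H0 \<eta>_def intro!: bexI[of _ "d / 2^n"])
  moreover have "eventually (\<lambda>y. \<forall>k\<in>{n..<n+m}. g k y < d) H"
    by (intro eventually_ball_finite) (auto intro: gn)
  ultimately have "eventually (\<lambda>y. y \<in> Y \<and> hh y > S hh - \<eta> \<and> (\<forall>k\<in>{n..<n+m}. g k y < d)) H"
    by eventually_elim simp
  then obtain y where y: "y \<in> Y" "hh y > S hh - \<eta>" and yk: "\<And>k. k\<in>{n..<n+m} \<Longrightarrow> g k y < d"
    using eventually_happens'[OF ultrafilter_onD(1)[OF H(2)]] by blast
  define a where "a k = hh y - h g k y" for k
  have step: "a k \<le> 2 * a (Suc k) + d / 4^(k+1) + \<eta>" for k
  proof -
    define b \<delta> where "b = g k y / 2^k" and "\<delta> = d / 4^(k+1)"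
    have "h g (Suc k) y = h g k y + b / 2" by (simp add: h_def b_def)
    moreover have "h g k y + b \<le> S hh + \<delta>"
      using key[OF y(1), of k] by (simp add: b_def \<delta>_def)
    ultimately have "hh y - h g k y \<le> 2 * (hh y - h g (Suc k) y) + \<delta> + \<eta>" using y(2) by simp
    then show ?thesis by (simp add: a_def \<delta>_def)
  qed
  have a0: "a 0 \<le> 2^k * a k + d * (1 - 1/2^k) + (2^k - 1) * \<eta>" for k
  proof (induction k)
    case (Suc k)
    have "2^k * a k \<le> 2^k * (2 * a (Suc k) + d / 4^(k+1) + \<eta>)"
      by (intro mult_left_mono step) simp
    moreover have "2^k * (d / 4^(k+1)) \<le> d * (1/2^k - 1/2^(Suc k))"
    proof -
      have "(4::real)^k = 2^k * 2^k" by (simp flip: power_mult_distrib)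
      then have "2^k * (d / 4^(k+1)) = d / 2^k / 4" by (simp add: field_simps)
      then show ?thesis using d by (simp add: field_simps)
    qed
    ultimately show ?case using Suc by (simp add: algebra_simps)
  qed simp
  have "hh y \<le> h g (n+m) y + C / 2^(n+m)" by (rule hh_le[OF y(1)])
  moreover have "h g (n+m) y \<le> h g n y + d / 2^n"
    using yk d by (intro h_gap[OF y(1)]) (auto intro: less_imp_le)
  moreover have "C / 2^(n+m) \<le> d / 2^n"
  proof -
    have "C / 2^(n+m) = C / 2^m / 2^n" by (simp add: power_add)
    also have "\<dots> \<le> d / 2^n" using m by (intro divide_right_mono) auto
    finally show ?thesis .
  qed
  ultimately have "a n \<le> 2 * d / 2^n" by (simp add: a_def)
  then have "2^n * a n \<le> 2 * d" by (simp add: field_simps)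
  moreover have "d * (1 - 1/2^n) \<le> d" using d by simp
  moreover have "(2^n - 1) * \<eta> \<le> d" using d by (simp add: \<eta>_def field_simps)
  ultimately have "hh y \<le> 4 * d" using a0[of n] by (simp add: a_def h_def)
  moreover have "\<eta> \<le> d" using d by (simp add: \<eta>_def field_simps)
  ultimately have "S hh \<le> 5 * d" using y(2) by linarith
  then have "g 0 z \<le> e" if "z \<in> Y" for z
    using key[OF that, of 0] d by (simp add: h_def d_def)
  with g[of 0] show ?thesis by blast
qed

text \<open>The selection of Eberlein and Smulian: from an ultrafilter along which \<open>w x\<close> tends to \<open>v\<close>
  pointwise, a sequence is extracted along which it tends to \<open>v\<close> at every ultrafilter on \<open>Y\<close>. Step \<open>n\<close>
  makes \<open>w (x n)\<close> close to \<open>v\<close> on finite sets that approximate all of \<open>Y\<close> as far as \<open>v\<close> and the functions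
  chosen before can tell. A cluster point \<open>f\<close> of the sequence agrees with \<open>v\<close> on all these sets, and the
  interchange of limits extends the agreement to all of \<open>Y\<close>.\<close>

lemma interchange_diagonal_sequence:
  assumes w: "interchange X Y w" and bd: "\<And>x y. x \<in> X \<Longrightarrow> y \<in> Y \<Longrightarrow> cmod (w x y) \<le> C"
    and F: "ultrafilter_on X F" and P: "eventually P F"
    and v: "\<And>y. y \<in> Y \<Longrightarrow> v y = Lim F (\<lambda>x. w x y)"
  obtains x :: "nat \<Rightarrow> 'a" where "\<And>n. x n \<in> X" "\<And>n. P (x n)"
    "\<And>H d. ultrafilter_on Y H \<Longrightarrow> d > 0 \<Longrightarrow>
      eventually (\<lambda>n. eventually (\<lambda>y. cmod (w (x n) y - v y) < d) H) sequentially"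
proof -
  have v_bd: "cmod (v y) \<le> C" if "y \<in> Y" for y
    unfolding v[OF that] by (rule Lim_norm_le[OF F]) (simp add: bd that)
  have v_lim: "((\<lambda>x. w x y) \<longlongrightarrow> v y) F" if "y \<in> Y" for y
    unfolding v[OF that] by (rule ultrafilter_tendsto[OF F, where K = C]) (simp add: bd that)
  have "\<exists>T. finite T \<and> T \<subseteq> Y \<and>
      (\<forall>y\<in>Y. \<exists>y'\<in>T. \<forall>f\<in>insert v (w ` S). cmod (f y - f y') < 1 / real (k+1))"
    if "finite S" "S \<subseteq> X" for S and k :: nat
    using that bd v_bd by (intro finite_net_for_finite_family[where C = C]) auto
  then obtain T where T: "\<And>S k. finite S \<Longrightarrow> S \<subseteq> X \<Longrightarrow> finite (T S k) \<and> T S k \<subseteq> Y \<and>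
      (\<forall>y\<in>Y. \<exists>y'\<in>T S k. \<forall>f\<in>insert v (w ` S). cmod (f y - f y') < 1 / real (k+1))"
    by metis
  have "\<exists>x. \<forall>n. x n \<in> X \<and> P (x n) \<and>
    (\<forall>k\<le>n. \<forall>y\<in>T (x ` {..<k}) k. cmod (w (x n) y - v y) < 1 / real (n+1))"
  proof (rule dependent_wellorder_choice)
    fix r and x x' :: "nat \<Rightarrow> 'a" and n :: nat
    assume eq: "\<And>k. k < n \<Longrightarrow> x k = x' k"
    then have "x ` {..<k} = x' ` {..<k}" if "k \<le> n" for k using that by auto
    then show "(r \<in> X \<and> P r \<and>
        (\<forall>k\<le>n. \<forall>y\<in>T (x ` {..<k}) k. cmod (w r y - v y) < 1 / real (n+1))) =
      (r \<in> X \<and> P r \<and>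
        (\<forall>k\<le>n. \<forall>y\<in>T (x' ` {..<k}) k. cmod (w r y - v y) < 1 / real (n+1)))"
      by auto
  next
    fix n and x :: "nat \<Rightarrow> 'a"
    assume x: "\<And>k. k < n \<Longrightarrow> x k \<in> X \<and> P (x k) \<and>
      (\<forall>j\<le>k. \<forall>y\<in>T (x ` {..<j}) j. cmod (w (x k) y - v y) < 1 / real (k+1))"
    have Tk: "finite (T (x ` {..<k}) k)" "T (x ` {..<k}) k \<subseteq> Y" if "k \<le> n" for k
    proof -
      have "x ` {..<k} \<subseteq> X" using x that by auto
      with T[of "x ` {..<k}" k] show "finite (T (x ` {..<k}) k)" "T (x ` {..<k}) k \<subseteq> Y" by auto
    qed
    have "eventually (\<lambda>r. \<forall>k\<in>{..n}. \<forall>y\<in>T (x ` {..<k}) k. cmod (w r y - v y) < 1 / real (n+1)) F"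
    proof (intro eventually_ball_finite ballI)
      fix k y assume "k \<in> {..n}" "y \<in> T (x ` {..<k}) k"
      then have "y \<in> Y" using Tk by auto
      from tendstoD[OF v_lim[OF this], of "1 / real (n+1)"]
      show "eventually (\<lambda>r. cmod (w r y - v y) < 1 / real (n+1)) F" by (simp add: dist_norm)
    qed (use Tk in auto)
    with P ultrafilter_onD(2)[OF F]
    have "eventually (\<lambda>r. r \<in> X \<and> P r \<and>
        (\<forall>k\<le>n. \<forall>y\<in>T (x ` {..<k}) k. cmod (w r y - v y) < 1 / real (n+1))) F"
      by eventually_elim auto
    then show "\<exists>r. r \<in> X \<and> P r \<and>
        (\<forall>k\<le>n. \<forall>y\<in>T (x ` {..<k}) k. cmod (w r y - v y) < 1 / real (n+1))"
      using eventually_happens'[OF ultrafilter_onD(1)[OF F]] by blast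
  qed
  then obtain x where xX: "\<And>n. x n \<in> X" and xP: "\<And>n. P (x n)"
    and xT: "\<And>n k y. k \<le> n \<Longrightarrow> y \<in> T (x ` {..<k}) k \<Longrightarrow> cmod (w (x n) y - v y) < 1 / real (n+1)"
    by blast
  have "eventually (\<lambda>n. eventually (\<lambda>y. cmod (w (x n) y - v y) < d) H) sequentially"
    if H: "ultrafilter_on Y H" and d: "d > 0" for H d
  proof (rule eventually_by_ultrafilters)
    fix U :: "nat filter" assume U: "U \<le> sequentially" "ultrafilter_on UNIV U"
    show "eventually (\<lambda>n. eventually (\<lambda>y. cmod (w (x n) y - v y) < d) H) U"
    proof (rule ccontr)
      assume "\<not> ?thesis"
      then have bad: "eventually (\<lambda>n. eventually (\<lambda>y. cmod (w (x n) y - v y) \<ge> d) H) U"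
        by (simp add: ultrafilter_onD(3)[OF U(2)] ultrafilter_onD(3)[OF H] not_less)
      define A where "A = filtermap x U"
      have A: "ultrafilter_on X A"
        unfolding A_def using U(2) xX by (rule ultrafilter_on_filtermap)
      define f where "f y = Lim A (\<lambda>x. w x y)" for y
      have f_bd: "cmod (f y) \<le> C" if "y \<in> Y" for y
        unfolding f_def by (rule Lim_norm_le[OF A]) (simp add: bd that)
      have f_lim: "((\<lambda>n. w (x n) y) \<longlongrightarrow> f y) U" if "y \<in> Y" for y
      proof -
        have "((\<lambda>x. w x y) \<longlongrightarrow> f y) A"
          unfolding f_def by (rule ultrafilter_tendsto[OF A, where K = C]) (simp add: bd that)
        then show ?thesis by (simp add: A_def filterlim_filtermap)
      qed
      \<comment> \<open>\<open>f = v\<close> on \<open>Y\<close>: both agree on the nets, whose points converge to any given one\<close>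
      have fv: "f y = v y" if y: "y \<in> Y" for y
      proof -
        have "\<exists>z. z \<in> T (x ` {..<k}) k \<and> cmod (v y - v z) < 1 / real (k+1) \<and>
            (\<forall>n<k. cmod (w (x n) y - w (x n) z) < 1 / real (k+1))" for k
        proof -
          obtain z where z: "z \<in> T (x ` {..<k}) k"
            "\<And>f. f \<in> insert v (w ` x ` {..<k}) \<Longrightarrow> cmod (f y - f z) < 1 / real (k+1)"
          proof -
            have "x ` {..<k} \<subseteq> X" using xX by blast
            then have "\<forall>y\<in>Y. \<exists>y'\<in>T (x ` {..<k}) k. \<forall>f\<in>insert v (w ` x ` {..<k}).
                cmod (f y - f y') < 1 / real (k+1)"
              using T[of "x ` {..<k}" k] by simp
            with y that show ?thesis by meson
          qed
          have "cmod (w (x n) y - w (x n) z) < 1 / real (k+1)" if "n < k" for n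
            using z(2)[of "w (x n)"] that by blast
          with z show ?thesis by blast
        qed
        then obtain z where z: "\<And>k. z k \<in> T (x ` {..<k}) k"
          and zv: "\<And>k. cmod (v y - v (z k)) < 1 / real (k+1)"
          and zw: "\<And>k n. n < k \<Longrightarrow> cmod (w (x n) y - w (x n) (z k)) < 1 / real (k+1)"
          by metis
        have zY: "z k \<in> Y" for k
        proof -
          have "x ` {..<k} \<subseteq> X" using xX by blast
          then have "T (x ` {..<k}) k \<subseteq> Y" using T[of "x ` {..<k}" k] by simp
          with z[of k] show ?thesis by (rule subsetD[rotated])
        qed
        have fz: "f (z k) = v (z k)" for k
        proof -
          have "((\<lambda>n. w (x n) (z k) - v (z k)) \<longlongrightarrow> 0) sequentially"
          proof (rule Lim_null_comparison)
            show "\<forall>\<^sub>F n in sequentially. norm (w (x n) (z k) - v (z k)) \<le> inverse (real (Suc n))"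
              using eventually_ge_at_top[of k]
              by eventually_elim (use xT z in \<open>auto simp: inverse_eq_divide intro: less_imp_le\<close>)
          qed (rule LIMSEQ_inverse_real_of_nat)
          then have "((\<lambda>n. w (x n) (z k) - v (z k)) \<longlongrightarrow> 0) U" using U(1) by (rule tendsto_mono[rotated])
          then have "((\<lambda>n. w (x n) (z k)) \<longlongrightarrow> v (z k)) U" by (rule LIM_zero_cancel)
          with f_lim[OF zY] show ?thesis
            using tendsto_unique ultrafilter_onD(1)[OF U(2)] by blast
        qed
        define B where "B = filtermap z U"
        have B: "ultrafilter_on Y B" unfolding B_def using U(2) zY by (rule ultrafilter_on_filtermap)
        have close: "(\<lambda>k. g (z k)) \<longlonglongrightarrow> g y"
          if "\<And>k. k > n \<Longrightarrow> cmod (g y - g (z k)) < 1 / real (k+1)" for g :: "'b \<Rightarrow> complex" and n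
        proof -
          have "((\<lambda>k. g (z k) - g y) \<longlongrightarrow> 0) sequentially"
          proof (rule Lim_null_comparison)
            show "\<forall>\<^sub>F k in sequentially. norm (g (z k) - g y) \<le> inverse (real (Suc k))"
              using eventually_gt_at_top[of n]
            proof eventually_elim
              case (elim k)
              show ?case using that[OF elim] by (simp add: inverse_eq_divide norm_minus_commute)
            qed
          qed (rule LIMSEQ_inverse_real_of_nat)
          then show ?thesis by (rule LIM_zero_cancel)
        qed
        have "(v \<longlongrightarrow> v y) B"
          unfolding B_def filterlim_filtermap by (rule tendsto_mono[OF U(1) close[of 0 v]]) (rule zv)
        then have "Lim B v = v y" by (rule ultrafilter_Lim_eqI[OF B])
        moreover have "Lim B f = Lim B v"
          unfolding B_def Lim_filtermap fz ..
        moreover have "Lim B f = f y"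
        proof -
          have "Lim B (\<lambda>y. Lim A (\<lambda>x. w x y)) = Lim A (\<lambda>x. Lim B (\<lambda>y. w x y))"
            using interchangeD[OF w A B] by simp
          also have "\<dots> = Lim U (\<lambda>n. Lim B (w (x n)))" by (simp add: A_def Lim_filtermap)
          also have "\<dots> = Lim U (\<lambda>n. w (x n) y)"
          proof -
            have "(w (x n) \<longlongrightarrow> w (x n) y) B" for n
              unfolding B_def filterlim_filtermap
              by (rule tendsto_mono[OF U(1) close[of n "w (x n)"]]) (rule zw)
            then have "Lim B (w (x n)) = w (x n) y" for n by (rule ultrafilter_Lim_eqI[OF B])
            then show ?thesis by simp
          qed
          also have "\<dots> = f y" by (rule ultrafilter_Lim_eqI[OF U(2) f_lim[OF y]])
          finally show ?thesis by (simp add: f_def[abs_def])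
        qed
        ultimately show ?thesis by simp
      qed
      have "Lim H v = Lim H f" by (rule Lim_cong_on[OF H]) (simp add: fv)
      also have "\<dots> = Lim A (\<lambda>x. Lim H (w x))" unfolding f_def using interchangeD[OF w A H] by simp
      also have "\<dots> = Lim U (\<lambda>n. Lim H (w (x n)))" by (simp add: A_def Lim_filtermap)
      finally have eq: "Lim H v = Lim U (\<lambda>n. Lim H (w (x n)))" .
      have "((\<lambda>n. Lim H (w (x n))) \<longlongrightarrow> Lim H v) U"
        unfolding eq
        by (rule ultrafilter_tendsto[OF U(2), where K = C]) (auto intro!: Lim_norm_le[OF H] bd xX)
      from tendstoD[OF this d] have "eventually (\<lambda>n. dist (Lim H (w (x n))) (Lim H v) < d) U" .
      with bad have "eventually (\<lambda>n. False) U"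
      proof eventually_elim
        case (elim n)
        have "((\<lambda>y. w (x n) y - v y) \<longlongrightarrow> Lim H (w (x n)) - Lim H v) H"
          by (intro tendsto_diff ultrafilter_tendsto[OF H, where K = C]) (auto intro: bd xX v_bd)
        then have "((\<lambda>y. cmod (w (x n) y - v y)) \<longlongrightarrow> cmod (Lim H (w (x n)) - Lim H v)) H"
          by (rule tendsto_norm)
        then have "d \<le> cmod (Lim H (w (x n)) - Lim H v)"
          by (rule tendsto_lowerbound[OF _ elim(1)]) (use ultrafilter_onD(1)[OF H] in auto)
        with elim(2) show False by (simp add: dist_norm)
      qed
      then show False using ultrafilter_onD(1)[OF U(2)] by (simp add: eventually_False)
    qed
  qed
  with xX xP that show ?thesis by blast
qed

text \<open>If \<open>\<phi> (w x - v)\<close> does not tend to \<open>0\<close>, then after a rotation its real part stays above a positive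
  constant on a set of the ultrafilter, and so does \<open>\<phi>\<close> on all convex combinations. But some convex
  combination of the absolute values along the extracted sequence is uniformly small.\<close>

lemma interchange_functional_continuity:
  fixes \<phi> :: "('b \<Rightarrow> complex) \<Rightarrow> complex"
  assumes w: "interchange X Y w" and bd: "\<And>x y. x \<in> X \<Longrightarrow> y \<in> Y \<Longrightarrow> cmod (w x y) \<le> C"
    and F: "ultrafilter_on X F" and v: "\<And>y. y \<in> Y \<Longrightarrow> v y = Lim F (\<lambda>x. w x y)"
    and Y: "Y \<noteq> {}" and L: "linear_subspace L" "\<And>x. x \<in> X \<Longrightarrow> w x \<in> L" "v \<in> L"
    and add: "\<And>f g. f \<in> L \<Longrightarrow> g \<in> L \<Longrightarrow> \<phi> (\<lambda>t. f t + g t) = \<phi> f + \<phi> g"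
    and scal: "\<And>c f. f \<in> L \<Longrightarrow> \<phi> (\<lambda>t. c * f t) = c * \<phi> f"
    and \<phi>_bd: "\<And>f B. f \<in> L \<Longrightarrow> (\<And>y. y \<in> Y \<Longrightarrow> cmod (f y) \<le> B) \<Longrightarrow> cmod (\<phi> f) \<le> K * B"
    and K: "K \<ge> 0"
  shows "((\<lambda>x. \<phi> (w x)) \<longlongrightarrow> \<phi> v) F"
proof -
  have L_add: "(\<lambda>t. f t + g t) \<in> L" if "f \<in> L" "g \<in> L" for f g
    using L(1) that by (auto simp: linear_subspace_def)
  have L_scal: "(\<lambda>t. c * f t) \<in> L" if "f \<in> L" for f c
    using L(1) that by (auto simp: linear_subspace_def)
  define D where "D x = (\<lambda>t. w x t + (-1) * v t)" for x
  have D_L: "D x \<in> L" if "x \<in> X" for x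
    unfolding D_def using that by (intro L_add L_scal L)
  have \<phi>_D: "\<phi> (D x) = \<phi> (w x) - \<phi> v" if "x \<in> X" for x
    unfolding D_def add[OF L(2)[OF that] L_scal[OF L(3)]] scal[OF L(3)] by simp
  have v_bd: "cmod (v y) \<le> C" if "y \<in> Y" for y
    unfolding v[OF that] by (rule Lim_norm_le[OF F]) (simp add: bd that)
  have D_bd: "cmod (D x y) \<le> C + C" if "x \<in> X" "y \<in> Y" for x y
    using norm_triangle_ineq4[of "w x y" "v y"] bd[OF that] v_bd[OF that(2)] by (simp add: D_def)
  define d where "d = Lim F (\<lambda>x. \<phi> (D x))"
  have d_lim: "((\<lambda>x. \<phi> (D x)) \<longlongrightarrow> d) F"
    unfolding d_def by (rule ultrafilter_tendsto[OF F \<phi>_bd]) (auto intro: D_L D_bd)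
  have "d = 0"
  proof (rule ccontr)
    assume "d \<noteq> 0"
    then have d: "cmod d > 0" by simp
    have "((\<lambda>x. Re (cnj d * \<phi> (D x))) \<longlongrightarrow> Re (cnj d * d)) F"
      by (intro tendsto_intros d_lim)
    moreover have "Re (cnj d * d) = (cmod d)^2" by (simp add: cmod_power2) (simp add: power2_eq_square)
    ultimately have "eventually (\<lambda>x. Re (cnj d * \<phi> (D x)) > (cmod d)^2 / 2) F"
      using d by (intro order_tendstoD(1)[where y = "Re (cnj d * d)"]) auto
    with ultrafilter_onD(2)[OF F]
    have ev: "eventually (\<lambda>x. x \<in> X \<and> Re (cnj d * \<phi> (D x)) > (cmod d)^2 / 2) F"
      by eventually_elim auto
    obtain x where x: "\<And>n. x n \<in> X" "\<And>n. x n \<in> X \<and> Re (cnj d * \<phi> (D (x n))) > (cmod d)^2 / 2"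
      and x_lim: "\<And>H d. ultrafilter_on Y H \<Longrightarrow> d > 0 \<Longrightarrow>
        eventually (\<lambda>n. eventually (\<lambda>y. cmod (w (x n) y - v y) < d) H) sequentially"
      by (rule interchange_diagonal_sequence[OF w bd F ev v]) blast+
    define f where "f n y = cmod (D (x n) y)" for n y
    define e where "e = cmod d / (2 * (K + 1))"
    have e: "e > 0" using d K by (simp add: e_def)
    have "\<exists>g\<in>tail_means f 0. \<forall>y\<in>Y. g y \<le> e"
    proof (rule small_tail_mean[OF Y _ _ e, where C = "C + C"])
      show "0 \<le> f n y \<and> f n y \<le> C + C" if "y \<in> Y" for n y
        using D_bd[OF x(1) that] by (simp add: f_def[abs_def])
      show "eventually (\<lambda>n. eventually (\<lambda>y. f n y < d') H) sequentially"
        if "ultrafilter_on Y H" "d' > 0" for H d'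
        using x_lim[OF that] by (simp add: f_def D_def)
    qed
    then obtain g where g: "g \<in> tail_means f 0" "\<And>y. y \<in> Y \<Longrightarrow> g y \<le> e" by blast
    have "\<exists>h\<in>L. (\<forall>y. cmod (h y) \<le> g y) \<and> Re (cnj d * \<phi> h) > (cmod d)^2 / 2"
      using g(1)
    proof induction
      case (member k)
      then show ?case using x D_L by (intro bexI[of _ "D (x k)"]) (auto simp: f_def)
    next
      case (mean g1 g2)
      obtain h1 h2 where h: "h1 \<in> L" "h2 \<in> L" "\<And>y. cmod (h1 y) \<le> g1 y" "\<And>y. cmod (h2 y) \<le> g2 y"
        "Re (cnj d * \<phi> h1) > (cmod d)^2 / 2" "Re (cnj d * \<phi> h2) > (cmod d)^2 / 2"
        using mean.IH by blast
      define h where "h = (\<lambda>t. (1/2) * h1 t + (1/2) * h2 t)"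
      have "h \<in> L" unfolding h_def by (intro L_add L_scal h)
      moreover have "cmod (h y) \<le> (g1 y + g2 y) / 2" for y
        using norm_triangle_ineq[of "h1 y / 2" "h2 y / 2"] h(3)[of y] h(4)[of y]
        by (simp add: h_def norm_divide)
      moreover have "\<phi> h = (1/2) * \<phi> h1 + (1/2) * \<phi> h2"
        unfolding h_def add[OF L_scal[OF h(1)] L_scal[OF h(2)]] scal[OF h(1)] scal[OF h(2)] ..
      moreover have "Re (cnj d * ((1/2) * a + (1/2) * b)) = (Re (cnj d * a) + Re (cnj d * b)) / 2"
        for a b by (simp add: algebra_simps add_divide_distrib diff_divide_distrib)
      ultimately have "h \<in> L" "\<And>y. cmod (h y) \<le> (g1 y + g2 y) / 2"
        "Re (cnj d * \<phi> h) = (Re (cnj d * \<phi> h1) + Re (cnj d * \<phi> h2)) / 2"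
        by simp_all
      then show ?case using h(5,6) by (intro bexI[of _ h]) auto
    qed
    then obtain h where h: "h \<in> L" "\<And>y. cmod (h y) \<le> g y" "Re (cnj d * \<phi> h) > (cmod d)^2 / 2"
      by blast
    have "cmod (\<phi> h) \<le> K * e"
      using h(1) by (rule \<phi>_bd) (use h(2) g(2) in \<open>blast intro: order_trans\<close>)
    also have "K * e \<le> cmod d / 2" using K d by (simp add: e_def field_simps)
    finally have "cmod d * cmod (\<phi> h) \<le> cmod d * (cmod d / 2)" by (intro mult_left_mono) auto
    moreover have "Re (cnj d * \<phi> h) \<le> cmod d * cmod (\<phi> h)"
      using complex_Re_le_cmod[of "cnj d * \<phi> h"] by (simp add: norm_mult)
    ultimately show False using h(3) by (simp add: power2_eq_square)
  qed
  have "eventually (\<lambda>x. \<phi> (D x) = \<phi> (w x) - \<phi> v) F"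
    using ultrafilter_onD(2)[OF F] by eventually_elim (rule \<phi>_D)
  with d_lim \<open>d = 0\<close> have "((\<lambda>x. \<phi> (w x) - \<phi> v) \<longlongrightarrow> 0) F" using tendsto_cong by fastforce
  then show ?thesis by (rule LIM_zero_cancel)
qed

text \<open>Limits of a countable family \<open>w (x c)\<close> form a separable set for the uniform norm. Each limit
  function is determined, uniformly on \<open>Y\<close> up to \<open>e/4\<close>, by finitely many members of the family:
  otherwise two ultrafilters on \<open>Y\<close> would agree on the whole family but not on the limit. As there are
  uncountably many limits, infinitely many of them share the same finite set of members; these functions are
  controlled by their values on one finite subset of \<open>Y\<close>, and two of them must be close there.\<close>

lemma interchange_limits_cluster:
  fixes x :: "'c::countable \<Rightarrow> 'a" and U :: "'i \<Rightarrow> 'c filter"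
  assumes w: "interchange X Y w" and bd: "\<And>x y. x \<in> X \<Longrightarrow> y \<in> Y \<Longrightarrow> cmod (w x y) \<le> C"
    and x: "\<And>c. x c \<in> X" and U: "\<And>i. i \<in> I \<Longrightarrow> ultrafilter_on UNIV (U i)"
    and I: "uncountable I" and e: "e > 0"
  shows "\<exists>i\<in>I. \<exists>j\<in>I. i \<noteq> j \<and>
    (\<forall>y\<in>Y. cmod (Lim (U i) (\<lambda>c. w (x c) y) - Lim (U j) (\<lambda>c. w (x c) y)) < e)"
proof -
  define f where "f i y = Lim (U i) (\<lambda>c. w (x c) y)" for i y
  have f_bd: "cmod (f i y) \<le> C" if "i \<in> I" "y \<in> Y" for i y
    unfolding f_def by (rule Lim_norm_le[OF U[OF that(1)]]) (simp add: bd x that)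
  define M where "M i n \<longleftrightarrow> (\<forall>y\<in>Y. \<forall>z\<in>Y.
    (\<forall>c. to_nat c \<le> n \<longrightarrow> cmod (w (x c) y - w (x c) z) < 1 / real (n+1)) \<longrightarrow>
      cmod (f i y - f i z) < e/4)" for i n
  have "\<exists>n. M i n" if i: "i \<in> I" for i
  proof (rule ccontr)
    assume "\<not> ?thesis"
    then have "\<forall>n. \<exists>y z. y \<in> Y \<and> z \<in> Y \<and>
      (\<forall>c. to_nat c \<le> n \<longrightarrow> cmod (w (x c) y - w (x c) z) < 1 / real (n+1)) \<and>
      \<not> cmod (f i y - f i z) < e/4"
      unfolding M_def by blast
    then obtain y z where yz: "\<And>n. y n \<in> Y" "\<And>n. z n \<in> Y"
      "\<And>n c. to_nat c \<le> n \<Longrightarrow> cmod (w (x c) (y n) - w (x c) (z n)) < 1 / real (n+1)"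
      "\<And>n. \<not> cmod (f i (y n) - f i (z n)) < e/4"
      by metis
    obtain V :: "nat filter" where "V \<le> sequentially" "ultrafilter_on UNIV V"
      by (rule ultrafilter_below[OF trivial_limit_sequentially]) auto
    note V = this
    have lim: "(\<lambda>n. w (x c) (y n) - w (x c) (z n)) \<longlonglongrightarrow> 0" for c
    proof (rule Lim_null_comparison)
      show "\<forall>\<^sub>F n in sequentially. norm (w (x c) (y n) - w (x c) (z n)) \<le> inverse (real (Suc n))"
        using eventually_ge_at_top[of "to_nat c"]
      proof eventually_elim
        case (elim n)
        show ?case using yz(3)[OF elim] by (simp add: inverse_eq_divide)
      qed
    qed (rule LIMSEQ_inverse_real_of_nat)
    define A where "A = filtermap x (U i)"
    have A: "ultrafilter_on X A" unfolding A_def using U[OF i] x by (rule ultrafilter_on_filtermap)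
    have conv: "((\<lambda>n. g (q n)) \<longlongrightarrow> Lim V (\<lambda>n. g (q n))) V"
      if "\<And>n. q n \<in> Y" "\<And>y. y \<in> Y \<Longrightarrow> cmod (g y) \<le> C" for g :: "'b \<Rightarrow> complex" and q
      using that by (intro ultrafilter_tendsto[OF V(2), where K = C]) auto
    have sw: "Lim V (\<lambda>n. f i (q n)) = Lim (U i) (\<lambda>c. Lim V (\<lambda>n. w (x c) (q n)))"
      if "\<And>n. q n \<in> Y" for q
    proof -
      have "ultrafilter_on Y (filtermap q V)" using V(2) that by (rule ultrafilter_on_filtermap)
      from interchangeD[OF w A this] show ?thesis by (simp add: A_def Lim_filtermap f_def)
    qed
    have "Lim V (\<lambda>n. w (x c) (y n)) = Lim V (\<lambda>n. w (x c) (z n))" for c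
    proof -
      have "((\<lambda>n. w (x c) (y n) - w (x c) (z n)) \<longlongrightarrow>
          Lim V (\<lambda>n. w (x c) (y n)) - Lim V (\<lambda>n. w (x c) (z n))) V"
        by (intro tendsto_diff conv) (auto intro: yz bd x)
      moreover have "((\<lambda>n. w (x c) (y n) - w (x c) (z n)) \<longlongrightarrow> 0) V"
        using lim V(1) by (rule tendsto_mono[rotated])
      ultimately show ?thesis using tendsto_unique ultrafilter_onD(1)[OF V(2)] by fastforce
    qed
    then have "Lim V (\<lambda>n. f i (y n)) = Lim V (\<lambda>n. f i (z n))" by (simp add: sw yz)
    moreover have "((\<lambda>n. cmod (f i (y n) - f i (z n))) \<longlongrightarrow>
        cmod (Lim V (\<lambda>n. f i (y n)) - Lim V (\<lambda>n. f i (z n)))) V"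
      by (intro tendsto_norm tendsto_diff conv) (auto intro: yz f_bd i)
    then have "e/4 \<le> cmod (Lim V (\<lambda>n. f i (y n)) - Lim V (\<lambda>n. f i (z n)))"
      by (rule tendsto_lowerbound) (use yz(4) ultrafilter_onD(1)[OF V(2)] in \<open>auto simp: not_less\<close>)
    ultimately show False using e by simp
  qed
  then have "I \<subseteq> (\<Union>n. {i\<in>I. M i n})" by blast
  then have "\<not> (\<forall>n. countable {i\<in>I. M i n})"
    using I countable_subset[of I "\<Union>n. {i\<in>I. M i n}"] by auto
  then obtain n where n: "uncountable {i\<in>I. M i n}" by blast
  define J where "J = {i\<in>I. M i n}"
  have J: "infinite J" using n countable_finite unfolding J_def by blast
  have fin: "finite {c::'c. to_nat c \<le> n}"
    using finite_vimageI[of "{..n}" "to_nat :: 'c \<Rightarrow> nat"] by (simp add: vimage_def atMost_def)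
  have "\<exists>T. finite T \<and> T \<subseteq> Y \<and> (\<forall>y\<in>Y. \<exists>z\<in>T.
    \<forall>f\<in>(\<lambda>c. w (x c)) ` {c. to_nat c \<le> n}. cmod (f y - f z) < 1 / real (n+1))"
    using fin bd x by (intro finite_net_for_finite_family[where C = C]) auto
  then obtain T where T: "finite T" "T \<subseteq> Y" "\<And>y. y \<in> Y \<Longrightarrow>
    \<exists>z\<in>T. \<forall>f\<in>(\<lambda>c. w (x c)) ` {c. to_nat c \<le> n}. cmod (f y - f z) < 1 / real (n+1)"
    by blast
  have "\<exists>J'. finite J' \<and> J' \<subseteq> J \<and>
    (\<forall>i\<in>J. \<exists>j\<in>J'. \<forall>f\<in>(\<lambda>z i. f i z) ` T. cmod (f i - f j) < e/4)"
    using T(1,2) f_bd e by (intro finite_net_for_finite_family[where C = C]) (auto simp: J_def)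
  then obtain J' where J': "finite J'" "J' \<subseteq> J" "\<And>i. i \<in> J \<Longrightarrow>
    \<exists>j\<in>J'. \<forall>f\<in>(\<lambda>z i. f i z) ` T. cmod (f i - f j) < e/4"
    by blast
  have "\<not> J \<subseteq> J'" using J finite_subset[OF _ J'(1), of J] by blast
  then obtain i where i: "i \<in> J" "i \<notin> J'" by blast
  obtain j where j: "j \<in> J'" "\<And>z. z \<in> T \<Longrightarrow> cmod (f i z - f j z) < e/4" using J'(3)[OF i(1)] by auto
  have "cmod (f i y - f j y) < e" if y: "y \<in> Y" for y
  proof -
    obtain z where z: "z \<in> T" "\<And>c. to_nat c \<le> n \<Longrightarrow> cmod (w (x c) y - w (x c) z) < 1 / real (n+1)"
      using T(3)[OF y] by auto
    have "cmod (f i y - f i z) < e/4" "cmod (f j y - f j z) < e/4"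
      using i(1) j(1) J'(2) y z T(2) unfolding J_def M_def by blast+
    moreover have "f i y - f j y = (f i y - f i z) + ((f i z - f j z) - (f j y - f j z))" by simp
    then have "cmod (f i y - f j y) \<le> cmod (f i y - f i z) + (cmod (f i z - f j z) + cmod (f j y - f j z))"
      by (metis (no_types) norm_triangle_ineq norm_triangle_ineq4 add_left_mono order_trans)
    ultimately show ?thesis using j(2)[OF z(1)] e by linarith
  qed
  moreover have "i \<in> I" "j \<in> I" "i \<noteq> j" using i j(1) J'(2) by (auto simp: J_def)
  ultimately show ?thesis unfolding f_def by (intro bexI[of _ i] bexI[of _ j]) auto
qed

lemma interchange_swap: "interchange X Y w \<Longrightarrow> interchange Y X (\<lambda>y x. w x y)"
  unfolding interchange_def by metis

lemma interchange_cong: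
  assumes "\<And>x y. x \<in> X \<Longrightarrow> y \<in> Y \<Longrightarrow> w x y = w' x y"
  shows "interchange X Y w \<longleftrightarrow> interchange X Y w'"
proof -
  have "Lim A (\<lambda>x. Lim B (w x)) = Lim A (\<lambda>x. Lim B (w' x)) \<and>
    Lim B (\<lambda>y. Lim A (\<lambda>x. w x y)) = Lim B (\<lambda>y. Lim A (\<lambda>x. w' x y))"
    if "ultrafilter_on X A" "ultrafilter_on Y B" for A B
    using that assms by (auto intro!: Lim_cong_on)
  then show ?thesis unfolding interchange_def by metis
qed

lemma interchange_reindex:
  assumes "interchange X Y w" "\<And>x. x \<in> X' \<Longrightarrow> f x \<in> X" "\<And>y. y \<in> Y' \<Longrightarrow> g y \<in> Y"
  shows "interchange X' Y' (\<lambda>x y. w (f x) (g y))"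
  unfolding interchange_def
proof (intro allI impI, elim conjE)
  fix A B assume A: "ultrafilter_on X' A" and B: "ultrafilter_on Y' B"
  have "ultrafilter_on X (filtermap f A)" "ultrafilter_on Y (filtermap g B)"
    using ultrafilter_on_filtermap[OF A] ultrafilter_on_filtermap[OF B] assms by blast+
  from interchangeD[OF assms(1) this]
  show "Lim A (\<lambda>x. Lim B (\<lambda>y. w (f x) (g y))) = Lim B (\<lambda>y. Lim A (\<lambda>x. w (f x) (g y)))"
    by (simp add: Lim_filtermap)
qed

text \<open>Continuous functions commute with limits. Two arguments and a closed domain \<open>S\<close> cover sums,
  products, conjugates and reciprocals at once.\<close>

lemma interchange_continuous_image:
  fixes h :: "complex \<times> complex \<Rightarrow> complex"
  assumes w: "interchange X Y w" "\<And>x y. x \<in> X \<Longrightarrow> y \<in> Y \<Longrightarrow> cmod (w x y) \<le> C"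
    and w': "interchange X Y w'" "\<And>x y. x \<in> X \<Longrightarrow> y \<in> Y \<Longrightarrow> cmod (w' x y) \<le> C'"
    and S: "closed S" "continuous_on S h" "\<And>x y. x \<in> X \<Longrightarrow> y \<in> Y \<Longrightarrow> (w x y, w' x y) \<in> S"
  shows "interchange X Y (\<lambda>x y. h (w x y, w' x y))"
  unfolding interchange_def
proof (intro allI impI, elim conjE)
  fix A B assume A: "ultrafilter_on X A" and B: "ultrafilter_on Y B"
  have one: "(Lim F f, Lim F g) \<in> S \<and> Lim F (\<lambda>z. h (f z, g z)) = h (Lim F f, Lim F g)"
    if F: "ultrafilter_on Z F" and bd: "\<And>z. z \<in> Z \<Longrightarrow> cmod (f z) \<le> C" "\<And>z. z \<in> Z \<Longrightarrow> cmod (g z) \<le> C'"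
      and in_S: "\<And>z. z \<in> Z \<Longrightarrow> (f z, g z) \<in> S" for Z :: "'z set" and F f g
  proof -
    have lim: "((\<lambda>z. (f z, g z)) \<longlongrightarrow> (Lim F f, Lim F g)) F"
      by (intro tendsto_Pair ultrafilter_tendsto[OF F bd(1)] ultrafilter_tendsto[OF F bd(2)])
    have ev: "eventually (\<lambda>z. (f z, g z) \<in> S) F"
      using ultrafilter_onD(2)[OF F] by eventually_elim (rule in_S)
    have "(Lim F f, Lim F g) \<in> S"
      using Lim_in_closed_set[OF S(1) ev _ lim] ultrafilter_onD(1)[OF F] by simp
    with continuous_on_tendsto_compose[OF S(2) lim this ev] show ?thesis
      using ultrafilter_Lim_eqI[OF F] by blast
  qed
  have row: "(Lim B (w x), Lim B (w' x)) \<in> S \<and> Lim B (\<lambda>y. h (w x y, w' x y)) = h (Lim B (w x), Lim B (w' x))"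
    if "x \<in> X" for x using that by (intro one[OF B] w w' S)
  have col: "(Lim A (\<lambda>x. w x y), Lim A (\<lambda>x. w' x y)) \<in> S \<and>
      Lim A (\<lambda>x. h (w x y, w' x y)) = h (Lim A (\<lambda>x. w x y), Lim A (\<lambda>x. w' x y))"
    if "y \<in> Y" for y using that by (intro one[OF A] w w' S)
  have "Lim A (\<lambda>x. Lim B (\<lambda>y. h (w x y, w' x y))) = Lim A (\<lambda>x. h (Lim B (w x), Lim B (w' x)))"
    using row by (intro Lim_cong_on[OF A]) blast
  also have "\<dots> = h (Lim A (\<lambda>x. Lim B (w x)), Lim A (\<lambda>x. Lim B (w' x)))"
    using row by (intro one[OF A, THEN conjunct2] Lim_norm_le[OF B] w w') blast+
  also have "\<dots> = h (Lim B (\<lambda>y. Lim A (\<lambda>x. w x y)), Lim B (\<lambda>y. Lim A (\<lambda>x. w' x y)))"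
    using interchangeD[OF w(1) A B] interchangeD[OF w'(1) A B] by simp
  also have "\<dots> = Lim B (\<lambda>y. h (Lim A (\<lambda>x. w x y), Lim A (\<lambda>x. w' x y)))"
    using col by (intro one[OF B, THEN conjunct2, symmetric] Lim_norm_le[OF A] w w') blast+
  also have "\<dots> = Lim B (\<lambda>y. Lim A (\<lambda>x. h (w x y, w' x y)))"
    using col by (intro Lim_cong_on[OF B]) simp
  finally show "Lim A (\<lambda>x. Lim B (\<lambda>y. h (w x y, w' x y))) = Lim B (\<lambda>y. Lim A (\<lambda>x. h (w x y, w' x y)))" .
qed

lemma Lim_close:
  fixes f g :: "'a \<Rightarrow> complex"
  assumes F: "ultrafilter_on X F" and "\<And>x. x \<in> X \<Longrightarrow> cmod (f x) \<le> C" "\<And>x. x \<in> X \<Longrightarrow> cmod (g x) \<le> C'"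
    and "\<And>x. x \<in> X \<Longrightarrow> cmod (f x - g x) \<le> e"
  shows "cmod (Lim F f - Lim F g) \<le> e"
proof -
  have "((\<lambda>x. f x - g x) \<longlongrightarrow> Lim F f - Lim F g) F"
    by (intro tendsto_diff ultrafilter_tendsto[OF F assms(2)] ultrafilter_tendsto[OF F assms(3)])
  then have "Lim F (\<lambda>x. f x - g x) = Lim F f - Lim F g" by (rule ultrafilter_Lim_eqI[OF F])
  with Lim_norm_le[where f = "\<lambda>x. f x - g x", OF F assms(4)] show ?thesis by simp
qed

lemma interchange_approx:
  assumes bd: "\<And>x y. x \<in> X \<Longrightarrow> y \<in> Y \<Longrightarrow> cmod (w x y) \<le> C"
    and approx: "\<And>e. e > 0 \<Longrightarrow> \<exists>w'. interchange X Y w' \<and> (\<forall>x\<in>X. \<forall>y\<in>Y. cmod (w x y - w' x y) \<le> e)"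
  shows "interchange X Y w"
  unfolding interchange_def
proof (intro allI impI, elim conjE)
  fix A B assume A: "ultrafilter_on X A" and B: "ultrafilter_on Y B"
  let ?l = "Lim A (\<lambda>x. Lim B (w x))" and ?r = "Lim B (\<lambda>y. Lim A (\<lambda>x. w x y))"
  have "cmod (?l - ?r) \<le> 0"
  proof (rule field_le_epsilon)
    fix e :: real assume "e > 0"
    then obtain w' where w': "interchange X Y w'" "\<And>x y. x \<in> X \<Longrightarrow> y \<in> Y \<Longrightarrow> cmod (w x y - w' x y) \<le> e/2"
      using approx[of "e/2"] by auto
    have bd': "cmod (w' x y) \<le> C + e/2" if "x \<in> X" "y \<in> Y" for x y
      using bd[OF that] w'(2)[OF that] norm_triangle_ineq2[of "w' x y" "w x y"]
      by (simp add: norm_minus_commute)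
    have "cmod (?l - Lim A (\<lambda>x. Lim B (w' x))) \<le> e/2"
      by (rule Lim_close[OF A Lim_norm_le[OF B bd] Lim_norm_le[OF B bd'] Lim_close[OF B bd bd' w'(2)]])
    moreover have "cmod (?r - Lim B (\<lambda>y. Lim A (\<lambda>x. w' x y))) \<le> e/2"
      by (rule Lim_close[OF B Lim_norm_le[OF A bd] Lim_norm_le[OF A bd'] Lim_close[OF A bd bd' w'(2)]])
    ultimately show "cmod (?l - ?r) \<le> 0 + e"
      using interchangeD[OF w'(1) A B] norm_triangle_ineq4[of "?l - Lim A (\<lambda>x. Lim B (w' x))" "?r - Lim B (\<lambda>y. Lim A (\<lambda>x. w' x y))"]
      by simp
  qed
  then show "?l = ?r" by simp
qed

section \<open>Limits in topological spaces\<close>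

lemma continuous_map_iff_limitin_nhdsin:
  "continuous_map X Y f \<longleftrightarrow> (\<forall>x\<in>topspace X. limitin Y f (f x) (nhdsin X x))"
proof -
  have "topcontinuous_at X Y f x \<longleftrightarrow> limitin Y f (f x) (nhdsin X x)"
    if "x \<in> topspace X" "f \<in> topspace X \<rightarrow> topspace Y" for x
    using that by (auto simp: topcontinuous_at_def limitin_def eventually_nhdsin)
  moreover have "f \<in> topspace X \<rightarrow> topspace Y" if "continuous_map X Y f"
    using that by (simp add: continuous_map_def)
  moreover have "f \<in> topspace X \<rightarrow> topspace Y" if "\<forall>x\<in>topspace X. limitin Y f (f x) (nhdsin X x)"
    using that by (auto simp: limitin_def)
  ultimately show ?thesis
    unfolding continuous_map_eq_topcontinuous_at by blast
qed

lemma continuous_map_euclidean_iff: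
  "continuous_map X euclidean f \<longleftrightarrow> (\<forall>x\<in>topspace X. (f \<longlongrightarrow> f x) (nhdsin X x))"
  by (simp add: continuous_map_iff_limitin_nhdsin)

lemma limitin_compose_continuous:
  assumes "continuous_map X Y f" "limitin X g l F"
  shows "limitin Y (\<lambda>x. f (g x)) (f l) F"
  using continuous_map_limit[OF assms] by (simp add: comp_def)

lemma limitin_compose_filterlim:
  "limitin T f l G \<Longrightarrow> filterlim h G F \<Longrightarrow> limitin T (\<lambda>z. f (h z)) l F"
  by (auto simp: limitin_def filterlim_iff)

lemma limitin_nhdsin_id: "x \<in> topspace X \<Longrightarrow> limitin X (\<lambda>y. y) x (nhdsin X x)"
  by (auto simp: limitin_def eventually_nhdsin)

lemma nhdsin_neq_bot: "x \<in> topspace X \<Longrightarrow> nhdsin X x \<noteq> bot"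
  by (auto simp: trivial_limit_def eventually_nhdsin)

lemma limitin_ultrafilter_of_compactin:
  assumes F: "ultrafilter_on X F" and K: "compactin T K" and g: "\<And>x. x \<in> X \<Longrightarrow> g x \<in> K"
  shows "\<exists>l\<in>K. limitin T g l F"
proof (rule ccontr)
  assume none: "\<not> ?thesis"
  have "\<exists>U. openin T U \<and> l \<in> U \<and> eventually (\<lambda>x. g x \<notin> U) F" if "l \<in> K" for l
  proof -
    have "l \<in> topspace T" using that compactin_subset_topspace[OF K] by blast
    moreover have "\<not> limitin T g l F" using none that by blast
    ultimately obtain U where U: "openin T U" "l \<in> U" "\<not> eventually (\<lambda>x. g x \<in> U) F"
      unfolding limitin_def by blast
    from U(3) have "eventually (\<lambda>x. g x \<notin> U) F" by (simp only: ultrafilter_onD(3)[OF F])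
    with U show ?thesis by blast
  qed
  then obtain U where U: "\<And>l. l \<in> K \<Longrightarrow> openin T (U l) \<and> l \<in> U l \<and> eventually (\<lambda>x. g x \<notin> U l) F"
    by metis
  then have "\<And>V. V \<in> U ` K \<Longrightarrow> openin T V" "K \<subseteq> \<Union>(U ` K)" by auto
  then obtain \<F> where \<F>: "finite \<F>" "\<F> \<subseteq> U ` K" "K \<subseteq> \<Union>\<F>"
    using compactinD[OF K, of "U ` K"] by auto
  then have "eventually (\<lambda>x. \<forall>V\<in>\<F>. g x \<notin> V) F"
    using U by (intro eventually_ball_finite) auto
  with ultrafilter_onD(2)[OF F] have "eventually (\<lambda>x. False) F"
    by eventually_elim (use \<F>(3) g in blast)
  then show False using ultrafilter_onD(1)[OF F] by (simp add: eventually_False)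
qed

lemma topspace_initial_topology [simp]: "topspace (initial_topology X Y \<F>) = X"
  by (auto simp: initial_topology_def)

lemma limitin_initial_topologyI:
  assumes "l \<in> X" "eventually (\<lambda>x. g x \<in> X) F" "\<And>f. f \<in> \<F> \<Longrightarrow> limitin Y (\<lambda>x. f (g x)) (f l) F"
  shows "limitin (initial_topology X Y \<F>) g l F"
  unfolding limitin_def
proof (intro conjI allI impI)
  fix U assume "openin (initial_topology X Y \<F>) U \<and> l \<in> U"
  then have "generate_topology_on (insert X {f -` U \<inter> X | f U. f \<in> \<F> \<and> openin Y U}) U" "l \<in> U"
    by (auto simp: initial_topology_def openin_topology_generated_by_iff)
  then show "eventually (\<lambda>x. g x \<in> U) F"
  proof induction
    case (Int a b)
    then have "eventually (\<lambda>x. g x \<in> a) F" "eventually (\<lambda>x. g x \<in> b) F" by auto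
    then show ?case by eventually_elim simp
  next
    case (UN K)
    then obtain k where "k \<in> K" "l \<in> k" "eventually (\<lambda>x. g x \<in> k) F" by blast
    then show ?case by (auto elim: eventually_mono)
  next
    case (Basis s)
    then consider "s = X" | f U where "s = f -` U \<inter> X" "f \<in> \<F>" "openin Y U" by blast
    then show ?case
    proof cases
      case 2
      then have "eventually (\<lambda>x. f (g x) \<in> U) F"
        using Basis assms(3)[of f] by (auto simp: limitin_def)
      with assms(2) show ?thesis by eventually_elim (simp add: 2)
    qed (use assms(2) in simp)
  qed simp
qed (use assms in simp)

lemma continuous_map_from_initial_topology:
  assumes "f \<in> \<F>" "f \<in> X \<rightarrow> topspace Y"
  shows "continuous_map (initial_topology X Y \<F>) Y f"
proof -
  have "openin (initial_topology X Y \<F>) (f -` U \<inter> X)" if "openin Y U" for U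
    unfolding initial_topology_def using assms(1) that by (intro topology_generated_by_Basis) blast
  moreover have "{x \<in> X. f x \<in> U} = f -` U \<inter> X" for U by auto
  ultimately show ?thesis using assms(2) by (simp add: continuous_map_def)
qed

lemma regular_space_initial_topology:
  assumes Y: "regular_space Y" and \<F>: "\<And>f. f \<in> \<F> \<Longrightarrow> f \<in> X \<rightarrow> topspace Y"
    and U: "openin (initial_topology X Y \<F>) U" "x \<in> U"
  obtains V where "openin (initial_topology X Y \<F>) V" "x \<in> V"
    "initial_topology X Y \<F> closure_of V \<subseteq> U"
proof -
  let ?T = "initial_topology X Y \<F>"
  have "generate_topology_on (insert X {f -` U \<inter> X | f U. f \<in> \<F> \<and> openin Y U}) U"
    using U(1) by (simp add: initial_topology_def openin_topology_generated_by_iff)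
  then have "\<exists>V. openin ?T V \<and> x \<in> V \<and> ?T closure_of V \<subseteq> U"
    using U(2)
  proof induction
    case (Int a b)
    then obtain V W where "openin ?T V \<and> x \<in> V \<and> ?T closure_of V \<subseteq> a"
      "openin ?T W \<and> x \<in> W \<and> ?T closure_of W \<subseteq> b" by blast
    moreover have "?T closure_of (V \<inter> W) \<subseteq> ?T closure_of V \<inter> ?T closure_of W"
      by (simp add: closure_of_mono)
    ultimately show ?case by (intro exI[of _ "V \<inter> W"]) auto
  next
    case (UN K)
    then obtain k where k: "k \<in> K" "x \<in> k" by blast
    then obtain V where "openin ?T V \<and> x \<in> V \<and> ?T closure_of V \<subseteq> k" using UN.IH by auto
    with k(1) show ?case by (intro exI[of _ V]) auto
  next
    case (Basis s)
    then consider "s = X" | f W where "s = f -` W \<inter> X" "f \<in> \<F>" "openin Y W" by blast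
    then show ?case
    proof cases
      case 1
      then show ?thesis using Basis(2) openin_topspace[of ?T] closure_of_subset_topspace[of ?T X]
        by auto
    next
      case 2
      have f: "continuous_map ?T Y f" using 2 \<F> by (intro continuous_map_from_initial_topology)
      have "f x \<in> W" using Basis(2) 2 by simp
      obtain W' C where W'C: "openin Y W'" "closedin Y C" "f x \<in> W'" "W' \<subseteq> C" "C \<subseteq> W"
        using Y 2(3) \<open>f x \<in> W\<close> by (metis neighbourhood_base_of neighbourhood_base_of_closedin)
      then have W': "openin Y W'" "f x \<in> W'" "Y closure_of W' \<subseteq> W"
        using closure_of_minimal[of W' C Y] by auto
      have "openin ?T {y \<in> topspace ?T. f y \<in> W'}"
        by (rule openin_continuous_map_preimage[OF f W'(1)])
      moreover have "closedin ?T {y \<in> topspace ?T. f y \<in> Y closure_of W'}"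
        by (rule closedin_continuous_map_preimage[OF f closedin_closure_of])
      moreover have "{y \<in> topspace ?T. f y \<in> W'} \<subseteq> {y \<in> topspace ?T. f y \<in> Y closure_of W'}"
        using closure_of_subset[OF openin_subset[OF W'(1)]] by auto
      ultimately have "openin ?T {y \<in> topspace ?T. f y \<in> W'}"
        "?T closure_of {y \<in> topspace ?T. f y \<in> W'} \<subseteq> {y \<in> topspace ?T. f y \<in> Y closure_of W'}"
        using closure_of_minimal by metis+
      moreover have "{y \<in> topspace ?T. f y \<in> Y closure_of W'} \<subseteq> s" using W'(3) 2(1) by auto
      moreover have "x \<in> {y \<in> topspace ?T. f y \<in> W'}" using W'(2) Basis(2) 2(1) by simp
      ultimately show ?thesis by (meson order_trans)
    qed
  qed simp
  then show ?thesis using that by blast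
qed

text \<open>By regularity an open cover of the closure can be refined by open sets whose closures are
  still inside its members. Finitely many of these cover the set, as otherwise an ultrafilter would avoid
  them all, and then their closures cover its closure.\<close>

lemma compactin_closure_of_image:
  assumes reg: "\<And>U x. openin T U \<Longrightarrow> x \<in> U \<Longrightarrow> \<exists>V. openin T V \<and> x \<in> V \<and> T closure_of V \<subseteq> U"
    and lim: "\<And>F. ultrafilter_on X F \<Longrightarrow> \<exists>l. limitin T g l F"
    and g: "\<And>x. x \<in> X \<Longrightarrow> g x \<in> topspace T"
  shows "compactin T (T closure_of (g ` X))"
  unfolding compactin_def
proof (intro conjI allI impI)
  show "T closure_of (g ` X) \<subseteq> topspace T" by (rule closure_of_subset_topspace)
  fix \<U> assume \<U>: "Ball \<U> (openin T) \<and> T closure_of (g ` X) \<subseteq> \<Union>\<U>"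
  define \<V> where "\<V> = {V. openin T V \<and> (\<exists>U\<in>\<U>. T closure_of V \<subseteq> U)}"
  have cover: "\<exists>V\<in>\<V>. x \<in> V" if "x \<in> T closure_of (g ` X)" for x
  proof -
    have "x \<in> \<Union>\<U>" using that \<U> by (meson subsetD)
    then obtain U where U: "U \<in> \<U>" "x \<in> U" by blast
    moreover have "openin T U" using \<U> U(1) by simp
    ultimately obtain V where "openin T V" "x \<in> V" "T closure_of V \<subseteq> U" using reg[of U x] by auto
    then show ?thesis using U(1) unfolding \<V>_def by (intro bexI[of _ V]) auto
  qed
  have "\<exists>\<W>. finite \<W> \<and> \<W> \<subseteq> \<V> \<and> g ` X \<subseteq> \<Union>\<W>"
  proof (rule ccontr)
    assume none: "\<not> ?thesis"
    define F where "F = (INF \<W>\<in>{\<W>. finite \<W> \<and> \<W> \<subseteq> \<V>}. principal {x\<in>X. g x \<notin> \<Union>\<W>})"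
    have ev: "eventually P F \<longleftrightarrow> (\<exists>\<W>\<in>{\<W>. finite \<W> \<and> \<W> \<subseteq> \<V>}. \<forall>x\<in>X. g x \<notin> \<Union>\<W> \<longrightarrow> P x)" for P
      unfolding F_def
    proof (subst eventually_INF_base)
      fix A B assume "A \<in> {\<W>. finite \<W> \<and> \<W> \<subseteq> \<V>}" "B \<in> {\<W>. finite \<W> \<and> \<W> \<subseteq> \<V>}"
      then show "\<exists>x\<in>{\<W>. finite \<W> \<and> \<W> \<subseteq> \<V>}. principal {xa \<in> X. g xa \<notin> \<Union> x}
          \<le> inf (principal {x \<in> X. g x \<notin> \<Union> A}) (principal {x \<in> X. g x \<notin> \<Union> B})"
        by (intro bexI[of _ "A \<union> B"]) auto
    qed (auto simp: eventually_principal)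
    have "\<not> eventually (\<lambda>_. False) F"
    proof
      assume "eventually (\<lambda>_. False) F"
      then obtain \<W> where "finite \<W>" "\<W> \<subseteq> \<V>" "\<forall>x\<in>X. g x \<in> \<Union>\<W>"
        unfolding ev by auto
      then have "finite \<W> \<and> \<W> \<subseteq> \<V> \<and> g ` X \<subseteq> \<Union>\<W>" by auto
      with none show False by (rule notE[OF _ exI])
    qed
    then have "F \<noteq> bot" by (simp add: eventually_False)
    moreover have "F \<le> principal X" by (auto simp: le_principal ev intro: exI[of _ "{}"])
    ultimately obtain H where H: "H \<le> F" "ultrafilter_on X H" by (metis ultrafilter_below)
    obtain l where l: "limitin T g l H" using lim[OF H(2)] by blast
    have "l \<in> T closure_of (g ` X)"
      unfolding in_closure_of
    proof (intro conjI allI impI)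
      show "l \<in> topspace T" using l by (simp add: limitin_def)
      fix U assume "l \<in> U \<and> openin T U"
      then have "eventually (\<lambda>x. g x \<in> U) H" using l by (simp add: limitin_def)
      with ultrafilter_onD(2)[OF H(2)] have "eventually (\<lambda>x. x \<in> X \<and> g x \<in> U) H"
        by eventually_elim simp
      then show "\<exists>y. y \<in> g ` X \<and> y \<in> U"
        using eventually_happens'[OF ultrafilter_onD(1)[OF H(2)]] by blast
    qed
    then obtain V where V: "V \<in> \<V>" "l \<in> V" using cover by blast
    then have "eventually (\<lambda>x. g x \<in> V) H" using l by (simp add: \<V>_def limitin_def)
    moreover have "eventually (\<lambda>x. g x \<notin> V) F"
      unfolding ev using V(1) by (intro bexI[of _ "{V}"]) auto
    then have "eventually (\<lambda>x. g x \<notin> V) H" by (rule filter_leD[OF H(1)])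
    ultimately have "eventually (\<lambda>x. False) H" by eventually_elim simp
    then show False using ultrafilter_onD(1)[OF H(2)] by (simp add: eventually_False)
  qed
  then obtain \<W> where \<W>: "finite \<W>" "\<W> \<subseteq> \<V>" "g ` X \<subseteq> \<Union>\<W>" by blast
  have "\<forall>V\<in>\<V>. \<exists>U. U \<in> \<U> \<and> T closure_of V \<subseteq> U" by (auto simp: \<V>_def)
  from bchoice[OF this] obtain u where u: "\<And>V. V \<in> \<V> \<Longrightarrow> u V \<in> \<U> \<and> T closure_of V \<subseteq> u V"
    by blast
  have "T closure_of (g ` X) \<subseteq> T closure_of (\<Union>\<W>)" using \<W>(3) by (rule closure_of_mono)
  also have "\<dots> = (\<Union>V\<in>\<W>. T closure_of V)" using \<W>(1) by (rule closure_of_Union)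
  also have "\<dots> \<subseteq> \<Union>(u ` \<W>)" using u \<W>(2) by blast
  finally show "\<exists>\<F>. finite \<F> \<and> \<F> \<subseteq> \<U> \<and> T closure_of (g ` X) \<subseteq> \<Union>\<F>"
    using u \<W>(1,2) by (intro exI[of _ "u ` \<W>"]) auto
qed

section \<open>Bounded continuous functions\<close>

lemma uniform_norm_upper:
  assumes "bounded (range u)" shows "cmod (u t) \<le> uniform_norm u"
proof -
  obtain B where "\<And>x. cmod (u x) \<le> B" using assms by (auto simp: bounded_iff)
  then have "bdd_above (range (\<lambda>x. cmod (u x)))" by (intro bdd_aboveI2)
  then show ?thesis unfolding uniform_norm_def by (intro cSUP_upper) auto
qed

lemma uniform_norm_least: "(\<And>t. cmod (u t) \<le> B) \<Longrightarrow> uniform_norm u \<le> B"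
  unfolding uniform_norm_def by (intro cSUP_least) auto

lemma bounded_continuousD:
  assumes "u \<in> bounded_continuous \<tau>"
  shows "continuous_map \<tau> euclidean u" "cmod (u t) \<le> uniform_norm u" "t \<notin> topspace \<tau> \<Longrightarrow> u t = 0"
  using assms uniform_norm_upper[of u t] by (auto simp: bounded_continuous_def)

lemma bounded_continuousI:
  assumes "continuous_map \<tau> euclidean u" "\<And>t. t \<in> topspace \<tau> \<Longrightarrow> cmod (u t) \<le> B"
    "\<And>t. t \<notin> topspace \<tau> \<Longrightarrow> u t = 0"
  shows "u \<in> bounded_continuous \<tau>"
proof -
  have "cmod (u t) \<le> max B 0" for t using assms(2,3)[of t] by (cases "t \<in> topspace \<tau>") auto
  then have "bounded (range u)" unfolding bounded_iff by blast
  with assms show ?thesis by (simp add: bounded_continuous_def)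
qed

lemma linear_subspace_bounded_continuous: "linear_subspace (bounded_continuous \<tau>)"
  unfolding linear_subspace_def
proof (intro conjI ballI allI)
  show "(\<lambda>t. 0) \<in> bounded_continuous \<tau>"
    by (intro bounded_continuousI[of _ _ 0]) (auto simp: continuous_map_euclidean_iff)
  fix u assume u: "u \<in> bounded_continuous \<tau>"
  {
    fix v assume v: "v \<in> bounded_continuous \<tau>"
    show "(\<lambda>t. u t + v t) \<in> bounded_continuous \<tau>"
    proof (rule bounded_continuousI[of _ _ "uniform_norm u + uniform_norm v"])
      show "continuous_map \<tau> euclidean (\<lambda>t. u t + v t)"
        using bounded_continuousD(1)[OF u] bounded_continuousD(1)[OF v]
        by (auto simp: continuous_map_euclidean_iff intro: tendsto_add)
      show "cmod (u t + v t) \<le> uniform_norm u + uniform_norm v" for t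
        by (intro norm_triangle_mono bounded_continuousD(2)[OF u] bounded_continuousD(2)[OF v])
    qed (simp add: bounded_continuousD(3)[OF u] bounded_continuousD(3)[OF v])
  }
  fix c
  show "(\<lambda>t. c * u t) \<in> bounded_continuous \<tau>"
  proof (rule bounded_continuousI[of _ _ "cmod c * uniform_norm u"])
    show "continuous_map \<tau> euclidean (\<lambda>t. c * u t)"
      using bounded_continuousD(1)[OF u] by (auto simp: continuous_map_euclidean_iff intro: tendsto_mult_left)
    show "cmod (c * u t) \<le> cmod c * uniform_norm u" for t
      by (simp add: norm_mult mult_left_mono bounded_continuousD(2)[OF u])
  qed (simp add: bounded_continuousD(3)[OF u])
qed

text \<open>These functionals are how the weak topology sees the second of the two iterated limits.\<close>

lemma Lim_functional_in_dual:
  assumes F: "ultrafilter_on UNIV F" and X: "X \<subseteq> bounded_continuous \<tau>" "linear_subspace X"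
  shows "(\<lambda>u\<in>X. Lim F u) \<in> dual X"
proof -
  have lim: "(u \<longlongrightarrow> Lim F u) F" if "u \<in> X" for u
    using that X(1) by (intro ultrafilter_tendsto[OF F, where K = "uniform_norm u"] bounded_continuousD(2)) blast
  have "Lim F (\<lambda>t. u t + v t) = Lim F u + Lim F v" if "u \<in> X" "v \<in> X" for u v
    by (intro ultrafilter_Lim_eqI[OF F] tendsto_add lim that)
  moreover have "Lim F (\<lambda>t. c * u t) = c * Lim F u" if "u \<in> X" for u c
    by (intro ultrafilter_Lim_eqI[OF F] tendsto_mult_left lim that)
  moreover have "cmod (Lim F u) \<le> 1 * uniform_norm u" if "u \<in> X" for u
    using that X(1) by (simp, intro Lim_norm_le[OF F] bounded_continuousD(2)) blast
  ultimately show ?thesis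
    using X(2) unfolding dual_def linear_subspace_def
    by (auto intro!: exI[of _ 1])
qed

lemma limitin_weak_topologyD:
  assumes "limitin (weak_topology X) g v F" "\<phi> \<in> dual X"
  shows "((\<lambda>x. \<phi> (g x)) \<longlongrightarrow> \<phi> v) F"
  using limitin_compose_continuous[OF continuous_map_from_initial_topology assms(1)[unfolded weak_topology_def],
      OF assms(2)] by simp

lemma tendsto_uniform_limit:
  fixes f :: "nat \<Rightarrow> 'x \<Rightarrow> complex"
  assumes "uniform_limit UNIV f u sequentially" "\<And>n. (f n \<longlongrightarrow> f n a) F"
  shows "(u \<longlongrightarrow> u a) F"
  using swap_uniform_limit'[of f "\<lambda>n. f n a" F sequentially "u a" UNIV u] assms
    tendsto_uniform_limitI[OF assms(1), of a] by simp

section \<open>Grothendieck's criterion for weak almost periodicity\<close>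

text \<open>This property does not mention a topology. It is what lets a function move
  between different topologies on the same group.\<close>

definition double_limit_property :: "('a, 'm) monoid_scheme \<Rightarrow> ('a \<Rightarrow> complex) \<Rightarrow> bool" where
  "double_limit_property G u \<longleftrightarrow> interchange (carrier G) (carrier G) (\<lambda>s t. u (s \<otimes>\<^bsub>G\<^esub> t))"

text \<open>Only the neighbourhood filters of the group and of its square occur in the proof; the types of
  the two filters are chosen accordingly.\<close>

lemma topological_groupI:
  fixes G :: "('a, 'm) monoid_scheme" (structure)
  assumes "group G" "topspace T = carrier G"
    and mult: "\<And>g h a b (F :: ('a \<times> 'a) filter). limitin T g a F \<Longrightarrow> limitin T h b F \<Longrightarrow>
      limitin T (\<lambda>z. g z \<otimes> h z) (a \<otimes> b) F"
    and inv: "\<And>g a (F :: 'a filter). limitin T g a F \<Longrightarrow> limitin T (\<lambda>z. inv g z) (inv a) F"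
  shows "topological_group G T"
  unfolding topological_group_def
proof (intro conjI assms(1,2))
  show "continuous_map (prod_topology T T) T (\<lambda>(x, y). x \<otimes> y)"
    unfolding continuous_map_iff_limitin_nhdsin
  proof
    fix p assume "p \<in> topspace (prod_topology T T)"
    then have "limitin (prod_topology T T) (\<lambda>z. z) p (nhdsin (prod_topology T T) p)"
      by (rule limitin_nhdsin_id)
    then have "limitin T fst (fst p) (nhdsin (prod_topology T T) p)"
      "limitin T snd (snd p) (nhdsin (prod_topology T T) p)"
      using limitin_compose_continuous[OF continuous_map_fst] limitin_compose_continuous[OF continuous_map_snd]
      by blast+
    from mult[OF this]
    show "limitin T (\<lambda>(x, y). x \<otimes> y) (case p of (x, y) \<Rightarrow> x \<otimes> y) (nhdsin (prod_topology T T) p)"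
      by (simp add: case_prod_unfold)
  qed
  show "continuous_map T T (\<lambda>x. inv x)"
    unfolding continuous_map_iff_limitin_nhdsin by (intro ballI inv limitin_nhdsin_id)
qed

locale topgroup =
  fixes G :: "('a, 'm) monoid_scheme" (structure) and \<tau> :: "'a topology"
  assumes topgrp: "topological_group G \<tau>"

sublocale topgroup \<subseteq> group G
  using topgrp by (simp add: topological_group_def)

context topgroup
begin

lemma topspace_eq [simp]: "topspace \<tau> = carrier G"
  using topgrp by (simp add: topological_group_def)

lemma limitin_mult:
  assumes "limitin \<tau> f a F" "limitin \<tau> g b F"
  shows "limitin \<tau> (\<lambda>x. f x \<otimes> g x) (a \<otimes> b) F"
proof -
  have "limitin (prod_topology \<tau> \<tau>) (\<lambda>x. (f x, g x)) (a, b) F"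
    using assms by (simp add: limitin_pairwise comp_def)
  moreover have "continuous_map (prod_topology \<tau> \<tau>) \<tau> (\<lambda>(x, y). x \<otimes> y)"
    using topgrp by (simp add: topological_group_def)
  ultimately show ?thesis using limitin_compose_continuous by fastforce
qed

lemma limitin_inv: "limitin \<tau> f a F \<Longrightarrow> limitin \<tau> (\<lambda>x. inv f x) (inv a) F"
  using topgrp limitin_compose_continuous unfolding topological_group_def by fast

lemma limitin_const_group: "a \<in> carrier G \<Longrightarrow> limitin \<tau> (\<lambda>x. a) a F"
  by simp

lemma limitin_nhdsin_group: "a \<in> carrier G \<Longrightarrow> limitin \<tau> (\<lambda>x. x) a (nhdsin \<tau> a)"
  by (rule limitin_nhdsin_id) simp

lemma tendsto_of_limitin:
  fixes u :: "'a \<Rightarrow> complex"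
  assumes "continuous_map \<tau> euclidean u" "limitin \<tau> f a F"
  shows "((\<lambda>x. u (f x)) \<longlongrightarrow> u a) F"
  using limitin_compose_continuous[OF assms] by simp

lemma eventually_nhdsin_carrier: "a \<in> carrier G \<Longrightarrow> eventually (\<lambda>x. x \<in> carrier G) (nhdsin \<tau> a)"
  using openin_topspace[of \<tau>] by (auto simp: eventually_nhdsin simp del: openin_topspace)

lemma continuous_on_groupI:
  fixes u :: "'a \<Rightarrow> complex"
  assumes "\<And>a. a \<in> carrier G \<Longrightarrow> (u \<longlongrightarrow> u a) (nhdsin \<tau> a)"
  shows "continuous_map \<tau> euclidean u"
  using assms by (simp add: continuous_map_euclidean_iff)

lemma translate_r_continuous:
  assumes "continuous_map \<tau> euclidean u" "s \<in> carrier G"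
  shows "continuous_map \<tau> euclidean (translate_r G u s)"
proof (rule continuous_on_groupI)
  fix a assume a: "a \<in> carrier G"
  have "((\<lambda>x. u (s \<otimes> x)) \<longlongrightarrow> u (s \<otimes> a)) (nhdsin \<tau> a)"
    by (intro tendsto_of_limitin assms limitin_mult limitin_const_group limitin_nhdsin_group a)
  moreover have "eventually (\<lambda>x. u (s \<otimes> x) = translate_r G u s x) (nhdsin \<tau> a)"
    using eventually_nhdsin_carrier[OF a] by eventually_elim (simp add: translate_r_def)
  ultimately show "(translate_r G u s \<longlongrightarrow> translate_r G u s a) (nhdsin \<tau> a)"
    using a by (auto simp: translate_r_def intro: Lim_transform_eventually)
qed

lemma translate_l_continuous:
  assumes "continuous_map \<tau> euclidean u" "s \<in> carrier G"
  shows "continuous_map \<tau> euclidean (translate_l G s u)"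
proof (rule continuous_on_groupI)
  fix a assume a: "a \<in> carrier G"
  have "((\<lambda>x. u (x \<otimes> s)) \<longlongrightarrow> u (a \<otimes> s)) (nhdsin \<tau> a)"
    by (intro tendsto_of_limitin assms limitin_mult limitin_const_group limitin_nhdsin_group a)
  moreover have "eventually (\<lambda>x. u (x \<otimes> s) = translate_l G s u x) (nhdsin \<tau> a)"
    using eventually_nhdsin_carrier[OF a] by eventually_elim (simp add: translate_l_def)
  ultimately show "(translate_l G s u \<longlongrightarrow> translate_l G s u a) (nhdsin \<tau> a)"
    using a by (auto simp: translate_l_def intro: Lim_transform_eventually)
qed

lemma translate_r_bounded_continuous:
  assumes "u \<in> bounded_continuous \<tau>" "s \<in> carrier G"
  shows "translate_r G u s \<in> bounded_continuous \<tau>"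
  by (rule bounded_continuousI[OF translate_r_continuous[OF bounded_continuousD(1)[OF assms(1)] assms(2)],
        where B = "uniform_norm u"])
    (auto simp: translate_r_def bounded_continuousD(2)[OF assms(1)])

lemma norm_translate_r_le:
  assumes "u \<in> bounded_continuous \<tau>" shows "cmod (translate_r G u s t) \<le> uniform_norm u"
  using order_trans[OF norm_ge_zero bounded_continuousD(2)[OF assms]]
  by (auto simp: translate_r_def bounded_continuousD(2)[OF assms])

text \<open>To see that the limit function is continuous at \<open>a\<close>, take for the second of the two ultrafilters
  one that converges to \<open>a\<close>.\<close>

lemma limit_translate_bounded_continuous:
  assumes u: "u \<in> bounded_continuous \<tau>" and w: "interchange (carrier G) (carrier G) (translate_r G u)"
    and F: "ultrafilter_on (carrier G) F"
  shows "(\<lambda>t. Lim F (\<lambda>s. translate_r G u s t)) \<in> bounded_continuous \<tau>"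
proof -
  define v where "v t = Lim F (\<lambda>s. translate_r G u s t)" for t
  have v_bd: "cmod (v t) \<le> uniform_norm u" for t
    unfolding v_def by (rule Lim_norm_le[OF F norm_translate_r_le[OF u]])
  have cont: "continuous_map \<tau> euclidean v"
  proof (rule continuous_on_groupI, rule tendstoI)
    fix a e assume a: "a \<in> carrier G" and e: "(e::real) > 0"
    show "eventually (\<lambda>t. dist (v t) (v a) < e) (nhdsin \<tau> a)"
    proof (rule eventually_by_ultrafilters)
      fix B assume B: "B \<le> nhdsin \<tau> a" "ultrafilter_on UNIV B"
      have BG: "ultrafilter_on (carrier G) B"
        using B(2) filter_leD[OF B(1) eventually_nhdsin_carrier[OF a]] by (rule ultrafilter_on_mono)
      have "(translate_r G u s \<longlongrightarrow> translate_r G u s a) B" if "s \<in> carrier G" for s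
        using translate_r_continuous[OF bounded_continuousD(1)[OF u] that] a tendsto_mono[OF B(1)]
        by (auto simp: continuous_map_euclidean_iff)
      then have "Lim B (translate_r G u s) = translate_r G u s a" if "s \<in> carrier G" for s
        using ultrafilter_Lim_eqI[OF BG] that by blast
      then have "Lim F (\<lambda>s. Lim B (translate_r G u s)) = v a"
        unfolding v_def by (intro Lim_cong_on[OF F])
      then have "Lim B v = v a" using interchangeD[OF w F BG] by (simp add: v_def[abs_def])
      then have "(v \<longlongrightarrow> v a) B" using ultrafilter_tendsto[where f = v, OF BG v_bd] by simp
      then show "eventually (\<lambda>t. dist (v t) (v a) < e) B" using e by (rule tendstoD)
    qed
  qed
  have "v \<in> bounded_continuous \<tau>"
  proof (rule bounded_continuousI[OF cont v_bd])
    fix t assume "t \<notin> topspace \<tau>"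
    then show "v t = 0"
      unfolding v_def by (intro ultrafilter_Lim_eqI[OF F]) (simp add: translate_r_def)
  qed
  then show ?thesis by (simp add: v_def[abs_def])
qed

lemma double_limit_property_translate:
  "double_limit_property G u \<longleftrightarrow> interchange (carrier G) (carrier G) (translate_r G u)"
  unfolding double_limit_property_def by (rule interchange_cong) (simp add: translate_r_def)

text \<open>If the orbit is relatively weakly compact, the translates converge weakly along \<open>A\<close>, and applying
  the functional \<open>lim\<^sub>B\<close> to this convergence interchanges the limits. Conversely, with the interchange the
  pointwise limit of translates along an ultrafilter is continuous and is their weak limit, so every
  ultrafilter on the orbit converges weakly.\<close>

theorem wap_iff_double_limit_property:
  "u \<in> wap G \<tau> \<longleftrightarrow> u \<in> bounded_continuous \<tau> \<and> double_limit_property G u"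
proof (cases "u \<in> bounded_continuous \<tau>")
  case u: True
  let ?C = "bounded_continuous \<tau>" and ?W = "weak_topology (bounded_continuous \<tau>)"
  have orbit: "translate_r G u s \<in> ?C" if "s \<in> carrier G" for s
    using translate_r_bounded_continuous[OF u that] .
  have top: "topspace ?W = ?C" by (simp add: weak_topology_def)
  note dlp = double_limit_property_translate[of u]
  show ?thesis
  proof
    assume "u \<in> wap G \<tau>"
    then have K: "compactin ?W (?W closure_of (translate_r G u ` carrier G))" by (simp add: wap_def)
    have sub: "translate_r G u s \<in> ?W closure_of (translate_r G u ` carrier G)" if "s \<in> carrier G" for s
    proof -
      have "translate_r G u ` carrier G \<subseteq> topspace ?W" using orbit by (auto simp: top)
      from subsetD[OF closure_of_subset[OF this]] that show ?thesis by simp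
    qed
    have "interchange (carrier G) (carrier G) (translate_r G u)"
      unfolding interchange_def
    proof (intro allI impI, elim conjE)
      fix A B assume A: "ultrafilter_on (carrier G) A" and B: "ultrafilter_on (carrier G) B"
      obtain v where v: "limitin ?W (translate_r G u) v A"
        using limitin_ultrafilter_of_compactin[where g = "translate_r G u", OF A K sub] by auto
      have "v \<in> ?C" using limitin_topspace[OF v] by (simp add: top)
      have conv: "((\<lambda>s. Lim F (translate_r G u s)) \<longlongrightarrow> Lim F v) A"
        if "ultrafilter_on UNIV F" for F
      proof -
        have "((\<lambda>s. (\<lambda>u\<in>?C. Lim F u) (translate_r G u s)) \<longlongrightarrow> (\<lambda>u\<in>?C. Lim F u) v) A"
          by (intro limitin_weak_topologyD[OF v] Lim_functional_in_dual[OF that order_refl]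
              linear_subspace_bounded_continuous)
        moreover have "eventually (\<lambda>s. (\<lambda>u\<in>?C. Lim F u) (translate_r G u s) = Lim F (translate_r G u s)) A"
          using ultrafilter_onD(2)[OF A] by eventually_elim (simp add: orbit)
        ultimately show ?thesis using \<open>v \<in> ?C\<close> by (auto intro: Lim_transform_eventually)
      qed
      have B': "ultrafilter_on UNIV B" using B by (rule ultrafilter_on_mono) simp
      have pt: "Lim A (\<lambda>s. translate_r G u s t) = v t" for t
        using conv[OF ultrafilter_on_principal[of t UNIV]] by (intro ultrafilter_Lim_eqI[OF A]) (simp add: Lim_principal)
      have "Lim A (\<lambda>s. Lim B (translate_r G u s)) = Lim B v"
        by (rule ultrafilter_Lim_eqI[OF A conv[OF B']])
      then show "Lim A (\<lambda>s. Lim B (translate_r G u s)) = Lim B (\<lambda>t. Lim A (\<lambda>s. translate_r G u s t))"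
        by (simp add: pt)
    qed
    with u dlp show "u \<in> ?C \<and> double_limit_property G u" by simp
  next
    assume "u \<in> ?C \<and> double_limit_property G u"
    then have w: "interchange (carrier G) (carrier G) (translate_r G u)" using dlp by simp
    note bd = norm_translate_r_le[OF u]
    have "compactin ?W (?W closure_of (translate_r G u ` carrier G))"
    proof (rule compactin_closure_of_image)
      show "translate_r G u s \<in> topspace ?W" if "s \<in> carrier G" for s
        using orbit[OF that] by (simp add: top)
      show "\<exists>V. openin ?W V \<and> x \<in> V \<and> ?W closure_of V \<subseteq> U" if U: "openin ?W U" "x \<in> U" for U x
        using U regular_space_initial_topology[of euclidean "dual ?C" ?C U x]
        unfolding weak_topology_def by (auto simp: regular_space_euclidean)
      show "\<exists>v. limitin ?W (translate_r G u) v F" if F: "ultrafilter_on (carrier G) F" for F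
      proof -
        define v where "v t = Lim F (\<lambda>s. translate_r G u s t)" for t
        have v: "v \<in> ?C"
          unfolding v_def using limit_translate_bounded_continuous[OF u w F] .
        have "limitin ?W (translate_r G u) v F"
          unfolding weak_topology_def
        proof (rule limitin_initial_topologyI[OF v])
          show "eventually (\<lambda>s. translate_r G u s \<in> ?C) F"
            using ultrafilter_onD(2)[OF F] by eventually_elim (rule orbit)
          fix \<phi> assume \<phi>: "\<phi> \<in> dual ?C"
          then have "\<exists>K. \<forall>f\<in>?C. cmod (\<phi> f) \<le> K * uniform_norm f" by (simp add: dual_def)
          then obtain K where K: "\<And>f. f \<in> ?C \<Longrightarrow> cmod (\<phi> f) \<le> K * uniform_norm f" by blast
          have "((\<lambda>s. \<phi> (translate_r G u s)) \<longlongrightarrow> \<phi> v) F"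
          proof (rule interchange_functional_continuity[OF w bd F v_def, where L = ?C and K = "\<bar>K\<bar>"])
            show "carrier G \<noteq> {}" by blast
            fix f B assume f: "f \<in> ?C" and B: "\<And>t. t \<in> carrier G \<Longrightarrow> cmod (f t) \<le> B"
            have "0 \<le> B" using order_trans[OF norm_ge_zero B[OF one_closed]] .
            then have "uniform_norm f \<le> B"
              using B bounded_continuousD(3)[OF f] by (intro uniform_norm_least) (metis norm_zero topspace_eq)
            moreover have "0 \<le> uniform_norm f"
              using order_trans[OF norm_ge_zero bounded_continuousD(2)[OF f]] .
            moreover have "cmod (\<phi> f) \<le> K * uniform_norm f" by (rule K[OF f])
            moreover have "K * uniform_norm f \<le> \<bar>K\<bar> * uniform_norm f"
              using \<open>0 \<le> uniform_norm f\<close> by (intro mult_right_mono) auto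
            moreover have "\<bar>K\<bar> * uniform_norm f \<le> \<bar>K\<bar> * B"
              using \<open>uniform_norm f \<le> B\<close> by (intro mult_left_mono) auto
            ultimately show "cmod (\<phi> f) \<le> \<bar>K\<bar> * B" by linarith
          qed (use \<phi> v orbit linear_subspace_bounded_continuous in \<open>auto simp: dual_def\<close>)
          then show "limitin euclidean (\<lambda>s. \<phi> (translate_r G u s)) (\<phi> v) F" by simp
        qed
        then show ?thesis by (intro exI[of _ v])
      qed
    qed
    with u show "u \<in> wap G \<tau>" by (simp add: wap_def)
  qed
qed (simp add: wap_def)

end

section \<open>Uniform continuity of translations\<close>

lemma uncountable_nat_to_bool: "uncountable (UNIV :: (nat \<Rightarrow> bool) set)"
  unfolding uncountable_def
proof (intro conjI notI)
  assume "\<exists>f::nat \<Rightarrow> nat \<Rightarrow> bool. range f = UNIV"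
  then obtain f :: "nat \<Rightarrow> nat \<Rightarrow> bool" where f: "range f = UNIV" by blast
  have "(\<lambda>n. \<not> f n n) \<in> range f" using f by blast
  then obtain n where "(\<lambda>n. \<not> f n n) = f n" by blast
  then show False by (metis (full_types))
qed simp

text \<open>Finite branches of the binary tree, with the latest choice at the head, so that a branch
  is extended by one factor on the left of its product.\<close>

fun branch :: "(nat \<Rightarrow> bool) \<Rightarrow> nat \<Rightarrow> bool list" where
  "branch i 0 = []"
| "branch i (Suc n) = i n # branch i n"

lemma length_branch [simp]: "length (branch i n) = n"
  by (induction n) auto

lemma branch_cong: "(\<And>k. k < n \<Longrightarrow> i k = j k) \<Longrightarrow> branch i n = branch j n"
  by (induction n) auto

primrec (in monoid) branch_product :: "(nat \<Rightarrow> 'a) \<Rightarrow> bool list \<Rightarrow> 'a" where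
  "branch_product s [] = \<one>"
| "branch_product s (b # \<sigma>) = (if b then s (length \<sigma>) \<otimes> branch_product s \<sigma> else branch_product s \<sigma>)"

lemma (in monoid) branch_product_closed:
  "(\<And>k. k < length \<sigma> \<Longrightarrow> s k \<in> carrier G) \<Longrightarrow> branch_product s \<sigma> \<in> carrier G"
  by (induction \<sigma>) (auto intro: m_closed)

lemma (in monoid) branch_product_cong:
  "(\<And>k. k < length \<sigma> \<Longrightarrow> s k = s' k) \<Longrightarrow> branch_product s \<sigma> = branch_product s' \<sigma>"
  by (induction \<sigma>) auto

text \<open>Suppose that arbitrarily far along \<open>N\<close> there are \<open>s\<close> and \<open>t\<close> with \<open>|u(s t) - u(t)| \<ge> e\<close>. Choose such pairs
  \<open>(s\<^sub>n, t\<^sub>n)\<close> one after the other, and let \<open>p\<^sub>\<sigma>\<close> be the product of those \<open>s\<^sub>k\<close> that the branch \<open>\<sigma>\<close> selects. The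
  translates by \<open>p\<^sub>\<rho>\<close> and by \<open>s\<^sub>k p\<^sub>\<rho>\<close> differ by at least \<open>e\<close> at \<open>p\<^sub>\<rho>\<^sup>-\<^sup>1 t\<^sub>k\<close>. Pointwise convergence
  along \<open>N\<close> allows the later \<open>s\<^sub>n\<close> to be chosen so far along that they hardly change the values at these
  finitely many points. So any two distinct infinite branches have limit functions at distance at least
  \<open>e/2\<close>. There are uncountably many branches but only countably many \<open>p\<^sub>\<sigma>\<close>, which contradicts
  \<open>interchange_limits_cluster\<close>.\<close>

lemma (in group) uniform_left_translation:
  fixes u :: "'a \<Rightarrow> complex"
  assumes u: "double_limit_property G u" and bd: "\<And>t. t \<in> carrier G \<Longrightarrow> cmod (u t) \<le> C"
    and N: "eventually (\<lambda>s. s \<in> carrier G) N"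
    and pt: "\<And>t. t \<in> carrier G \<Longrightarrow> ((\<lambda>s. u (s \<otimes> t)) \<longlongrightarrow> u t) N"
    and e: "e > 0"
  shows "eventually (\<lambda>s. \<forall>t\<in>carrier G. cmod (u (s \<otimes> t) - u t) < e) N"
proof (rule ccontr)
  assume bad: "\<not> ?thesis"
  have pick: "\<exists>s\<in>carrier G. \<exists>t\<in>carrier G. e \<le> cmod (u (s \<otimes> t) - u t) \<and> P s" if "eventually P N" for P
  proof (rule ccontr)
    assume "\<not> ?thesis"
    then have none: "\<And>s t. s \<in> carrier G \<Longrightarrow> P s \<Longrightarrow> t \<in> carrier G \<Longrightarrow> cmod (u (s \<otimes> t) - u t) < e"
      by (meson not_le)
    from N that have "eventually (\<lambda>s. \<forall>t\<in>carrier G. cmod (u (s \<otimes> t) - u t) < e) N"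
      by eventually_elim (use none in blast)
    with bad show False ..
  qed
  define z where "z f \<rho> = inv (branch_product (fst \<circ> f) \<rho>) \<otimes> snd (f (length \<rho>))"
    for f :: "nat \<Rightarrow> 'a \<times> 'a" and \<rho>
  define Q where "Q f n r \<longleftrightarrow> fst r \<in> carrier G \<and> snd r \<in> carrier G \<and>
      e \<le> cmod (u (fst r \<otimes> snd r) - u (snd r)) \<and>
      (\<forall>\<sigma> \<rho>. length \<sigma> = n \<and> length \<rho> < n \<longrightarrow>
        cmod (u (fst r \<otimes> (branch_product (fst \<circ> f) \<sigma> \<otimes> z f \<rho>))
          - u (branch_product (fst \<circ> f) \<sigma> \<otimes> z f \<rho>)) < e / 4 / 2^n)"
    for f :: "nat \<Rightarrow> 'a \<times> 'a" and n r
  have "\<exists>f. \<forall>n. Q f n (f n)"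
  proof (rule dependent_wellorder_choice)
    fix r and f g :: "nat \<Rightarrow> 'a \<times> 'a" and n :: nat
    assume eq: "\<And>k. k < n \<Longrightarrow> f k = g k"
    have "branch_product (fst \<circ> f) \<sigma> = branch_product (fst \<circ> g) \<sigma>" if "length \<sigma> \<le> n" for \<sigma>
      using that by (intro branch_product_cong) (simp add: eq)
    then show "Q f n r = Q g n r" by (auto simp: Q_def z_def eq)
  next
    fix n and f :: "nat \<Rightarrow> 'a \<times> 'a"
    assume f: "\<And>k. k < n \<Longrightarrow> Q f k (f k)"
    define I where "I = {\<sigma>::bool list. length \<sigma> = n} \<times> (\<Union>k<n. {\<rho>::bool list. length \<rho> = k})"
    have fin: "finite I"
    proof -
      have "finite {\<rho>::bool list. length \<rho> = k}" for k
        using finite_lists_length_eq[of "UNIV::bool set" k] by simp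
      then show ?thesis unfolding I_def by (intro finite_cartesian_product finite_UN_I) auto
    qed
    have bp: "branch_product (fst \<circ> f) \<sigma> \<in> carrier G" if "length \<sigma> \<le> n" for \<sigma>
      using that f by (intro branch_product_closed) (auto simp: Q_def)
    have "eventually (\<lambda>s. \<forall>p\<in>I.
        cmod (u (s \<otimes> (branch_product (fst \<circ> f) (fst p) \<otimes> z f (snd p)))
          - u (branch_product (fst \<circ> f) (fst p) \<otimes> z f (snd p))) < e / 4 / 2^n) N"
    proof (rule eventually_ball_finite[OF fin], rule ballI)
      fix p assume "p \<in> I"
      then have "branch_product (fst \<circ> f) (fst p) \<otimes> z f (snd p) \<in> carrier G"
        using bp f by (auto simp: I_def z_def Q_def intro!: m_closed inv_closed)
      from tendstoD[OF pt[OF this], of "e / 4 / 2^n"] e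
      show "eventually (\<lambda>s. cmod (u (s \<otimes> (branch_product (fst \<circ> f) (fst p) \<otimes> z f (snd p)))
          - u (branch_product (fst \<circ> f) (fst p) \<otimes> z f (snd p))) < e / 4 / 2^n) N"
        by (simp add: dist_norm)
    qed
    from pick[OF this] obtain s t where "s \<in> carrier G" "t \<in> carrier G" "e \<le> cmod (u (s \<otimes> t) - u t)"
      "\<And>p. p \<in> I \<Longrightarrow> cmod (u (s \<otimes> (branch_product (fst \<circ> f) (fst p) \<otimes> z f (snd p)))
          - u (branch_product (fst \<circ> f) (fst p) \<otimes> z f (snd p))) < e / 4 / 2^n"
      by blast
    then have "Q f n (s, t)" unfolding Q_def by (auto simp: I_def)
    then show "\<exists>r. Q f n r" ..
  qed
  then obtain f where f: "\<And>n. Q f n (f n)" by blast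
  define p where "p = branch_product (fst \<circ> f)"
  have f_in: "fst (f n) \<in> carrier G" "snd (f n) \<in> carrier G" for n using f[of n] by (auto simp: Q_def)
  have p_in: "p \<sigma> \<in> carrier G" for \<sigma>
    unfolding p_def using f_in by (intro branch_product_closed) simp
  have z_in: "z f \<rho> \<in> carrier G" for \<rho>
    unfolding z_def using p_in f_in by (auto simp: p_def)
  have gap: "e \<le> cmod (u (fst (f n) \<otimes> snd (f n)) - u (snd (f n)))" for n using f[of n] by (simp add: Q_def)
  have small: "cmod (u (p (b # \<sigma>) \<otimes> z f \<rho>) - u (p \<sigma> \<otimes> z f \<rho>)) \<le> e / 4 / 2^(length \<sigma>)"
    if "length \<rho> < length \<sigma>" for b \<sigma> \<rho>
  proof (cases b)
    case True
    have "cmod (u (fst (f (length \<sigma>)) \<otimes> (p \<sigma> \<otimes> z f \<rho>)) - u (p \<sigma> \<otimes> z f \<rho>)) < e / 4 / 2^(length \<sigma>)"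
      using f[of "length \<sigma>"] that by (simp add: Q_def p_def)
    then show ?thesis using True f_in p_in z_in by (simp add: p_def m_assoc)
  next
    case False
    then show ?thesis using e by (simp add: p_def)
  qed
  obtain V :: "nat filter" where V: "V \<le> sequentially" "ultrafilter_on UNIV V"
    by (rule ultrafilter_below[OF trivial_limit_sequentially]) auto
  define U where "U i = filtermap (branch i) V" for i
  have U: "ultrafilter_on UNIV (U i)" for i
    unfolding U_def using V(2) by (rule ultrafilter_on_filtermap) simp
  have "\<exists>i\<in>UNIV. \<exists>j\<in>UNIV. i \<noteq> j \<and>
    (\<forall>y\<in>carrier G. cmod (Lim (U i) (\<lambda>c. u (p c \<otimes> y)) - Lim (U j) (\<lambda>c. u (p c \<otimes> y))) < e/2)"
    by (rule interchange_limits_cluster[OF u[unfolded double_limit_property_def] _ p_in U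
          uncountable_nat_to_bool, where C = C]) (use bd e in auto)
  then obtain i j where ij: "i \<noteq> j" and close: "\<And>y. y \<in> carrier G \<Longrightarrow>
    cmod (Lim (U i) (\<lambda>c. u (p c \<otimes> y)) - Lim (U j) (\<lambda>c. u (p c \<otimes> y))) < e/2"
    by blast
  define k where "k = (LEAST k. i k \<noteq> j k)"
  obtain m where "i m \<noteq> j m" using ij by blast
  then have k: "i k \<noteq> j k" unfolding k_def by (rule LeastI[of "\<lambda>k. i k \<noteq> j k"])
  have less: "i m = j m" if "m < k" for m using not_less_Least[of m "\<lambda>k. i k \<noteq> j k"] that by (simp add: k_def)
  define \<rho> where "\<rho> = branch i k"
  have \<rho>: "branch j k = \<rho>" "length \<rho> = k" using branch_cong[of k i j] less by (auto simp: \<rho>_def)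
  let ?y = "z f \<rho>"
  \<comment> \<open>beyond level \<open>k + 1\<close> the values at \<open>?y\<close> move by at most \<open>\<Sum>\<^sub>m e/4/2\<^sup>m\<^sup>+\<^sup>1 = e/4\<close> in total\<close>
  have tail: "cmod (Lim (U l) (\<lambda>c. u (p c \<otimes> ?y)) - u (p (branch l (Suc k)) \<otimes> ?y)) \<le> e/4" for l
  proof -
    define a where "a m = u (p (branch l (Suc k + m)) \<otimes> ?y)" for m
    have *: "cmod (a m - a 0) \<le> e/4 * (1 - 1/2^m)" for m
    proof (induction m)
      case (Suc m)
      have "cmod (a (Suc m) - a m) \<le> e/4 / 2^(Suc k + m)"
        using small[of \<rho> "branch l (Suc k + m)" "l (Suc k + m)"] \<rho>(2) by (simp add: a_def)
      also have "\<dots> \<le> e/4 / 2^(Suc m)"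
        using e by (intro divide_left_mono) auto
      finally have "cmod (a (Suc m) - a m) \<le> e/4 / 2^(Suc m)" .
      moreover have "cmod (a (Suc m) - a 0) \<le> cmod (a (Suc m) - a m) + cmod (a m - a 0)"
        using norm_triangle_ineq[of "a (Suc m) - a m" "a m - a 0"] by simp
      moreover have "e/4 / 2^(Suc m) + e/4 * (1 - 1/2^m) = e/4 * (1 - 1/2^(Suc m))"
        by (simp add: field_simps)
      ultimately show ?case using Suc by linarith
    qed simp
    have "cmod (u (p (branch l n) \<otimes> ?y) - u (p (branch l (Suc k)) \<otimes> ?y)) \<le> e/4" if "n > k" for n
    proof -
      have "e/4 * (1 - 1/2^m) \<le> e/4 * 1" for m using e by (intro mult_left_mono) auto
      from order_trans[OF * this, of "n - Suc k"] that show ?thesis by (simp add: a_def)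
    qed
    then have ev: "eventually (\<lambda>n. cmod (u (p (branch l n) \<otimes> ?y) - u (p (branch l (Suc k)) \<otimes> ?y)) \<le> e/4) V"
      using filter_leD[OF V(1) eventually_gt_at_top[of k]] by (auto elim: eventually_mono)
    have "((\<lambda>c. u (p c \<otimes> ?y)) \<longlongrightarrow> Lim (U l) (\<lambda>c. u (p c \<otimes> ?y))) (U l)"
      by (rule ultrafilter_tendsto[OF U]) (rule bd, simp add: p_in z_in)
    then have "((\<lambda>n. u (p (branch l n) \<otimes> ?y)) \<longlongrightarrow> Lim (U l) (\<lambda>c. u (p c \<otimes> ?y))) V"
      by (simp add: U_def filterlim_filtermap)
    then have "((\<lambda>n. cmod (u (p (branch l n) \<otimes> ?y) - u (p (branch l (Suc k)) \<otimes> ?y)))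
      \<longlongrightarrow> cmod (Lim (U l) (\<lambda>c. u (p c \<otimes> ?y)) - u (p (branch l (Suc k)) \<otimes> ?y))) V"
      by (intro tendsto_norm tendsto_diff tendsto_const)
    then show ?thesis by (rule tendsto_upperbound[OF _ ev]) (use ultrafilter_onD(1)[OF V(2)] in auto)
  qed
  have py: "p \<rho> \<otimes> ?y = snd (f k)"
    using p_in f_in \<rho>(2) by (simp add: z_def p_def[symmetric] m_assoc[symmetric])
  have "fst (f k) \<otimes> p \<rho> \<otimes> ?y = fst (f k) \<otimes> snd (f k)"
    using py f_in p_in z_in by (simp add: m_assoc)
  then have val: "u (p (branch l (Suc k)) \<otimes> ?y) = (if l k then u (fst (f k) \<otimes> snd (f k)) else u (snd (f k)))"
    if "branch l k = \<rho>" for l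
    using that py \<rho>(2) by (auto simp: p_def)
  have "e \<le> cmod (u (p (branch i (Suc k)) \<otimes> ?y) - u (p (branch j (Suc k)) \<otimes> ?y))"
    unfolding val[OF \<rho>_def[symmetric]] val[OF \<rho>(1)]
    using gap[of k] k by (cases "i k"; cases "j k") (auto simp: norm_minus_commute)
  moreover have "cmod (a - b) \<le> cmod (a' - a) + cmod (a' - b') + cmod (b' - b)" for a b a' b'
    using norm_triangle_ineq4[of "a' - b'" "a' - a"] norm_triangle_ineq[of "a - b'" "b' - b"]
    by (simp add: algebra_simps)
  ultimately have "e \<le> e/4 + cmod (Lim (U i) (\<lambda>c. u (p c \<otimes> ?y)) - Lim (U j) (\<lambda>c. u (p c \<otimes> ?y))) + e/4"
    using tail[of i] tail[of j] by (meson add_mono order_refl order_trans)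
  with close[OF z_in, of \<rho>] show False by simp
qed

definition opposite :: "('a, 'm) monoid_scheme \<Rightarrow> 'a monoid" where
  "opposite G = \<lparr>carrier = carrier G, monoid.mult = (\<lambda>x y. y \<otimes>\<^bsub>G\<^esub> x), one = \<one>\<^bsub>G\<^esub>\<rparr>"

lemma opposite_simps [simp]: "carrier (opposite G) = carrier G"
  "x \<otimes>\<^bsub>opposite G\<^esub> y = y \<otimes>\<^bsub>G\<^esub> x"
  by (simp_all add: opposite_def)

lemma (in group) group_opposite: "group (opposite G)"
  by (rule groupI) (auto simp: opposite_def m_assoc intro: r_inv)

lemma double_limit_property_opposite:
  "double_limit_property G u \<Longrightarrow> double_limit_property (opposite G) u"
  unfolding double_limit_property_def using interchange_swap by fastforce

lemma (in group) uniform_right_translation: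
  fixes u :: "'a \<Rightarrow> complex"
  assumes "double_limit_property G u" "\<And>t. t \<in> carrier G \<Longrightarrow> cmod (u t) \<le> C"
    "eventually (\<lambda>s. s \<in> carrier G) N"
    "\<And>t. t \<in> carrier G \<Longrightarrow> ((\<lambda>s. u (t \<otimes> s)) \<longlongrightarrow> u t) N" "e > 0"
  shows "eventually (\<lambda>s. \<forall>t\<in>carrier G. cmod (u (t \<otimes> s) - u t) < e) N"
  using group.uniform_left_translation[OF group_opposite double_limit_property_opposite[OF assms(1)], of C N e]
    assms(2-) by simp

section \<open>The algebra of weakly almost periodic functions\<close>

context topgroup
begin

lemma wap_imp:
  assumes "u \<in> wap G \<tau>"
  shows "u \<in> bounded_continuous \<tau>" "double_limit_property G u" "continuous_map \<tau> euclidean u"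
    "cmod (u t) \<le> uniform_norm u" "t \<notin> carrier G \<Longrightarrow> u t = 0"
  using assms bounded_continuousD[of u \<tau>] by (auto simp: wap_iff_double_limit_property)

lemma wap_tendsto:
  assumes "u \<in> wap G \<tau>" "ultrafilter_on X F"
  shows "((\<lambda>x. u (f x)) \<longlongrightarrow> Lim F (\<lambda>x. u (f x))) F"
  by (rule ultrafilter_tendsto[OF assms(2) wap_imp(4)[OF assms(1)]])

lemma wap_continuous_image:
  fixes h :: "complex \<times> complex \<Rightarrow> complex"
  assumes u: "u \<in> wap G \<tau>" and v: "v \<in> wap G \<tau>"
    and S: "closed S" "continuous_on S h" "\<And>t. t \<in> carrier G \<Longrightarrow> (u t, v t) \<in> S"
    and w: "\<And>t. t \<in> carrier G \<Longrightarrow> w t = h (u t, v t)" "\<And>t. t \<notin> carrier G \<Longrightarrow> w t = 0"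
  shows "w \<in> wap G \<tau>"
  unfolding wap_iff_double_limit_property
proof
  let ?B = "cball 0 (uniform_norm u) \<times> cball 0 (uniform_norm v)"
  have "compact (?B \<inter> S)" using S(1) by (intro compact_Int_closed compact_Times compact_cball)
  then have "bounded (h ` (?B \<inter> S))"
    using continuous_on_subset[OF S(2)] by (intro compact_imp_bounded compact_continuous_image) auto
  then obtain K where "\<And>z. z \<in> ?B \<inter> S \<Longrightarrow> cmod (h z) \<le> K" unfolding bounded_iff by blast
  then have K: "cmod (w t) \<le> K" if "t \<in> carrier G" for t
    using that S(3) wap_imp(4)[OF u] wap_imp(4)[OF v] by (simp add: w(1))
  show "w \<in> bounded_continuous \<tau>"
  proof (rule bounded_continuousI)
    show "continuous_map \<tau> euclidean w"
    proof (rule continuous_on_groupI)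
      fix a assume a: "a \<in> carrier G"
      have "((\<lambda>t. (u t, v t)) \<longlongrightarrow> (u a, v a)) (nhdsin \<tau> a)"
        using wap_imp(3)[OF u] wap_imp(3)[OF v] a
        by (intro tendsto_Pair) (auto simp: continuous_map_euclidean_iff)
      moreover have "eventually (\<lambda>t. (u t, v t) \<in> S) (nhdsin \<tau> a)"
        using eventually_nhdsin_carrier[OF a] by eventually_elim (rule S(3))
      ultimately have "((\<lambda>t. h (u t, v t)) \<longlongrightarrow> h (u a, v a)) (nhdsin \<tau> a)"
        using continuous_on_tendsto_compose[OF S(2) _ S(3)[OF a]] by blast
      moreover have "eventually (\<lambda>t. h (u t, v t) = w t) (nhdsin \<tau> a)"
        using eventually_nhdsin_carrier[OF a] by eventually_elim (simp add: w)
      ultimately show "(w \<longlongrightarrow> w a) (nhdsin \<tau> a)"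
        using a by (simp add: w(1) Lim_transform_eventually)
    qed
  qed (use K w in auto)
  have "interchange (carrier G) (carrier G) (\<lambda>s t. h (u (s \<otimes> t), v (s \<otimes> t)))"
    using wap_imp(2)[OF u] wap_imp(2)[OF v] S wap_imp(4)[OF u] wap_imp(4)[OF v]
    unfolding double_limit_property_def
    by (intro interchange_continuous_image[where C = "uniform_norm u" and C' = "uniform_norm v"]) auto
  then show "double_limit_property G w"
    unfolding double_limit_property_def
    by (rule interchange_cong[THEN iffD1, rotated]) (simp add: w)
qed

lemma wap_const: "(\<lambda>t. if t \<in> carrier G then c else 0) \<in> wap G \<tau>"
  unfolding wap_iff_double_limit_property
proof
  show "(\<lambda>t. if t \<in> carrier G then c else 0) \<in> bounded_continuous \<tau>"
  proof (rule bounded_continuousI[where B = "cmod c"])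
    show "continuous_map \<tau> euclidean (\<lambda>t. if t \<in> carrier G then c else 0)"
      by (rule continuous_map_eq[where f = "\<lambda>_. c"]) auto
  qed auto
  have "interchange (carrier G) (carrier G) (\<lambda>s t. c)"
    unfolding interchange_def by (metis Lim_const_ultrafilter)
  then show "double_limit_property G (\<lambda>t. if t \<in> carrier G then c else 0)"
    unfolding double_limit_property_def
    by (rule interchange_cong[THEN iffD1, rotated]) simp
qed

lemma wap_zero: "(\<lambda>t. 0) \<in> wap G \<tau>"
  using wap_const[of 0] by simp

lemma wap_add: "u \<in> wap G \<tau> \<Longrightarrow> v \<in> wap G \<tau> \<Longrightarrow> (\<lambda>t. u t + v t) \<in> wap G \<tau>"
  by (rule wap_continuous_image[where S = UNIV and h = "\<lambda>z. fst z + snd z"])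
    (auto simp: wap_imp(5) intro!: continuous_intros)

lemma wap_mult: "u \<in> wap G \<tau> \<Longrightarrow> v \<in> wap G \<tau> \<Longrightarrow> (\<lambda>t. u t * v t) \<in> wap G \<tau>"
  by (rule wap_continuous_image[where S = UNIV and h = "\<lambda>z. fst z * snd z"])
    (auto simp: wap_imp(5) intro!: continuous_intros)

lemma wap_scale: "u \<in> wap G \<tau> \<Longrightarrow> (\<lambda>t. c * u t) \<in> wap G \<tau>"
  by (rule wap_continuous_image[where S = UNIV and h = "\<lambda>z. c * fst z" and v = u])
    (auto simp: wap_imp(5) intro!: continuous_intros)

lemma wap_cnj: "u \<in> wap G \<tau> \<Longrightarrow> (\<lambda>t. cnj (u t)) \<in> wap G \<tau>"
  by (rule wap_continuous_image[where S = UNIV and h = "\<lambda>z. cnj (fst z)" and v = u])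
    (auto simp: wap_imp(5) intro!: continuous_intros)

lemma wap_diff: "u \<in> wap G \<tau> \<Longrightarrow> v \<in> wap G \<tau> \<Longrightarrow> (\<lambda>t. u t - v t) \<in> wap G \<tau>"
  by (rule wap_continuous_image[where S = UNIV and h = "\<lambda>z. fst z - snd z"])
    (auto simp: wap_imp(5) intro!: continuous_intros)

lemma wap_reciprocal:
  assumes u: "u \<in> wap G \<tau>" and d: "d > 0" "\<And>t. t \<in> carrier G \<Longrightarrow> cmod (u t) \<ge> d"
  shows "(\<lambda>t. if t \<in> carrier G then 1 / u t else 0) \<in> wap G \<tau>"
proof (rule wap_continuous_image[OF u u, where S = "{z. d \<le> cmod (fst z)}" and h = "\<lambda>z. 1 / fst z"])
  show "closed {z::complex \<times> complex. d \<le> cmod (fst z)}"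
    by (intro closed_Collect_le continuous_intros)
  show "continuous_on {z::complex \<times> complex. d \<le> cmod (fst z)} (\<lambda>z. 1 / fst z)"
    using d(1) by (intro continuous_intros) auto
qed (use d in auto)

lemma linear_subspace_wap: "linear_subspace (wap G \<tau>)"
  unfolding linear_subspace_def using wap_zero wap_add wap_scale by blast

lemma norm_closed_wap: "norm_closed (wap G \<tau>)"
  unfolding norm_closed_def
proof (intro allI impI, elim conjE)
  fix f :: "nat \<Rightarrow> 'a \<Rightarrow> complex" and u
  assume f: "\<forall>n. f n \<in> wap G \<tau>" and lim: "uniform_limit UNIV f u sequentially"
  have approx: "\<exists>n. \<forall>t. cmod (u t - f n t) \<le> e" if e: "e > 0" for e
  proof -
    have "eventually (\<lambda>n. \<forall>t\<in>UNIV. dist (f n t) (u t) < e) sequentially"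
      using uniform_limitD[OF lim e] .
    then obtain n where "\<And>t. dist (f n t) (u t) < e" unfolding eventually_sequentially by blast
    then show ?thesis by (intro exI[of _ n]) (auto simp: dist_norm norm_minus_commute intro: less_imp_le)
  qed
  obtain n where n: "\<And>t. cmod (u t - f n t) \<le> 1" using approx[of 1] by auto
  have bd: "cmod (u t) \<le> uniform_norm (f n) + 1" for t
    using n[of t] wap_imp(4)[of "f n" t] f norm_triangle_ineq2[of "u t" "f n t"] by force
  have "u \<in> bounded_continuous \<tau>"
  proof (rule bounded_continuousI[OF _ bd])
    show "continuous_map \<tau> euclidean u"
    proof (rule continuous_on_groupI, rule tendsto_uniform_limit[OF lim])
      fix a n assume "a \<in> carrier G"
      then show "(f n \<longlongrightarrow> f n a) (nhdsin \<tau> a)"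
        using wap_imp(3)[of "f n"] f by (auto simp: continuous_map_euclidean_iff)
    qed
    fix t assume t: "t \<notin> topspace \<tau>"
    have "f m t = 0" for m using f t wap_imp(5)[of "f m" t] by simp
    moreover have "(\<lambda>m. f m t) \<longlonglongrightarrow> u t" using tendsto_uniform_limitI[OF lim] by blast
    ultimately show "u t = 0" by (simp add: LIMSEQ_const_iff)
  qed
  moreover have "double_limit_property G u"
    unfolding double_limit_property_def
  proof (rule interchange_approx)
    show "cmod (u (x \<otimes> y)) \<le> uniform_norm (f n) + 1" for x y by (rule bd)
    fix e :: real assume "e > 0"
    from approx[OF this] obtain m where "\<And>t. cmod (u t - f m t) \<le> e" by blast
    moreover have "interchange (carrier G) (carrier G) (\<lambda>s t. f m (s \<otimes> t))"
      using f wap_imp(2)[of "f m"] by (simp add: double_limit_property_def)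
    ultimately show "\<exists>w'. interchange (carrier G) (carrier G) w' \<and>
        (\<forall>x\<in>carrier G. \<forall>y\<in>carrier G. cmod (u (x \<otimes> y) - w' x y) \<le> e)"
      by blast
  qed
  ultimately show "u \<in> wap G \<tau>" by (simp add: wap_iff_double_limit_property)
qed

lemma wap_translate_r_closed:
  assumes u: "u \<in> wap G \<tau>" and s: "s \<in> carrier G"
  shows "translate_r G u s \<in> wap G \<tau>"
  unfolding wap_iff_double_limit_property
proof
  show "translate_r G u s \<in> bounded_continuous \<tau>"
    using translate_r_bounded_continuous[OF wap_imp(1)[OF u] s] .
  have "interchange (carrier G) (carrier G) (\<lambda>a b. u (s \<otimes> a \<otimes> b))"
    using interchange_reindex[OF wap_imp(2)[OF u, unfolded double_limit_property_def],
        of "carrier G" "\<lambda>a. s \<otimes> a" "carrier G" "\<lambda>b. b"] s by simp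
  then show "double_limit_property G (translate_r G u s)"
    unfolding double_limit_property_def
    by (rule interchange_cong[THEN iffD1, rotated]) (simp add: translate_r_def m_assoc s)
qed

lemma wap_translate_l_closed:
  assumes u: "u \<in> wap G \<tau>" and s: "s \<in> carrier G"
  shows "translate_l G s u \<in> wap G \<tau>"
  unfolding wap_iff_double_limit_property
proof
  show "translate_l G s u \<in> bounded_continuous \<tau>"
    by (rule bounded_continuousI[OF translate_l_continuous[OF wap_imp(3)[OF u] s], where B = "uniform_norm u"])
      (auto simp: translate_l_def wap_imp(4)[OF u])
  have "interchange (carrier G) (carrier G) (\<lambda>a b. u (a \<otimes> (b \<otimes> s)))"
    using interchange_reindex[OF wap_imp(2)[OF u, unfolded double_limit_property_def],
        of "carrier G" "\<lambda>a. a" "carrier G" "\<lambda>b. b \<otimes> s"] s by simp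
  then show "double_limit_property G (translate_l G s u)"
    unfolding double_limit_property_def
    by (rule interchange_cong[THEN iffD1, rotated]) (simp add: translate_l_def m_assoc s)
qed

end

section \<open>The points of the compactification\<close>

definition ultrafilter_point ::
  "('a, 'm) monoid_scheme \<Rightarrow> 'a topology \<Rightarrow> 'a filter \<Rightarrow> (('a \<Rightarrow> complex) \<Rightarrow> complex)" where
  "ultrafilter_point G \<tau> F = (\<lambda>u\<in>wap G \<tau>. Lim F u)"

lemma topspace_weak_star [simp]: "topspace (weak_star_topology X) = dual X"
  by (auto simp: weak_star_topology_def dual_def PiE_def)

lemma limitin_weak_star:
  "limitin (weak_star_topology X) g p F \<longleftrightarrow>
     p \<in> dual X \<and> eventually (\<lambda>x. g x \<in> dual X) F \<and> (\<forall>u\<in>X. ((\<lambda>x. g x u) \<longlongrightarrow> p u) F)"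
proof -
  have ext: "q \<in> extensional X" if "q \<in> dual X" for q using that by (simp add: dual_def)
  have "eventually (\<lambda>x. g x \<in> topspace (product_topology (\<lambda>_. euclidean) X)) F"
    if "eventually (\<lambda>x. g x \<in> dual X) F"
    using that by eventually_elim (simp add: PiE_def ext)
  then show ?thesis
    unfolding weak_star_topology_def limitin_subtopology limitin_componentwise
    using ext by auto
qed

context topgroup
begin

abbreviation W where "W \<equiv> wap G \<tau>"
abbreviation K where "K \<equiv> wap_compactification G \<tau>"

lemma carrier_K [simp]: "carrier K = wap_points G \<tau>"
  by (simp add: wap_compactification_def)

lemma wap_points_subset_dual: "wap_points G \<tau> \<subseteq> dual W"
  using closure_of_subset_topspace[of "weak_star_topology W"] by (simp add: wap_points_def)

lemma topspace_wap_topology [simp]: "topspace (wap_topology G \<tau>) = wap_points G \<tau>"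
  using wap_points_subset_dual by (auto simp: wap_topology_def)

lemma limitin_wap_topology:
  "limitin (wap_topology G \<tau>) g p F \<longleftrightarrow>
     p \<in> wap_points G \<tau> \<and> eventually (\<lambda>x. g x \<in> wap_points G \<tau>) F \<and> (\<forall>u\<in>W. ((\<lambda>x. g x u) \<longlongrightarrow> p u) F)"
proof -
  have "eventually (\<lambda>x. g x \<in> dual W) F" if "eventually (\<lambda>x. g x \<in> wap_points G \<tau>) F"
    using that by eventually_elim (use wap_points_subset_dual in blast)
  then show ?thesis
    unfolding wap_topology_def limitin_subtopology limitin_weak_star
    using wap_points_subset_dual by blast
qed

lemma continuous_map_into_wap_topology:
  "continuous_map X (wap_topology G \<tau>) g \<longleftrightarrow>
     g \<in> topspace X \<rightarrow> wap_points G \<tau> \<and> (\<forall>u\<in>W. continuous_map X euclidean (\<lambda>x. g x u))"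
proof -
  have "eventually (\<lambda>y. g y \<in> wap_points G \<tau>) (nhdsin X x)"
    if "g \<in> topspace X \<rightarrow> wap_points G \<tau>" for x
    using that openin_topspace[of X] by (auto simp: eventually_nhdsin)
  then show ?thesis
    unfolding continuous_map_iff_limitin_nhdsin limitin_wap_topology by (auto simp: Pi_iff)
qed

lemma wap_eval_eq: "s \<in> carrier G \<Longrightarrow> wap_eval G \<tau> s = ultrafilter_point G \<tau> (principal {s})"
  by (auto simp: wap_eval_def ultrafilter_point_def Lim_principal)

lemma ultrafilter_point_in_dual:
  assumes "ultrafilter_on (carrier G) F" shows "ultrafilter_point G \<tau> F \<in> dual W"
  unfolding ultrafilter_point_def
  using assms ultrafilter_on_mono[OF assms, of UNIV] wap_imp(1) linear_subspace_wap
  by (intro Lim_functional_in_dual[where \<tau> = \<tau>]) auto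

lemma wap_eval_in_dual: "s \<in> carrier G \<Longrightarrow> wap_eval G \<tau> s \<in> dual W"
  by (simp add: wap_eval_eq ultrafilter_point_in_dual ultrafilter_on_principal)

lemma wap_eval_in_points: "s \<in> carrier G \<Longrightarrow> wap_eval G \<tau> s \<in> wap_points G \<tau>"
  unfolding wap_points_def
  using closure_of_subset[of "wap_eval G \<tau> ` carrier G" "weak_star_topology W"] wap_eval_in_dual by auto

lemma ultrafilter_point_in_points:
  assumes F: "ultrafilter_on (carrier G) F"
  shows "ultrafilter_point G \<tau> F \<in> wap_points G \<tau>"
  unfolding wap_points_def in_closure_of
proof (intro conjI allI impI)
  show "ultrafilter_point G \<tau> F \<in> topspace (weak_star_topology W)"
    using ultrafilter_point_in_dual[OF F] by simp
  fix T assume T: "ultrafilter_point G \<tau> F \<in> T \<and> openin (weak_star_topology W) T"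
  have "limitin (weak_star_topology W) (wap_eval G \<tau>) (ultrafilter_point G \<tau> F) F"
    unfolding limitin_weak_star
  proof (intro conjI ballI)
    show "eventually (\<lambda>s. wap_eval G \<tau> s \<in> dual W) F"
      using ultrafilter_onD(2)[OF F] by eventually_elim (rule wap_eval_in_dual)
    show "((\<lambda>s. wap_eval G \<tau> s u) \<longlongrightarrow> ultrafilter_point G \<tau> F u) F" if "u \<in> W" for u
      using wap_tendsto[OF that F, of "\<lambda>x. x"] that by (simp add: wap_eval_def ultrafilter_point_def)
  qed (rule ultrafilter_point_in_dual[OF F])
  then have "eventually (\<lambda>s. wap_eval G \<tau> s \<in> T) F" using T by (simp add: limitin_def)
  with ultrafilter_onD(2)[OF F] have "eventually (\<lambda>s. s \<in> carrier G \<and> wap_eval G \<tau> s \<in> T) F"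
    by eventually_elim simp
  then show "\<exists>y. y \<in> wap_eval G \<tau> ` carrier G \<and> y \<in> T"
    using eventually_happens'[OF ultrafilter_onD(1)[OF F]] by blast
qed

text \<open>The filter is proper because \<open>p\<close> lies in the closure of the evaluations; convergence along it
  is the convergence of evaluations to \<open>p\<close>, tested on one function at a time.\<close>

lemma approach_facts:
  assumes p: "p \<in> wap_points G \<tau>"
  shows "approach G \<tau> p \<noteq> bot" "eventually (\<lambda>s. s \<in> carrier G) (approach G \<tau> p)"
    "u \<in> W \<Longrightarrow> (u \<longlongrightarrow> p u) (approach G \<tau> p)"
proof -
  let ?N = "nhdsin (wap_topology G \<tau>) p"
  show car: "eventually (\<lambda>s. s \<in> carrier G) (approach G \<tau> p)"
    by (simp add: approach_def eventually_inf_principal)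
  have "\<not> eventually (\<lambda>_. False) (approach G \<tau> p)"
  proof
    assume "eventually (\<lambda>_. False) (approach G \<tau> p)"
    then have "eventually (\<lambda>q. \<forall>s. wap_eval G \<tau> s = q \<longrightarrow> s \<notin> carrier G) ?N"
      by (auto simp: approach_def eventually_inf_principal eventually_filtercomap elim!: eventually_mono)
    then obtain S where S: "openin (wap_topology G \<tau>) S" "p \<in> S"
      "\<And>s. wap_eval G \<tau> s \<in> S \<Longrightarrow> s \<notin> carrier G"
      using p by (auto simp: eventually_nhdsin)
    then obtain T where T: "openin (weak_star_topology W) T" "S = T \<inter> wap_points G \<tau>"
      by (auto simp: wap_topology_def openin_subtopology)
    then obtain s where "s \<in> carrier G" "wap_eval G \<tau> s \<in> T"
      using p S(2) unfolding wap_points_def in_closure_of by auto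
    then show False using S(3) T(2) wap_eval_in_points by blast
  qed
  then show "approach G \<tau> p \<noteq> bot" by (simp add: eventually_False)
  assume u: "u \<in> W"
  have "limitin (wap_topology G \<tau>) (\<lambda>q. q) p ?N" using p by (intro limitin_nhdsin_id) simp
  then have "((\<lambda>q. q u) \<longlongrightarrow> p u) ?N" using u by (simp add: limitin_wap_topology)
  then have "((\<lambda>s. wap_eval G \<tau> s u) \<longlongrightarrow> p u) (filtercomap (wap_eval G \<tau>) ?N)"
    by (rule filterlim_compose) (rule filterlim_filtercomap)
  then show "(u \<longlongrightarrow> p u) (approach G \<tau> p)"
    using u by (intro tendsto_mono[of "approach G \<tau> p"]) (auto simp: approach_def wap_eval_def)
qed

lemma wap_pointE:
  assumes p: "p \<in> wap_points G \<tau>"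
  obtains F where "ultrafilter_on (carrier G) F" "p = ultrafilter_point G \<tau> F"
proof -
  obtain F where F: "F \<le> approach G \<tau> p" "ultrafilter_on (carrier G) F"
    using ultrafilter_below[OF approach_facts(1)[OF p]] approach_facts(2)[OF p]
    by (metis le_principal)
  have "p = ultrafilter_point G \<tau> F"
  proof
    fix u
    show "p u = ultrafilter_point G \<tau> F u"
    proof (cases "u \<in> W")
      case True
      then have "(u \<longlongrightarrow> p u) F" using approach_facts(3)[OF p] tendsto_mono[OF F(1)] by blast
      then show ?thesis using True ultrafilter_Lim_eqI[OF F(2)] by (simp add: ultrafilter_point_def)
    next
      case False
      then show ?thesis
        using p wap_points_subset_dual by (auto simp: ultrafilter_point_def dual_def extensional_def)
    qed
  qed
  with F(2) that show ?thesis by blast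
qed

lemma wap_translate_eq:
  assumes u: "u \<in> W" and p: "p \<in> wap_points G \<tau>" and t: "t \<in> carrier G"
  shows "wap_translate G \<tau> u p t = p (translate_l G t u)"
proof -
  have "(translate_l G t u \<longlongrightarrow> p (translate_l G t u)) (approach G \<tau> p)"
    by (intro approach_facts(3)[OF p] wap_translate_l_closed u t)
  moreover have "eventually (\<lambda>r. translate_l G t u r = u (r \<otimes> t)) (approach G \<tau> p)"
    using approach_facts(2)[OF p] by eventually_elim (simp add: translate_l_def)
  ultimately have "((\<lambda>r. u (r \<otimes> t)) \<longlongrightarrow> p (translate_l G t u)) (approach G \<tau> p)"
    by (rule Lim_transform_eventually)
  then show ?thesis using t approach_facts(1)[OF p] by (simp add: wap_translate_def tendsto_Lim)
qed

lemma wap_translate_outside: "t \<notin> carrier G \<Longrightarrow> wap_translate G \<tau> u p t = 0"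
  by (simp add: wap_translate_def)

lemma wap_translate_ultrafilter:
  assumes u: "u \<in> W" and F: "ultrafilter_on (carrier G) F"
  shows "wap_translate G \<tau> u (ultrafilter_point G \<tau> F) =
    (\<lambda>t. if t \<in> carrier G then Lim F (\<lambda>s. u (s \<otimes> t)) else 0)"
proof
  fix t
  have "Lim F (translate_l G t u) = Lim F (\<lambda>s. u (s \<otimes> t))"
    by (rule Lim_cong_on[OF F]) (simp add: translate_l_def)
  then show "wap_translate G \<tau> u (ultrafilter_point G \<tau> F) t =
      (if t \<in> carrier G then Lim F (\<lambda>s. u (s \<otimes> t)) else 0)"
    using wap_translate_eq[OF u ultrafilter_point_in_points[OF F], of t] wap_translate_l_closed[OF u, of t]
    by (simp add: wap_translate_outside ultrafilter_point_def)
qed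

text \<open>For the double limit property of \<open>u \<cdot> p\<close> three limits have to be permuted, along \<open>A\<close>, \<open>B\<close> and the
  ultrafilter \<open>F\<close> of \<open>p\<close>. The limit along \<open>B\<close> first passes that along \<open>F\<close>; then \<open>F\<close> and \<open>A\<close> are
  combined into one ultrafilter, and \<open>B\<close> passes both at once.\<close>

lemma wap_translate_closed:
  assumes u: "u \<in> W" and p: "p \<in> wap_points G \<tau>"
  shows "wap_translate G \<tau> u p \<in> W"
proof -
  obtain F where F: "ultrafilter_on (carrier G) F" and p_eq: "p = ultrafilter_point G \<tau> F"
    using wap_pointE[OF p] .
  define v where "v = wap_translate G \<tau> u p"
  have v: "v t = Lim F (\<lambda>s. u (s \<otimes> t))" if "t \<in> carrier G" for t
    using that by (simp add: v_def p_eq wap_translate_ultrafilter[OF u F])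
  have v': "v = (\<lambda>t. Lim F (\<lambda>s. translate_r G u s t))"
  proof
    fix t
    have "Lim F (\<lambda>s. 0 :: complex) = 0" by (rule ultrafilter_Lim_eqI[OF F]) simp
    moreover have "v t = 0" if "t \<notin> carrier G"
      using that by (simp add: v_def wap_translate_outside)
    ultimately show "v t = Lim F (\<lambda>s. translate_r G u s t)"
      by (cases "t \<in> carrier G") (simp_all add: v translate_r_def)
  qed
  have "v \<in> bounded_continuous \<tau>"
    unfolding v' using wap_imp(1,2)[OF u] F
    by (intro limit_translate_bounded_continuous) (auto simp: double_limit_property_translate)
  moreover have "double_limit_property G v"
    unfolding double_limit_property_def interchange_def
  proof (intro allI impI, elim conjE)
    fix A B assume A: "ultrafilter_on (carrier G) A" and B: "ultrafilter_on (carrier G) B"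
    let ?C = "tensor_filter (\<otimes>) F A"
    have C: "ultrafilter_on (carrier G) ?C" by (rule ultrafilter_on_tensor_filter[OF F A]) simp
    have Lim_C: "Lim ?C f = Lim A (\<lambda>a. Lim F (\<lambda>s. f (s \<otimes> a)))"
      if "\<And>z. cmod (f z) \<le> uniform_norm u" for f :: "'a \<Rightarrow> complex"
      using that by (intro Lim_tensor_filter[OF F A]) auto
    have u_int: "interchange (carrier G) (carrier G) (\<lambda>s t. u (s \<otimes> t))"
      using wap_imp(2)[OF u] by (simp add: double_limit_property_def)
    have "Lim A (\<lambda>a. Lim B (\<lambda>b. v (a \<otimes> b))) = Lim A (\<lambda>a. Lim F (\<lambda>s. Lim B (\<lambda>b. u (s \<otimes> a \<otimes> b))))"
    proof (rule Lim_cong_on[OF A])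
      fix a assume a: "a \<in> carrier G"
      have "Lim B (\<lambda>b. v (a \<otimes> b)) = Lim B (\<lambda>b. Lim F (\<lambda>s. u (s \<otimes> a \<otimes> b)))"
      proof (rule Lim_cong_on[OF B])
        fix b assume b: "b \<in> carrier G"
        have "Lim F (\<lambda>s. u (s \<otimes> (a \<otimes> b))) = Lim F (\<lambda>s. u (s \<otimes> a \<otimes> b))"
          by (rule Lim_cong_on[OF F]) (simp add: m_assoc a b)
        then show "v (a \<otimes> b) = Lim F (\<lambda>s. u (s \<otimes> a \<otimes> b))" using a b by (simp add: v)
      qed
      also have "\<dots> = Lim F (\<lambda>s. Lim B (\<lambda>b. u (s \<otimes> a \<otimes> b)))"
        using interchangeD[OF interchange_reindex[OF u_int, of "carrier G" "\<lambda>s. s \<otimes> a" "carrier G" "\<lambda>b. b"] F B] a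
        by simp
      finally show "Lim B (\<lambda>b. v (a \<otimes> b)) = Lim F (\<lambda>s. Lim B (\<lambda>b. u (s \<otimes> a \<otimes> b)))" .
    qed
    also have "\<dots> = Lim ?C (\<lambda>x. Lim B (\<lambda>b. u (x \<otimes> b)))"
      by (rule Lim_C[symmetric]) (rule Lim_norm_le[OF B wap_imp(4)[OF u]])
    also have "\<dots> = Lim B (\<lambda>b. Lim ?C (\<lambda>x. u (x \<otimes> b)))"
      by (rule interchangeD[OF u_int C B])
    also have "\<dots> = Lim B (\<lambda>b. Lim A (\<lambda>a. v (a \<otimes> b)))"
    proof (rule Lim_cong_on[OF B])
      fix b assume b: "b \<in> carrier G"
      have "Lim ?C (\<lambda>x. u (x \<otimes> b)) = Lim A (\<lambda>a. Lim F (\<lambda>s. u (s \<otimes> a \<otimes> b)))"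
        by (rule Lim_C) (rule wap_imp(4)[OF u])
      also have "\<dots> = Lim A (\<lambda>a. v (a \<otimes> b))"
      proof (rule Lim_cong_on[OF A])
        fix a assume a: "a \<in> carrier G"
        have "Lim F (\<lambda>s. u (s \<otimes> (a \<otimes> b))) = Lim F (\<lambda>s. u (s \<otimes> a \<otimes> b))"
          by (rule Lim_cong_on[OF F]) (simp add: m_assoc a b)
        then show "Lim F (\<lambda>s. u (s \<otimes> a \<otimes> b)) = v (a \<otimes> b)" using a b by (simp add: v)
      qed
      finally show "Lim ?C (\<lambda>x. u (x \<otimes> b)) = Lim A (\<lambda>a. v (a \<otimes> b))" .
    qed
    finally show "Lim A (\<lambda>a. Lim B (\<lambda>b. v (a \<otimes> b))) = Lim B (\<lambda>b. Lim A (\<lambda>a. v (a \<otimes> b)))" .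
  qed
  ultimately show ?thesis by (simp add: v_def[symmetric] wap_iff_double_limit_property)
qed

lemma mult_K_apply: "u \<in> W \<Longrightarrow> (p \<otimes>\<^bsub>K\<^esub> q) u = q (wap_translate G \<tau> u p)"
  by (simp add: wap_compactification_def)

lemma mult_K_ultrafilter:
  assumes F: "ultrafilter_on (carrier G) F" and B: "ultrafilter_on (carrier G) B"
  shows "ultrafilter_point G \<tau> F \<otimes>\<^bsub>K\<^esub> ultrafilter_point G \<tau> B = ultrafilter_point G \<tau> (tensor_filter (\<otimes>) F B)"
proof
  fix u
  show "(ultrafilter_point G \<tau> F \<otimes>\<^bsub>K\<^esub> ultrafilter_point G \<tau> B) u = ultrafilter_point G \<tau> (tensor_filter (\<otimes>) F B) u"
  proof (cases "u \<in> W")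
    case u: True
    have "Lim B (\<lambda>t. if t \<in> carrier G then Lim F (\<lambda>s. u (s \<otimes> t)) else 0) = Lim B (\<lambda>t. Lim F (\<lambda>s. u (s \<otimes> t)))"
      by (rule Lim_cong_on[OF B]) simp
    also have "\<dots> = Lim (tensor_filter (\<otimes>) F B) u"
      by (rule Lim_tensor_filter[OF F B _ wap_imp(4)[OF u], symmetric, where Z = UNIV]) simp
    finally show ?thesis
      using wap_translate_closed[OF u ultrafilter_point_in_points[OF F]] u
      by (simp add: mult_K_apply ultrafilter_point_def[of G \<tau> B] ultrafilter_point_def[of G \<tau> "tensor_filter (\<otimes>) F B"]
          wap_translate_ultrafilter[OF u F])
  qed (simp add: wap_compactification_def ultrafilter_point_def)
qed

lemma mult_K_closed:
  assumes "p \<in> wap_points G \<tau>" "q \<in> wap_points G \<tau>"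
  shows "p \<otimes>\<^bsub>K\<^esub> q \<in> wap_points G \<tau>"
proof -
  obtain F B where F: "ultrafilter_on (carrier G) F" "p = ultrafilter_point G \<tau> F"
    and B: "ultrafilter_on (carrier G) B" "q = ultrafilter_point G \<tau> B"
    using assms by (metis wap_pointE)
  have "ultrafilter_on (carrier G) (tensor_filter (\<otimes>) F B)"
    by (rule ultrafilter_on_tensor_filter[OF F(1) B(1)]) simp
  with F B show ?thesis by (simp add: mult_K_ultrafilter ultrafilter_point_in_points)
qed

text \<open>Multiplication is continuous in the left factor too: this is the double limit property.\<close>

lemma mult_K_ultrafilter_left:
  assumes F: "ultrafilter_on (carrier G) F" and q: "q \<in> wap_points G \<tau>" and u: "u \<in> W"
  shows "(ultrafilter_point G \<tau> F \<otimes>\<^bsub>K\<^esub> q) u = Lim F (\<lambda>s. (wap_eval G \<tau> s \<otimes>\<^bsub>K\<^esub> q) u)"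
proof -
  obtain B where B: "ultrafilter_on (carrier G) B" "q = ultrafilter_point G \<tau> B" using wap_pointE[OF q] .
  have eq: "(ultrafilter_point G \<tau> A \<otimes>\<^bsub>K\<^esub> q) u = Lim B (\<lambda>t. Lim A (\<lambda>s. u (s \<otimes> t)))"
    if A: "ultrafilter_on (carrier G) A" for A
    using u unfolding B(2) mult_K_ultrafilter[OF A B(1)]
    by (simp add: ultrafilter_point_def Lim_tensor_filter[OF A B(1) _ wap_imp(4)[OF u], where Z = UNIV])
  have "(ultrafilter_point G \<tau> F \<otimes>\<^bsub>K\<^esub> q) u = Lim F (\<lambda>s. Lim B (\<lambda>t. u (s \<otimes> t)))"
    using eq[OF F] interchangeD[of "carrier G" "carrier G" "\<lambda>s t. u (s \<otimes> t)", OF _ F B(1)] wap_imp(2)[OF u]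
    by (simp add: double_limit_property_def)
  also have "\<dots> = Lim F (\<lambda>s. (wap_eval G \<tau> s \<otimes>\<^bsub>K\<^esub> q) u)"
    by (rule Lim_cong_on[OF F])
      (simp add: wap_eval_eq eq ultrafilter_on_principal Lim_principal)
  finally show ?thesis .
qed

lemma wap_translate_at_one:
  assumes "u \<in> W" "p \<in> wap_points G \<tau>"
  shows "wap_translate G \<tau> u p \<one> = p u"
proof -
  have "translate_l G \<one> u = u" using wap_imp(5)[OF assms(1)] by (auto simp: translate_l_def)
  then show ?thesis using assms by (simp add: wap_translate_eq)
qed

lemma wap_translate_translate_l:
  assumes u: "u \<in> W" and p: "p \<in> wap_points G \<tau>" and t: "t \<in> carrier G"
  shows "wap_translate G \<tau> (translate_l G t u) p = translate_l G t (wap_translate G \<tau> u p)"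
proof
  fix x
  have "translate_l G x (translate_l G t u) = translate_l G (x \<otimes> t) u" if "x \<in> carrier G"
    using that t by (auto simp: translate_l_def m_assoc)
  then show "wap_translate G \<tau> (translate_l G t u) p x = translate_l G t (wap_translate G \<tau> u p) x"
    using t by (cases "x \<in> carrier G")
      (simp_all add: wap_translate_eq[OF wap_translate_l_closed[OF u t] p] wap_translate_outside
        wap_translate_eq[OF u p] translate_l_def[of G t "wap_translate G \<tau> u p"])
qed

lemma wap_translate_mult_K:
  assumes u: "u \<in> W" and p: "p \<in> wap_points G \<tau>" and q: "q \<in> wap_points G \<tau>"
  shows "wap_translate G \<tau> u (p \<otimes>\<^bsub>K\<^esub> q) = wap_translate G \<tau> (wap_translate G \<tau> u p) q"
proof
  fix t
  show "wap_translate G \<tau> u (p \<otimes>\<^bsub>K\<^esub> q) t = wap_translate G \<tau> (wap_translate G \<tau> u p) q t"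
    by (cases "t \<in> carrier G")
      (simp_all add: wap_translate_eq[OF u mult_K_closed[OF p q]] wap_translate_outside
        wap_translate_eq[OF wap_translate_closed[OF u p] q] mult_K_apply wap_translate_l_closed[OF u]
        wap_translate_translate_l[OF u p])
qed

lemma wap_translate_eval:
  assumes "u \<in> W" "s \<in> carrier G"
  shows "wap_translate G \<tau> u (wap_eval G \<tau> s) = translate_r G u s"
  unfolding wap_eval_eq[OF assms(2)] wap_translate_ultrafilter[OF assms(1) ultrafilter_on_principal[OF assms(2)]]
  by (auto simp: fun_eq_iff translate_r_def Lim_principal)

lemma mult_K_eval:
  assumes "u \<in> W" "s \<in> carrier G" "p \<in> wap_points G \<tau>"
  shows "(p \<otimes>\<^bsub>K\<^esub> wap_eval G \<tau> s) u = wap_translate G \<tau> u p s"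
    "(wap_eval G \<tau> s \<otimes>\<^bsub>K\<^esub> p) u = p (translate_r G u s)"
  unfolding mult_K_apply[OF assms(1)] wap_translate_eval[OF assms(1,2)]
  using wap_translate_closed[OF assms(1,3)] by (simp_all add: wap_eval_def)

lemma wap_point_eqI:
  assumes "p \<in> wap_points G \<tau>" "q \<in> wap_points G \<tau>" "\<And>u. u \<in> W \<Longrightarrow> p u = q u"
  shows "p = q"
  using assms wap_points_subset_dual by (intro extensionalityI[of p W q]) (auto simp: dual_def)

lemma wap_translate_fun:
  assumes p: "p \<in> wap_points G \<tau>" and u: "u \<in> W" and v: "v \<in> W"
  shows "wap_translate G \<tau> (\<lambda>t. u t + v t) p = (\<lambda>t. wap_translate G \<tau> u p t + wap_translate G \<tau> v p t)"
    "wap_translate G \<tau> (\<lambda>t. u t * v t) p = (\<lambda>t. wap_translate G \<tau> u p t * wap_translate G \<tau> v p t)"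
    "wap_translate G \<tau> (\<lambda>t. c * u t) p = (\<lambda>t. c * wap_translate G \<tau> u p t)"
    "wap_translate G \<tau> (\<lambda>t. u t - v t) p = (\<lambda>t. wap_translate G \<tau> u p t - wap_translate G \<tau> v p t)"
proof -
  obtain F where F: "ultrafilter_on (carrier G) F" and p_eq: "p = ultrafilter_point G \<tau> F"
    using wap_pointE[OF p] .
  note lims = wap_tendsto[OF u F] wap_tendsto[OF v F]
  show "wap_translate G \<tau> (\<lambda>t. u t + v t) p = (\<lambda>t. wap_translate G \<tau> u p t + wap_translate G \<tau> v p t)"
    by (auto simp: p_eq wap_translate_ultrafilter[OF _ F] u v wap_add intro!: ultrafilter_Lim_eqI[OF F] tendsto_intros lims)
  show "wap_translate G \<tau> (\<lambda>t. u t * v t) p = (\<lambda>t. wap_translate G \<tau> u p t * wap_translate G \<tau> v p t)"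
    by (auto simp: p_eq wap_translate_ultrafilter[OF _ F] u v wap_mult intro!: ultrafilter_Lim_eqI[OF F] tendsto_intros lims)
  show "wap_translate G \<tau> (\<lambda>t. c * u t) p = (\<lambda>t. c * wap_translate G \<tau> u p t)"
    by (auto simp: p_eq wap_translate_ultrafilter[OF _ F] u v wap_scale intro!: ultrafilter_Lim_eqI[OF F] tendsto_intros lims)
  show "wap_translate G \<tau> (\<lambda>t. u t - v t) p = (\<lambda>t. wap_translate G \<tau> u p t - wap_translate G \<tau> v p t)"
    by (auto simp: p_eq wap_translate_ultrafilter[OF _ F] u v wap_diff intro!: ultrafilter_Lim_eqI[OF F] tendsto_intros lims)
qed

lemma norm_wap_translate_le:
  assumes "p \<in> wap_points G \<tau>" "u \<in> W" "\<And>t. cmod (u t) \<le> B"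
  shows "cmod (wap_translate G \<tau> u p t) \<le> B"
proof -
  obtain F where F: "ultrafilter_on (carrier G) F" and p_eq: "p = ultrafilter_point G \<tau> F"
    using wap_pointE[OF assms(1)] .
  have "cmod (Lim F (\<lambda>s. u (s \<otimes> t))) \<le> B" by (rule Lim_norm_le[OF F assms(3)])
  then show ?thesis
    using order_trans[OF norm_ge_zero assms(3)] by (simp add: p_eq wap_translate_ultrafilter[OF assms(2) F])
qed

end

section \<open>Group topologies of central idempotents\<close>

context topgroup
begin

lemma central_idempotentsD:
  assumes "e \<in> central_idempotents G \<tau>"
  shows "e \<in> wap_points G \<tau>" "e \<otimes>\<^bsub>K\<^esub> e = e"
    "s \<in> wap_points G \<tau> \<Longrightarrow> e \<otimes>\<^bsub>K\<^esub> s = s \<otimes>\<^bsub>K\<^esub> e"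
  using assms by (auto simp: central_idempotents_def Let_def)

lemma topspace_T_map [simp]: "topspace (T_map G \<tau> e) = carrier G"
  by (simp add: T_map_def)

text \<open>The value of \<open>\<eta>\<^sub>e(s) = e \<epsilon>(s)\<close> at \<open>u\<close> is \<open>(u \<cdot> e)(s)\<close>, so \<open>T(e)\<close> is the initial topology of the
  functions \<open>u \<cdot> e\<close>.\<close>

lemma limitin_T_map:
  assumes e: "e \<in> wap_points G \<tau>"
  shows "limitin (T_map G \<tau> e) g l F \<longleftrightarrow>
    l \<in> carrier G \<and> eventually (\<lambda>x. g x \<in> carrier G) F \<and>
    (\<forall>u\<in>W. ((\<lambda>x. wap_translate G \<tau> u e (g x)) \<longlongrightarrow> wap_translate G \<tau> u e l) F)"
    (is "?L \<longleftrightarrow> ?R")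
proof -
  let ?\<eta> = "\<lambda>s. e \<otimes>\<^bsub>K\<^esub> wap_eval G \<tau> s"
  have \<eta>_in: "?\<eta> s \<in> wap_points G \<tau>" if "s \<in> carrier G" for s
    using that by (intro mult_K_closed e wap_eval_in_points)
  have eq: "((\<lambda>x. ?\<eta> (g x) u) \<longlongrightarrow> ?\<eta> l u) F \<longleftrightarrow>
      ((\<lambda>x. wap_translate G \<tau> u e (g x)) \<longlongrightarrow> wap_translate G \<tau> u e l) F"
    if "u \<in> W" "l \<in> carrier G" and ev: "eventually (\<lambda>x. g x \<in> carrier G) F" for u
  proof -
    have "eventually (\<lambda>x. ?\<eta> (g x) u = wap_translate G \<tau> u e (g x)) F"
      using ev by eventually_elim (rule mult_K_eval(1)[OF that(1) _ e])
    then show ?thesis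
      unfolding mult_K_eval(1)[OF that(1,2) e] by (rule tendsto_cong)
  qed
  show ?thesis
  proof
    assume L: ?L
    have l: "l \<in> carrier G" using limitin_topspace[OF L] by simp
    have ev: "eventually (\<lambda>x. g x \<in> carrier G) F"
      using L openin_topspace[of "T_map G \<tau> e"] l unfolding limitin_def by force
    have "limitin (wap_topology G \<tau>) (\<lambda>x. ?\<eta> (g x)) (?\<eta> l) F"
      using L unfolding T_map_def
      by (rule limitin_compose_continuous[rotated, OF _ continuous_map_from_initial_topology])
        (use \<eta>_in in auto)
    with l ev eq show ?R by (simp add: limitin_wap_topology)
  next
    assume R: ?R
    then have ev: "eventually (\<lambda>x. g x \<in> carrier G) F" by blast
    have "eventually (\<lambda>x. ?\<eta> (g x) \<in> wap_points G \<tau>) F"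
      using ev by eventually_elim (rule \<eta>_in)
    with R ev eq \<eta>_in have "limitin (wap_topology G \<tau>) (\<lambda>x. ?\<eta> (g x)) (?\<eta> l) F"
      by (simp add: limitin_wap_topology)
    with R show ?L unfolding T_map_def by (intro limitin_initial_topologyI) auto
  qed
qed

text \<open>Here centrality enters: \<open>(u \<cdot> e) \<cdot> s = u \<cdot> (e s) = u \<cdot> (s e) = (u \<cdot> s) \<cdot> e\<close>.\<close>

lemma translate_r_wap_translate_central:
  assumes e: "e \<in> central_idempotents G \<tau>" and u: "u \<in> W" and s: "s \<in> carrier G"
  shows "translate_r G (wap_translate G \<tau> u e) s = wap_translate G \<tau> (translate_r G u s) e"
proof -
  note e' = central_idempotentsD[OF e]
  have "translate_r G (wap_translate G \<tau> u e) s = wap_translate G \<tau> (wap_translate G \<tau> u e) (wap_eval G \<tau> s)"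
    using wap_translate_eval[OF wap_translate_closed[OF u e'(1)] s] by simp
  also have "\<dots> = wap_translate G \<tau> u (wap_eval G \<tau> s \<otimes>\<^bsub>K\<^esub> e)"
    using wap_translate_mult_K[OF u e'(1) wap_eval_in_points[OF s]] e'(3)[OF wap_eval_in_points[OF s]] by simp
  also have "\<dots> = wap_translate G \<tau> (translate_r G u s) e"
    using wap_translate_mult_K[OF u wap_eval_in_points[OF s] e'(1)] wap_translate_eval[OF u s] by simp
  finally show ?thesis .
qed

lemma wap_translate_idempotent:
  assumes "e \<in> central_idempotents G \<tau>" "u \<in> W"
  shows "wap_translate G \<tau> (wap_translate G \<tau> u e) e = wap_translate G \<tau> u e"
  using wap_translate_mult_K[OF assms(2), of e e] central_idempotentsD(1,2)[OF assms(1)] by simp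

lemma T_map_coarser:
  assumes e: "e \<in> wap_points G \<tau>"
  shows "continuous_map \<tau> (T_map G \<tau> e) (\<lambda>x. x)"
  unfolding continuous_map_iff_limitin_nhdsin limitin_T_map[OF e]
proof (intro ballI conjI)
  fix x u assume x: "x \<in> topspace \<tau>"
  then show "x \<in> carrier G" "eventually (\<lambda>y. y \<in> carrier G) (nhdsin \<tau> x)"
    by (auto intro: eventually_nhdsin_carrier)
  assume "u \<in> W"
  from wap_imp(3)[OF wap_translate_closed[OF this e]] x
  show "(wap_translate G \<tau> u e \<longlongrightarrow> wap_translate G \<tau> u e x) (nhdsin \<tau> x)"
    by (simp add: continuous_map_euclidean_iff)
qed

text \<open>The functions \<open>v = u \<cdot> e\<close> are closed under both translations, so translations are continuous. The
  joint continuity at \<open>(a, b)\<close> follows from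
  \<open>|v(s t) - v(a b)| \<le> |v((s a\<^sup>-\<^sup>1) (a t)) - v(a t)| + |v(a t) - v(a b)|\<close>, where the first term is small
  uniformly in \<open>t\<close>. The same uniform estimate for \<open>s a\<^sup>-\<^sup>1\<close> at the argument \<open>a s\<^sup>-\<^sup>1\<close> gives
  continuity of the inverse.\<close>

lemma topological_group_T_map:
  assumes e: "e \<in> central_idempotents G \<tau>"
  shows "topological_group G (T_map G \<tau> e)"
proof -
  note e_in = central_idempotentsD(1)[OF e]
  let ?T = "T_map G \<tau> e"
  note lim = limitin_T_map[OF e_in]
  define v where "v u = wap_translate G \<tau> u e" for u
  have vW: "v u \<in> W" if "u \<in> W" for u using wap_translate_closed[OF that e_in] by (simp add: v_def)
  have v_l: "v u (x \<otimes> a) = v (translate_l G a u) x" if "u \<in> W" "x \<in> carrier G" "a \<in> carrier G" for u x a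
    using that unfolding v_def wap_translate_translate_l[OF that(1) e_in that(3)] by (simp add: translate_l_def)
  have v_r: "v u (a \<otimes> x) = v (translate_r G u a) x" if "u \<in> W" "x \<in> carrier G" "a \<in> carrier G" for u x a
    using that unfolding v_def translate_r_wap_translate_central[OF e that(1,3), symmetric]
    by (simp add: translate_r_def)
  have lim_v: "((\<lambda>z. v u (g z)) \<longlongrightarrow> v u a) F" if "limitin ?T g a F" "u \<in> W" for g a F u
    using that by (simp add: lim v_def)
  have in_G: "a \<in> carrier G" "eventually (\<lambda>z. g z \<in> carrier G) F" if "limitin ?T g a F" for g a F
    using that by (simp_all add: lim)
  have lim_l: "((\<lambda>z. v u (g z \<otimes> b)) \<longlongrightarrow> v u (a \<otimes> b)) F"
    if g: "limitin ?T g a F" and u: "u \<in> W" and b: "b \<in> carrier G" for g a F u b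
  proof -
    have "((\<lambda>z. v (translate_l G b u) (g z)) \<longlongrightarrow> v (translate_l G b u) a) F"
      by (rule lim_v[OF g wap_translate_l_closed[OF u b]])
    moreover have "eventually (\<lambda>z. v (translate_l G b u) (g z) = v u (g z \<otimes> b)) F"
      using in_G(2)[OF g] by eventually_elim (simp add: v_l u b)
    ultimately have "((\<lambda>z. v u (g z \<otimes> b)) \<longlongrightarrow> v (translate_l G b u) a) F"
      by (rule Lim_transform_eventually)
    then show ?thesis by (simp add: v_l u b in_G(1)[OF g])
  qed
  have lim_r: "((\<lambda>z. v u (b \<otimes> g z)) \<longlongrightarrow> v u (b \<otimes> a)) F"
    if g: "limitin ?T g a F" and u: "u \<in> W" and b: "b \<in> carrier G" for g a F u b
  proof -
    have "((\<lambda>z. v (translate_r G u b) (g z)) \<longlongrightarrow> v (translate_r G u b) a) F"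
      by (rule lim_v[OF g wap_translate_r_closed[OF u b]])
    moreover have "eventually (\<lambda>z. v (translate_r G u b) (g z) = v u (b \<otimes> g z)) F"
      using in_G(2)[OF g] by eventually_elim (simp add: v_r u b)
    ultimately have "((\<lambda>z. v u (b \<otimes> g z)) \<longlongrightarrow> v (translate_r G u b) a) F"
      by (rule Lim_transform_eventually)
    then show ?thesis by (simp add: v_r u b in_G(1)[OF g])
  qed
  \<comment> \<open>\<open>uniform_left_translation\<close> for the filter of the elements \<open>g z a\<^sup>-\<^sup>1\<close>, which tend to \<open>1\<close>\<close>
  have unif: "eventually (\<lambda>z. \<forall>t\<in>carrier G. cmod (v u (g z \<otimes> inv a \<otimes> t) - v u t) < d) F"
    if g: "limitin ?T g a F" and u: "u \<in> W" and d: "d > 0" for g a F u and d :: real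
  proof -
    have a: "a \<in> carrier G" using in_G(1)[OF g] .
    have "eventually (\<lambda>s. \<forall>t\<in>carrier G. cmod (v u (s \<otimes> t) - v u t) < d) (filtermap (\<lambda>z. g z \<otimes> inv a) F)"
    proof (rule uniform_left_translation[OF wap_imp(2)[OF vW[OF u]] wap_imp(4)[OF vW[OF u]] _ _ d])
      show "eventually (\<lambda>s. s \<in> carrier G) (filtermap (\<lambda>z. g z \<otimes> inv a) F)"
        unfolding eventually_filtermap using in_G(2)[OF g] by eventually_elim (simp add: a)
      fix t assume t: "t \<in> carrier G"
      have "((\<lambda>z. v u (g z \<otimes> (inv a \<otimes> t))) \<longlongrightarrow> v u (a \<otimes> (inv a \<otimes> t))) F"
        using a t by (intro lim_l[OF g u]) simp
      moreover have "eventually (\<lambda>z. v u (g z \<otimes> (inv a \<otimes> t)) = v u (g z \<otimes> inv a \<otimes> t)) F"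
        using in_G(2)[OF g] by eventually_elim (simp add: a t m_assoc)
      ultimately have "((\<lambda>z. v u (g z \<otimes> inv a \<otimes> t)) \<longlongrightarrow> v u (a \<otimes> (inv a \<otimes> t))) F"
        by (rule Lim_transform_eventually)
      moreover have "a \<otimes> (inv a \<otimes> t) = t" using a t by (simp add: m_assoc[symmetric])
      ultimately show "((\<lambda>s. v u (s \<otimes> t)) \<longlongrightarrow> v u t) (filtermap (\<lambda>z. g z \<otimes> inv a) F)"
        by (simp add: filterlim_filtermap)
    qed
    then show ?thesis by (simp add: eventually_filtermap)
  qed
  have mult: "limitin ?T (\<lambda>z. g z \<otimes> h z) (a \<otimes> b) F" if g: "limitin ?T g a F" and h: "limitin ?T h b F" for g h a b F
    unfolding lim
  proof (intro conjI ballI)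
    note a = in_G(1)[OF g] and b = in_G(1)[OF h]
    show "a \<otimes> b \<in> carrier G" using a b by simp
    show "eventually (\<lambda>z. g z \<otimes> h z \<in> carrier G) F"
      using in_G(2)[OF g] in_G(2)[OF h] by eventually_elim simp
    fix u assume u: "u \<in> W"
    have "((\<lambda>z. v u (g z \<otimes> h z)) \<longlongrightarrow> v u (a \<otimes> b)) F"
    proof (rule tendstoI)
      fix d :: real assume d: "d > 0"
      have "eventually (\<lambda>z. dist (v u (a \<otimes> h z)) (v u (a \<otimes> b)) < d/2) F"
        using tendstoD[OF lim_r[OF h u a], of "d/2"] d by simp
      moreover have "eventually (\<lambda>z. \<forall>t\<in>carrier G. cmod (v u (g z \<otimes> inv a \<otimes> t) - v u t) < d/2) F"
        using unif[OF g u, of "d/2"] d by simp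
      ultimately show "eventually (\<lambda>z. dist (v u (g z \<otimes> h z)) (v u (a \<otimes> b)) < d) F"
        using in_G(2)[OF g] in_G(2)[OF h]
      proof eventually_elim
        case (elim z)
        have "g z \<otimes> inv a \<otimes> (a \<otimes> h z) = g z \<otimes> (inv a \<otimes> a) \<otimes> h z"
          using elim a by (simp only: m_assoc m_closed inv_closed)
        also have "\<dots> = g z \<otimes> h z" using elim a by simp
        finally have "dist (v u (g z \<otimes> h z)) (v u (a \<otimes> h z)) < d/2"
          using bspec[OF elim(2), of "a \<otimes> h z"] elim a by (simp add: dist_norm)
        with elim(1) show ?case using dist_triangle_half_r[of "v u (a \<otimes> h z)" "v u (g z \<otimes> h z)" d "v u (a \<otimes> b)"]
          by (simp add: dist_commute)
      qed
    qed
    then show "((\<lambda>z. wap_translate G \<tau> u e (g z \<otimes> h z)) \<longlongrightarrow> wap_translate G \<tau> u e (a \<otimes> b)) F"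
      by (simp add: v_def)
  qed
  have inverse: "limitin ?T (\<lambda>z. inv g z) (inv a) F" if g: "limitin ?T g a F" for g a F
    unfolding lim
  proof (intro conjI ballI)
    note a = in_G(1)[OF g]
    show "inv a \<in> carrier G" using a by simp
    show "eventually (\<lambda>z. inv g z \<in> carrier G) F"
      using in_G(2)[OF g] by eventually_elim simp
    fix u assume u: "u \<in> W"
    have "((\<lambda>z. v u (inv g z)) \<longlongrightarrow> v u (inv a)) F"
    proof (rule tendstoI)
      fix d :: real assume d: "d > 0"
      have ua: "translate_r G u (inv a) \<in> W" using a by (intro wap_translate_r_closed u) simp
      show "eventually (\<lambda>z. dist (v u (inv g z)) (v u (inv a)) < d) F"
        using unif[OF g ua d] in_G(2)[OF g]
      proof eventually_elim
        case (elim z)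
        have "v (translate_r G u (inv a)) \<one> = v u (inv a)"
          using v_r[OF u, of \<one> "inv a"] a by simp
        moreover have "v (translate_r G u (inv a)) (a \<otimes> inv g z) = v u (inv g z)"
        proof -
          have "inv a \<otimes> (a \<otimes> inv g z) = inv g z" using a elim by (simp add: m_assoc[symmetric])
          then show ?thesis using v_r[OF u, of "a \<otimes> inv g z" "inv a"] a elim by simp
        qed
        moreover have "g z \<otimes> inv a \<otimes> (a \<otimes> inv g z) = \<one>"
        proof -
          have "g z \<otimes> inv a \<otimes> (a \<otimes> inv g z) = g z \<otimes> (inv a \<otimes> a) \<otimes> inv g z"
            using elim a by (simp only: m_assoc m_closed inv_closed)
          then show ?thesis using elim a by simp
        qed
        ultimately show ?case
          using bspec[OF elim(1), of "a \<otimes> inv g z"] elim(2) a by (simp add: dist_norm norm_minus_commute)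
      qed
    qed
    then show "((\<lambda>z. wap_translate G \<tau> u e (inv g z)) \<longlongrightarrow> wap_translate G \<tau> u e (inv a)) F"
      by (simp add: v_def)
  qed
  show ?thesis
    by (rule topological_groupI[OF is_group topspace_T_map mult inverse])
qed

text \<open>Both parts rest on the identity \<open>u \<cdot> e = u\<close> for \<open>T(e)\<close>-continuous \<open>u\<close>: if \<open>\<epsilon>(s\<^sub>i)\<close> tends to \<open>e\<close>, then
  \<open>s\<^sub>i\<close> tends to \<open>1\<close> in \<open>T(e)\<close>, so \<open>(u \<cdot> e)(t) = lim u(s\<^sub>i t) = u(t)\<close> by continuity of translations.\<close>

lemma wap_at_T_map:
  assumes e: "e \<in> central_idempotents G \<tau>"
  shows "wap_at G \<tau> (T_map G \<tau> e) = {wap_translate G \<tau> u e | u. u \<in> W}"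
    and "u \<in> wap_at G \<tau> (T_map G \<tau> e) \<Longrightarrow> wap_translate G \<tau> u e = u"
proof -
  note e_in = central_idempotentsD(1)[OF e]
  interpret T: topgroup G "T_map G \<tau> e"
    by (rule topgroup.intro[OF topological_group_T_map[OF e]])
  show fixed: "wap_translate G \<tau> u e = u" if "u \<in> wap_at G \<tau> (T_map G \<tau> e)" for u
  proof
    fix t
    have u: "u \<in> W" and cont: "continuous_map (T_map G \<tau> e) euclidean u" using that by (auto simp: wap_at_def)
    obtain F where F: "ultrafilter_on (carrier G) F" and e_eq: "e = ultrafilter_point G \<tau> F"
      using wap_pointE[OF e_in] .
    \<comment> \<open>\<open>\<eta>\<^sub>e\<close> sends any net converging to \<open>e\<close> to a net converging to \<open>e e = e = \<eta>\<^sub>e(1)\<close>\<close>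
    have "limitin (T_map G \<tau> e) (\<lambda>s. s) \<one> F"
      unfolding limitin_T_map[OF e_in]
    proof (intro conjI ballI)
      show "eventually (\<lambda>s. s \<in> carrier G) F" using ultrafilter_onD(2)[OF F] .
      fix v assume v: "v \<in> W"
      have v': "wap_translate G \<tau> v e \<in> W" using wap_translate_closed[OF v e_in] .
      have "Lim F (wap_translate G \<tau> v e) = e (wap_translate G \<tau> v e)"
        using v' by (simp add: e_eq ultrafilter_point_def)
      also have "\<dots> = (e \<otimes>\<^bsub>K\<^esub> e) v" using v by (simp add: mult_K_apply)
      also have "\<dots> = e v" by (simp add: central_idempotentsD(2)[OF e])
      also have "\<dots> = wap_translate G \<tau> v e \<one>" using wap_translate_at_one[OF v e_in] by simp
      finally show "((\<lambda>s. wap_translate G \<tau> v e s) \<longlongrightarrow> wap_translate G \<tau> v e \<one>) F"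
        using wap_tendsto[OF v' F, of "\<lambda>s. s"] by simp
    qed simp
    then have "limitin (T_map G \<tau> e) (\<lambda>s. s \<otimes> t) t F" if "t \<in> carrier G"
      using T.limitin_mult[OF _ T.limitin_const_group[OF that], of "\<lambda>s. s" \<one> F] that by simp
    then have "((\<lambda>s. u (s \<otimes> t)) \<longlongrightarrow> u t) F" if "t \<in> carrier G"
      using T.tendsto_of_limitin[OF cont] that by blast
    then show "wap_translate G \<tau> u e t = u t"
      using ultrafilter_Lim_eqI[OF F] wap_imp(5)[OF u, of t]
      by (simp add: e_eq wap_translate_ultrafilter[OF u F])
  qed
  have "wap_translate G \<tau> u e \<in> wap_at G \<tau> (T_map G \<tau> e)" if u: "u \<in> W" for u
    unfolding wap_at_def
  proof (intro CollectI conjI wap_translate_closed[OF u e_in])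
    show "continuous_map (T_map G \<tau> e) euclidean (wap_translate G \<tau> u e)"
      unfolding continuous_map_euclidean_iff
    proof
      fix x assume "x \<in> topspace (T_map G \<tau> e)"
      from limitin_nhdsin_id[OF this] u
      show "(wap_translate G \<tau> u e \<longlongrightarrow> wap_translate G \<tau> u e x) (nhdsin (T_map G \<tau> e) x)"
        by (simp add: limitin_T_map[OF e_in])
    qed
  qed
  moreover have "wap_at G \<tau> (T_map G \<tau> e) \<subseteq> W" by (auto simp: wap_at_def)
  ultimately show "wap_at G \<tau> (T_map G \<tau> e) = {wap_translate G \<tau> u e | u. u \<in> W}"
    using fixed by (auto, metis subsetD)
qed

end

section \<open>The two-sided completion\<close>

text \<open>Generated by the thickenings of the sets of \<open>C\<close> by entourages. For a Cauchy filter this is the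
  minimal Cauchy filter that it contains, the greatest one above it in the order on \<open>filter\<close>.\<close>

definition round_filter :: "('a, 'm) monoid_scheme \<Rightarrow> 'a topology \<Rightarrow> 'a filter \<Rightarrow> 'a filter" where
  "round_filter H \<theta> C =
     Abs_filter (\<lambda>P. \<exists>U\<in>unit_nbhds H \<theta>. eventually (\<lambda>x. \<forall>y. (x, y) \<in> two_sided_entourage H U \<longrightarrow> P y) C)"

context topgroup
begin

abbreviation entourage where "entourage \<equiv> two_sided_entourage G"

lemma unit_nbhds_iff: "U \<in> unit_nbhds G \<tau> \<longleftrightarrow> openin \<tau> U \<and> \<one> \<in> U"
  by (simp add: unit_nbhds_def)

lemma entourage_iff: "(x, y) \<in> entourage U \<longleftrightarrow>
    x \<in> carrier G \<and> y \<in> carrier G \<and> inv x \<otimes> y \<in> U \<and> y \<otimes> inv x \<in> U"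
  by (simp add: two_sided_entourage_def)

lemma unit_nbhds_Int: "U \<in> unit_nbhds G \<tau> \<Longrightarrow> V \<in> unit_nbhds G \<tau> \<Longrightarrow> U \<inter> V \<in> unit_nbhds G \<tau>"
  by (auto simp: unit_nbhds_def)

lemma unit_nbhds_carrier: "carrier G \<in> unit_nbhds G \<tau>"
  using openin_topspace[of \<tau>] by (simp add: unit_nbhds_def)

lemma entourage_refl: "U \<in> unit_nbhds G \<tau> \<Longrightarrow> x \<in> carrier G \<Longrightarrow> (x, x) \<in> entourage U"
  by (simp add: entourage_iff unit_nbhds_iff)

lemma eventually_unit_nbhds:
  "eventually P (nhdsin \<tau> \<one>) \<longleftrightarrow> (\<exists>U\<in>unit_nbhds G \<tau>. \<forall>x\<in>U. P x)"
  by (auto simp: eventually_nhdsin unit_nbhds_iff)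

lemma unit_nbhds_product:
  assumes "U \<in> unit_nbhds G \<tau>"
  obtains V where "V \<in> unit_nbhds G \<tau>" "\<And>a b c. a \<in> V \<Longrightarrow> b \<in> V \<Longrightarrow> c \<in> V \<Longrightarrow> a \<otimes> b \<otimes> c \<in> U"
    "\<And>a b c. a \<in> V \<Longrightarrow> b \<in> V \<Longrightarrow> c \<in> V \<Longrightarrow> inv a \<otimes> b \<otimes> c \<in> U"
    "\<And>a b c. a \<in> V \<Longrightarrow> b \<in> V \<Longrightarrow> c \<in> V \<Longrightarrow> a \<otimes> b \<otimes> inv c \<in> U"
proof -
  let ?N = "nhdsin \<tau> \<one>"
  let ?F = "?N \<times>\<^sub>F (?N \<times>\<^sub>F ?N)"
  have id: "limitin \<tau> (\<lambda>x. x) \<one> ?N" by (rule limitin_nhdsin_group) simp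
  have lims: "limitin \<tau> (\<lambda>z. fst z) \<one> ?F" "limitin \<tau> (\<lambda>z. fst (snd z)) \<one> ?F" "limitin \<tau> (\<lambda>z. snd (snd z)) \<one> ?F"
    by (rule limitin_compose_filterlim[OF id], intro filterlim_fst filterlim_snd
        filterlim_compose[OF filterlim_fst filterlim_snd] filterlim_compose[OF filterlim_snd filterlim_snd])+
  have in_U: "eventually (\<lambda>z. f z \<in> U) ?F" if "limitin \<tau> f \<one> ?F" for f
    using that assms by (auto simp: limitin_def unit_nbhds_iff)
  have "limitin \<tau> (\<lambda>z. fst z \<otimes> fst (snd z) \<otimes> snd (snd z)) \<one> ?F"
    "limitin \<tau> (\<lambda>z. inv (fst z) \<otimes> fst (snd z) \<otimes> snd (snd z)) \<one> ?F"
    "limitin \<tau> (\<lambda>z. fst z \<otimes> fst (snd z) \<otimes> inv (snd (snd z))) \<one> ?F"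
    using limitin_mult[OF limitin_mult[OF lims(1,2)] lims(3)]
      limitin_mult[OF limitin_mult[OF limitin_inv[OF lims(1)] lims(2)] lims(3)]
      limitin_mult[OF limitin_mult[OF lims(1,2)] limitin_inv[OF lims(3)]]
    by simp_all
  from this[THEN in_U] have "eventually (\<lambda>z. fst z \<otimes> fst (snd z) \<otimes> snd (snd z) \<in> U \<and>
      inv (fst z) \<otimes> fst (snd z) \<otimes> snd (snd z) \<in> U \<and> fst z \<otimes> fst (snd z) \<otimes> inv (snd (snd z)) \<in> U) ?F"
    by eventually_elim simp
  from eventually_prod_filter[THEN iffD1, OF this]
  obtain P Q where PQ: "eventually P ?N" "eventually Q (?N \<times>\<^sub>F ?N)"
    and all: "\<forall>x y. P x \<longrightarrow> Q y \<longrightarrow> fst (x, y) \<otimes> fst (snd (x, y)) \<otimes> snd (snd (x, y)) \<in> U \<and>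
      inv (fst (x, y)) \<otimes> fst (snd (x, y)) \<otimes> snd (snd (x, y)) \<in> U \<and>
      fst (x, y) \<otimes> fst (snd (x, y)) \<otimes> inv (snd (snd (x, y))) \<in> U"
    by (elim exE conjE) (rule that)
  have PQ3: "a \<otimes> b \<otimes> c \<in> U \<and> inv a \<otimes> b \<otimes> c \<in> U \<and> a \<otimes> b \<otimes> inv c \<in> U"
    if "P a" "Q (b, c)" for a b c
    using all[rule_format, OF that] by simp
  from eventually_prod_filter[THEN iffD1, OF PQ(2)]
  obtain R S where RS: "eventually R ?N" "eventually S ?N" "\<forall>x y. R x \<longrightarrow> S y \<longrightarrow> Q (x, y)"
    by (elim exE conjE) (rule that)
  have "eventually (\<lambda>x. P x \<and> R x \<and> S x) ?N"
    using PQ(1) RS(1,2) by eventually_elim simp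
  then obtain V where "V \<in> unit_nbhds G \<tau>" "\<And>x. x \<in> V \<Longrightarrow> P x \<and> R x \<and> S x"
    unfolding eventually_unit_nbhds by blast
  with PQ3 RS(3) show ?thesis by (intro that[of V]) simp_all
qed

lemma unit_nbhds_conjugate:
  assumes "U \<in> unit_nbhds G \<tau>" "a \<in> carrier G"
  obtains V where "V \<in> unit_nbhds G \<tau>" "\<And>z. z \<in> V \<Longrightarrow> inv a \<otimes> z \<otimes> a \<in> U"
    "\<And>z. z \<in> V \<Longrightarrow> a \<otimes> z \<otimes> inv a \<in> U"
proof -
  have id: "limitin \<tau> (\<lambda>x. x) \<one> (nhdsin \<tau> \<one>)" by (rule limitin_nhdsin_group) simp
  have "limitin \<tau> (\<lambda>z. inv a \<otimes> z \<otimes> a) (inv a \<otimes> \<one> \<otimes> a) (nhdsin \<tau> \<one>)"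
    "limitin \<tau> (\<lambda>z. a \<otimes> z \<otimes> inv a) (a \<otimes> \<one> \<otimes> inv a) (nhdsin \<tau> \<one>)"
    using assms(2) by (intro limitin_mult limitin_const_group id; simp)+
  then have "eventually (\<lambda>z. inv a \<otimes> z \<otimes> a \<in> U) (nhdsin \<tau> \<one>)" "eventually (\<lambda>z. a \<otimes> z \<otimes> inv a \<in> U) (nhdsin \<tau> \<one>)"
    using assms by (auto simp: limitin_def unit_nbhds_iff)
  then have "eventually (\<lambda>z. inv a \<otimes> z \<otimes> a \<in> U \<and> a \<otimes> z \<otimes> inv a \<in> U) (nhdsin \<tau> \<one>)"
    by eventually_elim simp
  then show ?thesis unfolding eventually_unit_nbhds using that by blast
qed

lemma entourage_chain:
  assumes "U \<in> unit_nbhds G \<tau>"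
  obtains V where "V \<in> unit_nbhds G \<tau>"
    "\<And>x x' y y'. (x, y) \<in> entourage V \<Longrightarrow> (x, x') \<in> entourage V \<Longrightarrow> (x', y') \<in> entourage V \<Longrightarrow>
      (y, y') \<in> entourage U"
proof -
  obtain V where V: "V \<in> unit_nbhds G \<tau>"
    "\<And>a b c. a \<in> V \<Longrightarrow> b \<in> V \<Longrightarrow> c \<in> V \<Longrightarrow> inv a \<otimes> b \<otimes> c \<in> U"
    "\<And>a b c. a \<in> V \<Longrightarrow> b \<in> V \<Longrightarrow> c \<in> V \<Longrightarrow> a \<otimes> b \<otimes> inv c \<in> U"
    using unit_nbhds_product[OF assms] by metis
  have "(y, y') \<in> entourage U"
    if h: "(x, y) \<in> entourage V" "(x, x') \<in> entourage V" "(x', y') \<in> entourage V" for x x' y y'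
  proof -
    have car: "x \<in> carrier G" "y \<in> carrier G" "x' \<in> carrier G" "y' \<in> carrier G"
      using h by (auto simp: entourage_iff)
    have "inv (inv x \<otimes> y) \<otimes> (inv x \<otimes> x') \<otimes> (inv x' \<otimes> y') \<in> U"
      using h by (intro V(2)) (auto simp: entourage_iff)
    moreover have "inv (inv x \<otimes> y) \<otimes> (inv x \<otimes> x') \<otimes> (inv x' \<otimes> y') = inv y \<otimes> y'"
    proof -
      have "inv (inv x \<otimes> y) \<otimes> (inv x \<otimes> x') \<otimes> (inv x' \<otimes> y')
          = inv y \<otimes> (x \<otimes> inv x) \<otimes> (x' \<otimes> inv x') \<otimes> y'"
        using car by (simp only: inv_mult_group inv_inv m_assoc m_closed inv_closed)
      then show ?thesis using car by simp
    qed
    moreover have "(y' \<otimes> inv x') \<otimes> (x' \<otimes> inv x) \<otimes> inv (y \<otimes> inv x) \<in> U"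
      using h by (intro V(3)) (auto simp: entourage_iff)
    moreover have "(y' \<otimes> inv x') \<otimes> (x' \<otimes> inv x) \<otimes> inv (y \<otimes> inv x) = y' \<otimes> inv y"
    proof -
      have "(y' \<otimes> inv x') \<otimes> (x' \<otimes> inv x) \<otimes> inv (y \<otimes> inv x)
          = y' \<otimes> (inv x' \<otimes> x') \<otimes> (inv x \<otimes> x) \<otimes> inv y"
        using car by (simp only: inv_mult_group inv_inv m_assoc m_closed inv_closed)
      then show ?thesis using car by simp
    qed
    ultimately show ?thesis using car by (simp add: entourage_iff)
  qed
  with V(1) that show ?thesis by blast
qed

abbreviation cauchy where "cauchy \<equiv> two_sided_cauchy G \<tau>"
abbreviation points where "points \<equiv> completion_points G \<tau>"
abbreviation rounding where "rounding \<equiv> round_filter G \<tau>"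

lemma eventually_round:
  "eventually P (rounding C) \<longleftrightarrow>
    (\<exists>U\<in>unit_nbhds G \<tau>. eventually (\<lambda>x. \<forall>y. (x, y) \<in> entourage U \<longrightarrow> P y) C)"
  unfolding round_filter_def
proof (rule eventually_Abs_filter, rule is_filter.intro)
  show "\<exists>U\<in>unit_nbhds G \<tau>. \<forall>\<^sub>F x in C. \<forall>y. (x, y) \<in> entourage U \<longrightarrow> True"
    using unit_nbhds_carrier by auto
  fix P Q
  assume "\<exists>U\<in>unit_nbhds G \<tau>. \<forall>\<^sub>F x in C. \<forall>y. (x, y) \<in> entourage U \<longrightarrow> P y"
  then obtain U where U: "U \<in> unit_nbhds G \<tau>" "\<forall>\<^sub>F x in C. \<forall>y. (x, y) \<in> entourage U \<longrightarrow> P y" by blast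
  {
    assume "\<exists>U\<in>unit_nbhds G \<tau>. \<forall>\<^sub>F x in C. \<forall>y. (x, y) \<in> entourage U \<longrightarrow> Q y"
    then obtain V where V: "V \<in> unit_nbhds G \<tau>" "\<forall>\<^sub>F x in C. \<forall>y. (x, y) \<in> entourage V \<longrightarrow> Q y" by blast
    have "\<forall>\<^sub>F x in C. \<forall>y. (x, y) \<in> entourage (U \<inter> V) \<longrightarrow> P y \<and> Q y"
      using U(2) V(2) by eventually_elim (auto simp: entourage_iff)
    then show "\<exists>U\<in>unit_nbhds G \<tau>. \<forall>\<^sub>F x in C. \<forall>y. (x, y) \<in> entourage U \<longrightarrow> P y \<and> Q y"
      using unit_nbhds_Int[OF U(1) V(1)] by blast
  }
  assume "\<forall>x. P x \<longrightarrow> Q x"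
  with U(2) have "\<forall>\<^sub>F x in C. \<forall>y. (x, y) \<in> entourage U \<longrightarrow> Q y" by (auto elim: eventually_mono)
  with U(1) show "\<exists>U\<in>unit_nbhds G \<tau>. \<forall>\<^sub>F x in C. \<forall>y. (x, y) \<in> entourage U \<longrightarrow> Q y" by blast
qed

lemma cauchyD:
  assumes "cauchy C"
  shows "C \<noteq> bot" "eventually (\<lambda>x. x \<in> carrier G) C"
    "U \<in> unit_nbhds G \<tau> \<Longrightarrow> \<exists>A. eventually (\<lambda>x. x \<in> A) C \<and> (\<forall>x\<in>A. \<forall>y\<in>A. (x, y) \<in> entourage U)"
  using assms unfolding two_sided_cauchy_def le_principal by blast+

lemma cauchyI:
  assumes "C \<noteq> bot" "eventually (\<lambda>x. x \<in> carrier G) C"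
    "\<And>U. U \<in> unit_nbhds G \<tau> \<Longrightarrow> \<exists>A. eventually (\<lambda>x. x \<in> A) C \<and> (\<forall>x\<in>A. \<forall>y\<in>A. (x, y) \<in> entourage U)"
  shows "cauchy C"
  unfolding two_sided_cauchy_def le_principal
proof (intro conjI ballI assms(1,2))
  fix U assume "U \<in> unit_nbhds G \<tau>"
  from assms(3)[OF this] obtain A where "eventually (\<lambda>x. x \<in> A) C" "\<forall>x\<in>A. \<forall>y\<in>A. (x, y) \<in> entourage U"
    by blast
  then show "\<exists>A. eventually (\<lambda>x. x \<in> A) C \<and> A \<times> A \<subseteq> entourage U" by (intro exI[of _ A]) auto
qed

lemma cauchy_mono:
  assumes "cauchy C" "D \<le> C" "D \<noteq> bot" shows "cauchy D"
proof (rule cauchyI[OF assms(3)])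
  show "eventually (\<lambda>x. x \<in> carrier G) D" using cauchyD(2)[OF assms(1)] by (rule filter_leD[OF assms(2)])
  fix U assume "U \<in> unit_nbhds G \<tau>"
  from cauchyD(3)[OF assms(1) this] obtain A where "eventually (\<lambda>x. x \<in> A) C" "\<forall>x\<in>A. \<forall>y\<in>A. (x, y) \<in> entourage U"
    by blast
  then show "\<exists>A. eventually (\<lambda>x. x \<in> A) D \<and> (\<forall>x\<in>A. \<forall>y\<in>A. (x, y) \<in> entourage U)"
    using filter_leD[OF assms(2)] by blast
qed

lemma le_round: assumes "cauchy C" shows "C \<le> rounding C"
proof (rule filter_leI)
  fix P assume "eventually P (rounding C)"
  then obtain U where U: "U \<in> unit_nbhds G \<tau>" "\<forall>\<^sub>F x in C. \<forall>y. (x, y) \<in> entourage U \<longrightarrow> P y"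
    unfolding eventually_round by blast
  from U(2) cauchyD(2)[OF assms] show "eventually P C"
    by eventually_elim (use entourage_refl[OF U(1)] in blast)
qed

lemma cauchy_round: assumes C: "cauchy C" shows "cauchy (rounding C)"
proof (rule cauchyI)
  show "rounding C \<noteq> bot" using le_round[OF C] cauchyD(1)[OF C] by (metis bot.extremum_uniqueI)
  show "eventually (\<lambda>x. x \<in> carrier G) (rounding C)"
    unfolding eventually_round using unit_nbhds_carrier by (auto simp: entourage_iff)
  fix U assume "U \<in> unit_nbhds G \<tau>"
  then obtain V where V: "V \<in> unit_nbhds G \<tau>"
    "\<And>x x' y y'. (x, y) \<in> entourage V \<Longrightarrow> (x, x') \<in> entourage V \<Longrightarrow> (x', y') \<in> entourage V \<Longrightarrow>
      (y, y') \<in> entourage U"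
    using entourage_chain by blast
  obtain M where M: "eventually (\<lambda>x. x \<in> M) C" "\<forall>x\<in>M. \<forall>y\<in>M. (x, y) \<in> entourage V"
    using cauchyD(3)[OF C V(1)] by blast
  define A where "A = {y. \<exists>x\<in>M. (x, y) \<in> entourage V}"
  have "eventually (\<lambda>x. x \<in> A) (rounding C)"
    unfolding eventually_round using V(1) M(1) by (auto simp: A_def elim!: eventually_mono intro!: bexI[of _ V])
  moreover have "(y, y') \<in> entourage U" if "y \<in> A" "y' \<in> A" for y y'
    using that M(2) V(2) unfolding A_def by blast
  ultimately show "\<exists>A. eventually (\<lambda>x. x \<in> A) (rounding C) \<and> (\<forall>x\<in>A. \<forall>y\<in>A. (x, y) \<in> entourage U)" by blast
qed

text \<open>A small set of \<open>D\<close> meets every set of \<open>C\<close>, and so lies in the thickening of each of them.\<close>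

lemma cauchy_le_round:
  assumes C: "C \<noteq> bot" and D: "cauchy D" "C \<le> D" shows "D \<le> rounding C"
proof (rule filter_leI)
  fix P assume "eventually P (rounding C)"
  then obtain U where U: "U \<in> unit_nbhds G \<tau>" "\<forall>\<^sub>F x in C. \<forall>y. (x, y) \<in> entourage U \<longrightarrow> P y"
    unfolding eventually_round by blast
  obtain M where M: "eventually (\<lambda>x. x \<in> M) D" "\<forall>x\<in>M. \<forall>y\<in>M. (x, y) \<in> entourage U"
    using cauchyD(3)[OF D(1) U(1)] by blast
  have "eventually (\<lambda>x. x \<in> M \<and> (\<forall>y. (x, y) \<in> entourage U \<longrightarrow> P y)) C"
    using filter_leD[OF D(2) M(1)] U(2) by eventually_elim simp
  then obtain x where x: "x \<in> M" "\<forall>y. (x, y) \<in> entourage U \<longrightarrow> P y"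
    using eventually_happens'[OF C] by blast
  from M(1) show "eventually P D" by eventually_elim (use x M(2) in blast)
qed

lemma round_in_points: assumes "cauchy C" shows "rounding C \<in> points"
proof -
  have "D = rounding C" if D: "cauchy D" "rounding C \<le> D" for D
  proof (rule antisym[OF _ D(2)])
    have "C \<le> D" by (rule order_trans[OF le_round[OF assms] D(2)])
    then show "D \<le> rounding C" by (rule cauchy_le_round[OF cauchyD(1)[OF assms] D(1)])
  qed
  with cauchy_round[OF assms] show ?thesis by (simp add: completion_points_def)
qed

lemma pointsD: "F \<in> points \<Longrightarrow> cauchy F"
  by (simp add: completion_points_def)

lemma round_unique:
  assumes F: "F \<in> points" and C: "C \<le> F" "C \<noteq> bot"
  shows "rounding C = F"
proof -
  have "cauchy C" by (rule cauchy_mono[OF pointsD[OF F] C])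
  then have "cauchy (rounding C)" by (rule cauchy_round)
  moreover have "F \<le> rounding C" by (rule cauchy_le_round[OF C(2) pointsD[OF F] C(1)])
  ultimately show ?thesis using F by (auto simp: completion_points_def)
qed

text \<open>Read \<open>filterlim f F \<Phi>\<close> as: \<open>f\<close> converges along \<open>\<Phi>\<close> to the point \<open>F\<close> of the completion. Limits are
  unique, and by \<open>filterlim_Ghat_mult\<close> below they are multiplicative. The group laws of the completion
  follow from these two facts, by taking limits of the laws of the group.\<close>

lemma points_unique:
  assumes "F \<in> points" "F' \<in> points" "filterlim f F \<Phi>" "filterlim f F' \<Phi>" "\<Phi> \<noteq> bot"
  shows "F = F'"
  using round_unique[OF assms(1), of "filtermap f \<Phi>"] round_unique[OF assms(2), of "filtermap f \<Phi>"] assms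
  by (simp add: filterlim_def filtermap_bot_iff)

lemma nhdsin_eq_round:
  assumes x: "x \<in> carrier G"
  shows "nhdsin \<tau> x = rounding (principal {x})"
proof (rule filter_eq_iff[THEN iffD2], intro allI iffI)
  fix P assume "eventually P (nhdsin \<tau> x)"
  then obtain S where S: "openin \<tau> S" "x \<in> S" "\<And>y. y \<in> S \<Longrightarrow> P y" using x by (auto simp: eventually_nhdsin)
  have "limitin \<tau> (\<lambda>z. x \<otimes> z) (x \<otimes> \<one>) (nhdsin \<tau> \<one>)"
    using x by (intro limitin_mult limitin_const_group limitin_nhdsin_group) auto
  then have "eventually (\<lambda>z. x \<otimes> z \<in> S) (nhdsin \<tau> \<one>)" using S x by (simp add: limitin_def)
  then obtain U where U: "U \<in> unit_nbhds G \<tau>" "\<And>z. z \<in> U \<Longrightarrow> x \<otimes> z \<in> S" unfolding eventually_unit_nbhds by blast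
  have "P y" if "(x, y) \<in> entourage U" for y
  proof -
    have "x \<otimes> (inv x \<otimes> y) \<in> S" "y \<in> carrier G" using that by (auto simp: entourage_iff intro: U(2))
    moreover have "x \<otimes> (inv x \<otimes> y) = y" using x \<open>y \<in> carrier G\<close> by (simp add: m_assoc[symmetric])
    ultimately show ?thesis using S(3) by simp
  qed
  with U(1) show "eventually P (rounding (principal {x}))" by (auto simp: eventually_round eventually_principal)
next
  fix P assume "eventually P (rounding (principal {x}))"
  then obtain U where U: "U \<in> unit_nbhds G \<tau>" "\<And>y. (x, y) \<in> entourage U \<Longrightarrow> P y"
    by (auto simp: eventually_round eventually_principal)
  have "limitin \<tau> (\<lambda>y. inv x \<otimes> y) (inv x \<otimes> x) (nhdsin \<tau> x)" "limitin \<tau> (\<lambda>y. y \<otimes> inv x) (x \<otimes> inv x) (nhdsin \<tau> x)"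
    using x by (intro limitin_mult limitin_const_group limitin_nhdsin_group; simp)+
  then have "eventually (\<lambda>y. inv x \<otimes> y \<in> U) (nhdsin \<tau> x)" "eventually (\<lambda>y. y \<otimes> inv x \<in> U) (nhdsin \<tau> x)"
    using U(1) x by (auto simp: limitin_def unit_nbhds_iff)
  with eventually_nhdsin_carrier[OF x] show "eventually P (nhdsin \<tau> x)"
    by eventually_elim (use x in \<open>auto intro: U(2) simp: entourage_iff\<close>)
qed

lemma nhdsin_in_points: assumes "x \<in> carrier G" shows "nhdsin \<tau> x \<in> points"
  unfolding nhdsin_eq_round[OF assms]
proof (intro round_in_points cauchyI)
  show "\<exists>A. eventually (\<lambda>x. x \<in> A) (principal {x}) \<and> (\<forall>x\<in>A. \<forall>y\<in>A. (x, y) \<in> entourage U)"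
    if "U \<in> unit_nbhds G \<tau>" for U
    using entourage_refl[OF that assms] by (intro exI[of _ "{x}"]) (simp add: eventually_principal)
qed (use assms in \<open>auto simp: principal_eq_bot_iff eventually_principal\<close>)

lemma filterlim_const_nhdsin: "x \<in> carrier G \<Longrightarrow> filterlim (\<lambda>_. x) (nhdsin \<tau> x) \<Phi>"
  by (auto simp: filterlim_iff eventually_nhdsin)

definition product_filter :: "'a filter \<Rightarrow> 'a filter \<Rightarrow> 'a filter" where
  "product_filter F F' = filtermap (\<lambda>(x, y). x \<otimes> y) (F \<times>\<^sub>F F')"

lemma eventually_product_filter:
  "eventually P (product_filter F F') \<longleftrightarrow>
    (\<exists>A B. eventually A F \<and> eventually B F' \<and> (\<forall>x y. A x \<longrightarrow> B y \<longrightarrow> P (x \<otimes> y)))"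
  by (simp add: product_filter_def eventually_filtermap eventually_prod_filter)

text \<open>The factors \<open>x\<close>, \<open>x'\<close> and \<open>y\<close>, \<open>y'\<close> are compared by
  \<open>(x y)\<^sup>-\<^sup>1 (x' y') = (y\<^sup>-\<^sup>1 y\<^sub>0) (y\<^sub>0\<^sup>-\<^sup>1 (x\<^sup>-\<^sup>1 x') y\<^sub>0) (y\<^sub>0\<^sup>-\<^sup>1 y')\<close> and its mirror image. So the conjugation is
  by a fixed element \<open>y\<^sub>0\<close>, which has to be chosen before the small sets of \<open>F\<close>.\<close>

lemma cauchy_product_filter:
  assumes F: "cauchy F" and F': "cauchy F'"
  shows "cauchy (product_filter F F')"
proof (rule cauchyI)
  show "product_filter F F' \<noteq> bot"
    using cauchyD(1)[OF F] cauchyD(1)[OF F'] by (simp add: product_filter_def filtermap_bot_iff prod_filter_eq_bot)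
  show "eventually (\<lambda>x. x \<in> carrier G) (product_filter F F')"
    unfolding eventually_product_filter using cauchyD(2)[OF F] cauchyD(2)[OF F'] m_closed by blast
  fix U assume U: "U \<in> unit_nbhds G \<tau>"
  obtain V where V: "V \<in> unit_nbhds G \<tau>" "\<And>a b c. a \<in> V \<Longrightarrow> b \<in> V \<Longrightarrow> c \<in> V \<Longrightarrow> a \<otimes> b \<otimes> c \<in> U"
    using unit_nbhds_product[OF U] by metis
  have small: "\<exists>A. eventually (\<lambda>x. x \<in> A) C \<and> (\<forall>x\<in>A. \<forall>y\<in>A. (x, y) \<in> entourage V) \<and> (\<exists>x. x \<in> A \<and> x \<in> carrier G)"
    if C: "cauchy C" for C
  proof -
    obtain A where A: "eventually (\<lambda>x. x \<in> A) C" "\<forall>x\<in>A. \<forall>y\<in>A. (x, y) \<in> entourage V"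
      using cauchyD(3)[OF C V(1)] by blast
    have "eventually (\<lambda>x. x \<in> A \<and> x \<in> carrier G) C" using A(1) cauchyD(2)[OF C] by eventually_elim simp
    from eventually_happens'[OF cauchyD(1)[OF C] this] A show ?thesis by (intro exI[of _ A]) simp
  qed
  obtain A x0 where A: "eventually (\<lambda>x. x \<in> A) F" "\<And>x y. x \<in> A \<Longrightarrow> y \<in> A \<Longrightarrow> (x, y) \<in> entourage V"
    and x0: "x0 \<in> A" "x0 \<in> carrier G" using small[OF F] by blast
  obtain B y0 where B: "eventually (\<lambda>x. x \<in> B) F'" "\<And>x y. x \<in> B \<Longrightarrow> y \<in> B \<Longrightarrow> (x, y) \<in> entourage V"
    and y0: "y0 \<in> B" "y0 \<in> carrier G" using small[OF F'] by blast
  obtain V1 where V1: "V1 \<in> unit_nbhds G \<tau>" "\<And>z. z \<in> V1 \<Longrightarrow> inv y0 \<otimes> z \<otimes> y0 \<in> V"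
    using unit_nbhds_conjugate[OF V(1) y0(2)] by metis
  obtain V2 where V2: "V2 \<in> unit_nbhds G \<tau>" "\<And>z. z \<in> V2 \<Longrightarrow> x0 \<otimes> z \<otimes> inv x0 \<in> V"
    using unit_nbhds_conjugate[OF V(1) x0(2)] by metis
  obtain A' where A': "eventually (\<lambda>x. x \<in> A') F" "\<forall>x\<in>A'. \<forall>y\<in>A'. (x, y) \<in> entourage V1"
    using cauchyD(3)[OF F V1(1)] by blast
  obtain B' where B': "eventually (\<lambda>x. x \<in> B') F'" "\<forall>x\<in>B'. \<forall>y\<in>B'. (x, y) \<in> entourage V2"
    using cauchyD(3)[OF F' V2(1)] by blast
  define M where "M = {x \<otimes> y | x y. x \<in> A \<inter> A' \<and> y \<in> B \<inter> B'}"
  have "(x \<otimes> y, x' \<otimes> y') \<in> entourage U"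
    if x: "x \<in> A \<inter> A'" "x' \<in> A \<inter> A'" and y: "y \<in> B \<inter> B'" "y' \<in> B \<inter> B'" for x x' y y'
  proof -
    have car: "x \<in> carrier G" "x' \<in> carrier G" "y \<in> carrier G" "y' \<in> carrier G"
      using A(2)[of x x'] B(2)[of y y'] x y by (auto simp: entourage_iff)
    have "(inv y \<otimes> y0) \<otimes> (inv y0 \<otimes> (inv x \<otimes> x') \<otimes> y0) \<otimes> (inv y0 \<otimes> y') \<in> U"
    proof (rule V(2))
      show "inv y \<otimes> y0 \<in> V" "inv y0 \<otimes> y' \<in> V" using B(2)[of y y0] B(2)[of y0 y'] y y0 by (auto simp: entourage_iff)
      show "inv y0 \<otimes> (inv x \<otimes> x') \<otimes> y0 \<in> V" using A'(2) x by (intro V1(2)) (auto simp: entourage_iff)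
    qed
    moreover have "(inv y \<otimes> y0) \<otimes> (inv y0 \<otimes> (inv x \<otimes> x') \<otimes> y0) \<otimes> (inv y0 \<otimes> y') = inv (x \<otimes> y) \<otimes> (x' \<otimes> y')"
    proof -
      have "(inv y \<otimes> y0) \<otimes> (inv y0 \<otimes> (inv x \<otimes> x') \<otimes> y0) \<otimes> (inv y0 \<otimes> y')
          = inv y \<otimes> (y0 \<otimes> inv y0) \<otimes> (inv x \<otimes> x') \<otimes> (y0 \<otimes> inv y0) \<otimes> y'"
        using car y0 by (simp only: m_assoc m_closed inv_closed)
      also have "\<dots> = inv (x \<otimes> y) \<otimes> (x' \<otimes> y')"
        using car y0 by (simp add: inv_mult_group m_assoc)
      finally show ?thesis .
    qed
    moreover have "(x' \<otimes> inv x0) \<otimes> (x0 \<otimes> (y' \<otimes> inv y) \<otimes> inv x0) \<otimes> (x0 \<otimes> inv x) \<in> U"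
    proof (rule V(2))
      show "x' \<otimes> inv x0 \<in> V" "x0 \<otimes> inv x \<in> V" using A(2)[of x0 x'] A(2)[of x x0] x x0 by (auto simp: entourage_iff)
      show "x0 \<otimes> (y' \<otimes> inv y) \<otimes> inv x0 \<in> V" using B'(2) y by (intro V2(2)) (auto simp: entourage_iff)
    qed
    moreover have "(x' \<otimes> inv x0) \<otimes> (x0 \<otimes> (y' \<otimes> inv y) \<otimes> inv x0) \<otimes> (x0 \<otimes> inv x) = (x' \<otimes> y') \<otimes> inv (x \<otimes> y)"
    proof -
      have "(x' \<otimes> inv x0) \<otimes> (x0 \<otimes> (y' \<otimes> inv y) \<otimes> inv x0) \<otimes> (x0 \<otimes> inv x)
          = x' \<otimes> (inv x0 \<otimes> x0) \<otimes> (y' \<otimes> inv y) \<otimes> (inv x0 \<otimes> x0) \<otimes> inv x"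
        using car x0 by (simp only: m_assoc m_closed inv_closed)
      also have "\<dots> = (x' \<otimes> y') \<otimes> inv (x \<otimes> y)"
        using car x0 by (simp add: inv_mult_group m_assoc)
      finally show ?thesis .
    qed
    ultimately show ?thesis using car by (simp add: entourage_iff)
  qed
  then have "\<forall>p\<in>M. \<forall>q\<in>M. (p, q) \<in> entourage U" by (auto simp: M_def)
  moreover have "eventually (\<lambda>p. p \<in> M) (product_filter F F')"
    unfolding eventually_product_filter
    using eventually_conj[OF A(1) A'(1)] eventually_conj[OF B(1) B'(1)]
    by (intro exI[of _ "\<lambda>x. x \<in> A \<and> x \<in> A'"] exI[of _ "\<lambda>x. x \<in> B \<and> x \<in> B'"]) (auto simp: M_def)
  ultimately show "\<exists>A. eventually (\<lambda>x. x \<in> A) (product_filter F F') \<and> (\<forall>x\<in>A. \<forall>y\<in>A. (x, y) \<in> entourage U)"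
    by blast
qed

abbreviation Ghat where "Ghat \<equiv> completion G \<tau>"

lemma Ghat_simps [simp]: "carrier Ghat = points" "\<one>\<^bsub>Ghat\<^esub> = nhdsin \<tau> \<one>"
  by (simp_all add: completion_def)

lemma Ghat_mult:
  assumes "F \<in> points" "F' \<in> points"
  shows "F \<otimes>\<^bsub>Ghat\<^esub> F' = rounding (product_filter F F')"
proof -
  have C: "cauchy (product_filter F F')" using assms by (intro cauchy_product_filter pointsD)
  have "(THE L. L \<in> points \<and> product_filter F F' \<le> L) = rounding (product_filter F F')"
  proof (rule the_equality)
    show "rounding (product_filter F F') \<in> points \<and> product_filter F F' \<le> rounding (product_filter F F')"
      using round_in_points[OF C] le_round[OF C] ..
    show "L = rounding (product_filter F F')" if "L \<in> points \<and> product_filter F F' \<le> L" for L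
      using round_unique[OF conjunct1[OF that] conjunct2[OF that] cauchyD(1)[OF C]] ..
  qed
  then show ?thesis by (simp add: completion_def product_filter_def)
qed

lemma Ghat_mult_closed: "F \<in> points \<Longrightarrow> F' \<in> points \<Longrightarrow> F \<otimes>\<^bsub>Ghat\<^esub> F' \<in> points"
  by (simp add: Ghat_mult round_in_points cauchy_product_filter pointsD)

lemma filterlim_Ghat_mult:
  assumes F: "F \<in> points" "filterlim f F \<Phi>" and F': "F' \<in> points" "filterlim g F' \<Phi>"
  shows "filterlim (\<lambda>z. f z \<otimes> g z) (F \<otimes>\<^bsub>Ghat\<^esub> F') \<Phi>"
proof -
  have "filterlim (\<lambda>z. (f z, g z)) (F \<times>\<^sub>F F') \<Phi>" using F(2) F'(2) by (rule filterlim_Pair)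
  moreover have "filterlim (\<lambda>(x, y). x \<otimes> y) (product_filter F F') (F \<times>\<^sub>F F')"
    by (simp add: filterlim_def product_filter_def)
  ultimately have "filterlim (\<lambda>z. f z \<otimes> g z) (product_filter F F') \<Phi>"
    using filterlim_compose by fastforce
  moreover have "product_filter F F' \<le> F \<otimes>\<^bsub>Ghat\<^esub> F'"
    using F(1) F'(1) by (simp add: Ghat_mult le_round cauchy_product_filter pointsD)
  ultimately show ?thesis by (rule filterlim_mono[OF _ _ order_refl])
qed

lemma filterlim_round_inv: "filterlim (\<lambda>x. inv x) (rounding (filtermap (\<lambda>x. inv x) F)) F"
  and round_inv_in_points: "rounding (filtermap (\<lambda>x. inv x) F) \<in> points" if F: "F \<in> points"
proof -
  have "cauchy (filtermap (\<lambda>x. inv x) F)"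
  proof (rule cauchyI)
    show "filtermap (\<lambda>x. inv x) F \<noteq> bot" using cauchyD(1)[OF pointsD[OF F]] by (simp add: filtermap_bot_iff)
    show "eventually (\<lambda>x. x \<in> carrier G) (filtermap (\<lambda>x. inv x) F)"
      unfolding eventually_filtermap using cauchyD(2)[OF pointsD[OF F]] by eventually_elim simp
    fix U assume "U \<in> unit_nbhds G \<tau>"
    then obtain V where V: "V \<in> unit_nbhds G \<tau>" "\<And>a b c. a \<in> V \<Longrightarrow> b \<in> V \<Longrightarrow> c \<in> V \<Longrightarrow> inv a \<otimes> b \<otimes> c \<in> U"
      using unit_nbhds_product by metis
    have inv_V: "inv a \<in> U" if "a \<in> V" "a \<in> carrier G" for a
      using V(2)[of a \<one> \<one>] that V(1) by (simp add: unit_nbhds_iff)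
    obtain A where A: "eventually (\<lambda>x. x \<in> A) F" "\<forall>x\<in>A. \<forall>y\<in>A. (x, y) \<in> entourage V"
      using cauchyD(3)[OF pointsD[OF F] V(1)] by blast
    have "(inv x, inv y) \<in> entourage U" if "x \<in> A" "y \<in> A" for x y
    proof -
      have xy: "(x, y) \<in> entourage V" using A(2) that by blast
      then have car: "x \<in> carrier G" "y \<in> carrier G" by (auto simp: entourage_iff)
      have "inv (y \<otimes> inv x) \<in> U" "inv (inv x \<otimes> y) \<in> U"
        using xy car by (auto intro!: inv_V simp: entourage_iff)
      then show ?thesis using car by (simp add: entourage_iff inv_mult_group)
    qed
    then show "\<exists>A. eventually (\<lambda>x. x \<in> A) (filtermap (\<lambda>x. inv x) F) \<and> (\<forall>x\<in>A. \<forall>y\<in>A. (x, y) \<in> entourage U)"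
      using A(1) by (intro exI[of _ "(\<lambda>x. inv x) ` A"]) (auto simp: eventually_filtermap elim: eventually_mono)
  qed
  then show "filterlim (\<lambda>x. inv x) (rounding (filtermap (\<lambda>x. inv x) F)) F" "rounding (filtermap (\<lambda>x. inv x) F) \<in> points"
    by (simp_all add: filterlim_def le_round round_in_points)
qed

lemma Ghat_group: "group Ghat"
proof (rule groupI)
  have nb: "F \<noteq> bot" "eventually (\<lambda>x. x \<in> carrier G) F" if "F \<in> points" for F
    using cauchyD(1,2)[OF pointsD[OF that]] .
  show "x \<otimes>\<^bsub>Ghat\<^esub> y \<in> carrier Ghat" if "x \<in> carrier Ghat" "y \<in> carrier Ghat" for x y
    using that by (simp add: Ghat_mult_closed)
  show "\<one>\<^bsub>Ghat\<^esub> \<in> carrier Ghat" by (simp add: nhdsin_in_points)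
  fix x assume "x \<in> carrier Ghat"
  then have x: "x \<in> points" by simp
  have id: "filterlim (\<lambda>a. a) x x" by (rule filterlim_ident)
  show "\<one>\<^bsub>Ghat\<^esub> \<otimes>\<^bsub>Ghat\<^esub> x = x"
  proof (rule points_unique[OF _ x _ _ nb(1)[OF x]])
    show "filterlim (\<lambda>a. \<one> \<otimes> a) (\<one>\<^bsub>Ghat\<^esub> \<otimes>\<^bsub>Ghat\<^esub> x) x"
      by (rule filterlim_Ghat_mult[OF _ _ x id]) (simp_all add: nhdsin_in_points filterlim_const_nhdsin)
    show "filterlim (\<lambda>a. \<one> \<otimes> a) x x"
      using id by (rule filterlim_cong[THEN iffD1, OF refl refl, rotated])
        (use nb(2)[OF x] in \<open>auto elim: eventually_mono\<close>)
  qed (simp add: Ghat_mult_closed nhdsin_in_points x)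
  show "\<exists>y\<in>carrier Ghat. y \<otimes>\<^bsub>Ghat\<^esub> x = \<one>\<^bsub>Ghat\<^esub>"
  proof (intro bexI)
    let ?y = "rounding (filtermap (\<lambda>x. inv x) x)"
    show y: "?y \<in> carrier Ghat" by (simp add: round_inv_in_points x)
    show "?y \<otimes>\<^bsub>Ghat\<^esub> x = \<one>\<^bsub>Ghat\<^esub>"
    proof (rule points_unique[OF _ _ _ _ nb(1)[OF x]])
      show "filterlim (\<lambda>a. inv a \<otimes> a) (?y \<otimes>\<^bsub>Ghat\<^esub> x) x"
        using y by (intro filterlim_Ghat_mult x id filterlim_round_inv) auto
      show "filterlim (\<lambda>a. inv a \<otimes> a) (\<one>\<^bsub>Ghat\<^esub>) x"
        using filterlim_const_nhdsin[OF one_closed, of x]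
        by (simp, elim filterlim_cong[THEN iffD1, OF refl refl, rotated])
          (use nb(2)[OF x] in \<open>auto elim: eventually_mono\<close>)
    qed (use y x in \<open>auto intro: Ghat_mult_closed nhdsin_in_points\<close>)
  qed
  fix y z assume "y \<in> carrier Ghat" "z \<in> carrier Ghat"
  then have yz: "y \<in> points" "z \<in> points" by auto
  let ?\<Phi> = "x \<times>\<^sub>F (y \<times>\<^sub>F z)"
  have l1: "filterlim fst x ?\<Phi>" and l2: "filterlim (\<lambda>p. fst (snd p)) y ?\<Phi>" and l3: "filterlim (\<lambda>p. snd (snd p)) z ?\<Phi>"
    using filterlim_fst filterlim_compose[OF filterlim_fst filterlim_snd]
      filterlim_compose[OF filterlim_snd filterlim_snd] by blast+
  show "x \<otimes>\<^bsub>Ghat\<^esub> y \<otimes>\<^bsub>Ghat\<^esub> z = x \<otimes>\<^bsub>Ghat\<^esub> (y \<otimes>\<^bsub>Ghat\<^esub> z)"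
  proof (rule points_unique[where \<Phi> = ?\<Phi>])
    show "filterlim (\<lambda>p. fst p \<otimes> fst (snd p) \<otimes> snd (snd p)) (x \<otimes>\<^bsub>Ghat\<^esub> y \<otimes>\<^bsub>Ghat\<^esub> z) ?\<Phi>"
      by (intro filterlim_Ghat_mult Ghat_mult_closed x yz l1 l2 l3)
    have "filterlim (\<lambda>p. fst p \<otimes> (fst (snd p) \<otimes> snd (snd p))) (x \<otimes>\<^bsub>Ghat\<^esub> (y \<otimes>\<^bsub>Ghat\<^esub> z)) ?\<Phi>"
      by (intro filterlim_Ghat_mult Ghat_mult_closed x yz l1 l2 l3)
    moreover have "eventually (\<lambda>p. fst p \<otimes> (fst (snd p) \<otimes> snd (snd p)) = fst p \<otimes> fst (snd p) \<otimes> snd (snd p)) ?\<Phi>"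
      using eventually_compose_filterlim[OF nb(2)[OF x] l1] eventually_compose_filterlim[OF nb(2)[OF yz(1)] l2]
        eventually_compose_filterlim[OF nb(2)[OF yz(2)] l3]
      by eventually_elim (simp add: m_assoc)
    ultimately show "filterlim (\<lambda>p. fst p \<otimes> fst (snd p) \<otimes> snd (snd p)) (x \<otimes>\<^bsub>Ghat\<^esub> (y \<otimes>\<^bsub>Ghat\<^esub> z)) ?\<Phi>"
      by (rule filterlim_cong[OF refl refl, THEN iffD1, rotated])
    show "?\<Phi> \<noteq> bot" using nb x yz by (simp add: prod_filter_eq_bot)
  qed (intro Ghat_mult_closed x yz)+
qed

lemma Ghat_inv:
  assumes F: "F \<in> points" shows "inv\<^bsub>Ghat\<^esub> F = rounding (filtermap (\<lambda>x. inv x) F)"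
proof (rule group.inv_equality[OF Ghat_group])
  let ?y = "rounding (filtermap (\<lambda>x. inv x) F)"
  have y: "?y \<in> points" by (rule round_inv_in_points[OF F])
  show "?y \<otimes>\<^bsub>Ghat\<^esub> F = \<one>\<^bsub>Ghat\<^esub>"
  proof (rule points_unique[OF _ _ _ _ cauchyD(1)[OF pointsD[OF F]]])
    show "filterlim (\<lambda>a. inv a \<otimes> a) (?y \<otimes>\<^bsub>Ghat\<^esub> F) F"
      by (intro filterlim_Ghat_mult F y filterlim_ident filterlim_round_inv)
    show "filterlim (\<lambda>a. inv a \<otimes> a) (\<one>\<^bsub>Ghat\<^esub>) F"
      using filterlim_const_nhdsin[OF one_closed, of F]
      by (simp, elim filterlim_cong[THEN iffD1, OF refl refl, rotated])
        (use cauchyD(2)[OF pointsD[OF F]] in \<open>auto elim: eventually_mono\<close>)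
  qed (use y F in \<open>auto intro: Ghat_mult_closed nhdsin_in_points\<close>)
qed (use F round_inv_in_points in auto)

abbreviation Ghat_top where "Ghat_top \<equiv> completion_topology G \<tau>"

text \<open>The sets \<open>{F. eventually P F}\<close> form a base. They are open because the points are round filters:
  if \<open>P\<close> holds eventually along \<open>F\<close>, it does so on a whole thickening, and every filter close to \<open>F\<close>
  contains that thickening.\<close>

lemma openin_Ghat_top:
  "openin Ghat_top S \<longleftrightarrow> S \<subseteq> points \<and>
    (\<forall>F\<in>S. \<exists>P. eventually P F \<and> {F'\<in>points. eventually P F'} \<subseteq> S)"
proof -
  have op: "openin Ghat_top S \<longleftrightarrow> S \<subseteq> points \<and>
      (\<forall>F\<in>S. \<exists>U\<in>unit_nbhds G \<tau>. \<forall>F'. (F, F') \<in> completion_entourage G \<tau> U \<longrightarrow> F' \<in> S)"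
    by (rule openin_completion_topology) simp_all
  have "(\<exists>U\<in>unit_nbhds G \<tau>. \<forall>F'. (F, F') \<in> completion_entourage G \<tau> U \<longrightarrow> F' \<in> S) \<longleftrightarrow>
      (\<exists>P. eventually P F \<and> {F'\<in>points. eventually P F'} \<subseteq> S)" if F: "F \<in> points" for F
  proof
    assume "\<exists>U\<in>unit_nbhds G \<tau>. \<forall>F'. (F, F') \<in> completion_entourage G \<tau> U \<longrightarrow> F' \<in> S"
    then obtain U where U: "U \<in> unit_nbhds G \<tau>" "\<And>F'. (F, F') \<in> completion_entourage G \<tau> U \<Longrightarrow> F' \<in> S"
      by blast
    obtain A where A: "eventually (\<lambda>x. x \<in> A) F" "\<forall>x\<in>A. \<forall>y\<in>A. (x, y) \<in> entourage U"
      using cauchyD(3)[OF pointsD[OF F] U(1)] by blast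
    have "F' \<in> S" if "F' \<in> points" "eventually (\<lambda>x. x \<in> A) F'" for F'
      using that A F by (intro U(2)) (auto simp: completion_entourage_def)
    with A(1) show "\<exists>P. eventually P F \<and> {F'\<in>points. eventually P F'} \<subseteq> S" by blast
  next
    assume "\<exists>P. eventually P F \<and> {F'\<in>points. eventually P F'} \<subseteq> S"
    then obtain P where P: "eventually P F" "\<And>F'. F' \<in> points \<Longrightarrow> eventually P F' \<Longrightarrow> F' \<in> S" by blast
    have "rounding F = F" by (rule round_unique[OF F order_refl cauchyD(1)[OF pointsD[OF F]]])
    with P(1) have "eventually P (rounding F)" by simp
    then obtain U where U: "U \<in> unit_nbhds G \<tau>" "eventually (\<lambda>x. \<forall>y. (x, y) \<in> entourage U \<longrightarrow> P y) F"
      unfolding eventually_round by blast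
    have "F' \<in> S" if F': "(F, F') \<in> completion_entourage G \<tau> U" for F'
    proof -
      obtain A where A: "eventually (\<lambda>x. x \<in> A) F" "eventually (\<lambda>x. x \<in> A) F'" "A \<times> A \<subseteq> entourage U"
        and "F' \<in> points" using F' by (auto simp: completion_entourage_def)
      have "eventually (\<lambda>x. x \<in> A \<and> (\<forall>y. (x, y) \<in> entourage U \<longrightarrow> P y)) F"
        using A(1) U(2) by eventually_elim simp
      then obtain x where x: "x \<in> A" "\<forall>y. (x, y) \<in> entourage U \<longrightarrow> P y"
        using eventually_happens'[OF cauchyD(1)[OF pointsD[OF F]]] by blast
      from A(2) have "eventually P F'" by eventually_elim (use x A(3) in blast)
      with \<open>F' \<in> points\<close> show ?thesis by (rule P(2))
    qed
    with U(1) show "\<exists>U\<in>unit_nbhds G \<tau>. \<forall>F'. (F, F') \<in> completion_entourage G \<tau> U \<longrightarrow> F' \<in> S" by blast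
  qed
  then show ?thesis unfolding op by (meson subsetD)
qed

lemma openin_Ghat_basic: "openin Ghat_top {F\<in>points. eventually P F}"
  unfolding openin_Ghat_top by blast

lemma topspace_Ghat_top [simp]: "topspace Ghat_top = points"
proof
  show "topspace Ghat_top \<subseteq> points" using openin_topspace[of Ghat_top] unfolding openin_Ghat_top by blast
  show "points \<subseteq> topspace Ghat_top" using openin_subset[OF openin_Ghat_basic[of "\<lambda>_. True"]] by simp
qed

lemma limitin_Ghat_top:
  "limitin Ghat_top g F \<Phi> \<longleftrightarrow> F \<in> points \<and> eventually (\<lambda>z. g z \<in> points) \<Phi> \<and>
    (\<forall>P. eventually P F \<longrightarrow> eventually (\<lambda>z. eventually P (g z)) \<Phi>)"
proof (intro iffI conjI allI impI)
  assume lim: "limitin Ghat_top g F \<Phi>"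
  show F: "F \<in> points" using limitin_topspace[OF lim] by simp
  have basic: "eventually (\<lambda>z. g z \<in> {F\<in>points. eventually P F}) \<Phi>" if "eventually P F" for P
    using limitinD[OF lim openin_Ghat_basic] F that by simp
  from basic[of "\<lambda>_. True"] show "eventually (\<lambda>z. g z \<in> points) \<Phi>" by simp
  show "eventually (\<lambda>z. eventually P (g z)) \<Phi>" if "eventually P F" for P
    using basic[OF that] by (auto elim: eventually_mono)
next
  assume R: "F \<in> points \<and> eventually (\<lambda>z. g z \<in> points) \<Phi> \<and>
    (\<forall>P. eventually P F \<longrightarrow> eventually (\<lambda>z. eventually P (g z)) \<Phi>)"
  show "limitin Ghat_top g F \<Phi>"
    unfolding limitin_def
  proof (intro conjI allI impI)
    show "F \<in> topspace Ghat_top" using R by simp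
    fix S assume "openin Ghat_top S \<and> F \<in> S"
    then obtain P where P: "eventually P F" "{F'\<in>points. eventually P F'} \<subseteq> S"
      unfolding openin_Ghat_top by blast
    from R P(1) have "eventually (\<lambda>z. g z \<in> points) \<Phi>" "eventually (\<lambda>z. eventually P (g z)) \<Phi>" by auto
    then show "eventually (\<lambda>z. g z \<in> S) \<Phi>" by eventually_elim (use P(2) in blast)
  qed
qed

text \<open>For multiplication, roundness of the product provides a set \<open>A B\<close> one entourage
  inside the given neighbourhood; that entourage absorbs the passage from the product filter of
  nearby points to its round hull.\<close>

lemma topological_group_Ghat: "topological_group Ghat Ghat_top"
proof (rule topological_groupI[OF Ghat_group])
  show "topspace Ghat_top = carrier Ghat" by simp
  fix g h :: "'a filter \<times> 'a filter \<Rightarrow> 'a filter" and a b :: "'a filter" and \<Phi>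
  assume "limitin Ghat_top g a \<Phi>" "limitin Ghat_top h b \<Phi>"
  then have g: "a \<in> points" "eventually (\<lambda>z. g z \<in> points) \<Phi>"
      "\<And>P. eventually P a \<Longrightarrow> eventually (\<lambda>z. eventually P (g z)) \<Phi>"
    and h: "b \<in> points" "eventually (\<lambda>z. h z \<in> points) \<Phi>"
      "\<And>P. eventually P b \<Longrightarrow> eventually (\<lambda>z. eventually P (h z)) \<Phi>"
    by (simp_all add: limitin_Ghat_top)
  show "limitin Ghat_top (\<lambda>z. g z \<otimes>\<^bsub>Ghat\<^esub> h z) (a \<otimes>\<^bsub>Ghat\<^esub> b) \<Phi>"
    unfolding limitin_Ghat_top
  proof (intro conjI allI impI)
    show "a \<otimes>\<^bsub>Ghat\<^esub> b \<in> points" using g(1) h(1) by (rule Ghat_mult_closed)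
    show "eventually (\<lambda>z. g z \<otimes>\<^bsub>Ghat\<^esub> h z \<in> points) \<Phi>"
      using g(2) h(2) by eventually_elim (rule Ghat_mult_closed)
    fix P assume "eventually P (a \<otimes>\<^bsub>Ghat\<^esub> b)"
    then obtain U where U: "U \<in> unit_nbhds G \<tau>"
      "eventually (\<lambda>x. \<forall>y. (x, y) \<in> entourage U \<longrightarrow> P y) (product_filter a b)"
      unfolding Ghat_mult[OF g(1) h(1)] eventually_round by blast
    then obtain A B where AB: "eventually A a" "eventually B b"
      "\<forall>x y. A x \<longrightarrow> B y \<longrightarrow> (\<forall>z. (x \<otimes> y, z) \<in> entourage U \<longrightarrow> P z)"
      unfolding eventually_product_filter by blast
    show "eventually (\<lambda>z. eventually P (g z \<otimes>\<^bsub>Ghat\<^esub> h z)) \<Phi>"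
      using g(2) h(2) g(3)[OF AB(1)] h(3)[OF AB(2)]
    proof eventually_elim
      case (elim z)
      have "eventually (\<lambda>x. \<forall>y. (x, y) \<in> entourage U \<longrightarrow> P y) (product_filter (g z) (h z))"
        unfolding eventually_product_filter using elim(3,4) AB(3) by blast
      with U(1) show ?case unfolding Ghat_mult[OF elim(1,2)] eventually_round by blast
    qed
  qed
next
  fix g :: "'a filter \<Rightarrow> 'a filter" and a :: "'a filter" and \<Phi>
  assume "limitin Ghat_top g a \<Phi>"
  then have g: "a \<in> points" "eventually (\<lambda>z. g z \<in> points) \<Phi>"
      "\<And>P. eventually P a \<Longrightarrow> eventually (\<lambda>z. eventually P (g z)) \<Phi>"
    by (simp_all add: limitin_Ghat_top)
  show "limitin Ghat_top (\<lambda>z. inv\<^bsub>Ghat\<^esub> g z) (inv\<^bsub>Ghat\<^esub> a) \<Phi>"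
    unfolding limitin_Ghat_top
  proof (intro conjI allI impI)
    show "inv\<^bsub>Ghat\<^esub> a \<in> points" using g(1) by (simp add: Ghat_inv round_inv_in_points)
    show "eventually (\<lambda>z. inv\<^bsub>Ghat\<^esub> g z \<in> points) \<Phi>"
      using g(2) by eventually_elim (simp add: Ghat_inv round_inv_in_points)
    fix P assume "eventually P (inv\<^bsub>Ghat\<^esub> a)"
    then obtain U where U: "U \<in> unit_nbhds G \<tau>"
      "eventually (\<lambda>x. \<forall>y. (inv x, y) \<in> entourage U \<longrightarrow> P y) a"
      unfolding Ghat_inv[OF g(1)] eventually_round eventually_filtermap by blast
    show "eventually (\<lambda>z. eventually P (inv\<^bsub>Ghat\<^esub> g z)) \<Phi>"
      using g(2) g(3)[OF U(2)]
    proof eventually_elim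
      case (elim z)
      then show ?case
        using U(1) unfolding Ghat_inv[OF elim(1)] eventually_round eventually_filtermap by blast
    qed
  qed
qed

lemma topgroup_Ghat: "topgroup Ghat Ghat_top"
  by (rule topgroup.intro[OF topological_group_Ghat])

lemma nhdsin_hom:
  assumes "x \<in> carrier G" "y \<in> carrier G"
  shows "nhdsin \<tau> (x \<otimes> y) = nhdsin \<tau> x \<otimes>\<^bsub>Ghat\<^esub> nhdsin \<tau> y"
proof (rule points_unique[where \<Phi> = "principal {()}"])
  show "filterlim (\<lambda>_. x \<otimes> y) (nhdsin \<tau> (x \<otimes> y)) (principal {()})"
    using assms by (intro filterlim_const_nhdsin) simp
  show "filterlim (\<lambda>_. x \<otimes> y) (nhdsin \<tau> x \<otimes>\<^bsub>Ghat\<^esub> nhdsin \<tau> y) (principal {()})"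
    using assms by (intro filterlim_Ghat_mult filterlim_const_nhdsin nhdsin_in_points)
qed (use assms in \<open>auto intro: nhdsin_in_points Ghat_mult_closed simp: principal_eq_bot_iff\<close>)

lemma continuous_nhdsin: "continuous_map \<tau> Ghat_top (nhdsin \<tau>)"
  unfolding continuous_map_iff_limitin_nhdsin limitin_Ghat_top
proof (intro ballI conjI allI impI)
  fix x assume x: "x \<in> topspace \<tau>"
  then show "nhdsin \<tau> x \<in> points" by (simp add: nhdsin_in_points)
  show "eventually (\<lambda>z. nhdsin \<tau> z \<in> points) (nhdsin \<tau> x)"
    using eventually_nhdsin_carrier[of x] x by (auto elim: eventually_mono intro: nhdsin_in_points)
  fix P assume "eventually P (nhdsin \<tau> x)"
  then obtain S where "openin \<tau> S" "x \<in> S" "\<forall>y\<in>S. P y" using x by (auto simp: eventually_nhdsin)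
  then show "eventually (\<lambda>z. eventually P (nhdsin \<tau> z)) (nhdsin \<tau> x)"
    unfolding eventually_nhdsin by blast
qed

lemma wap_uniformly_continuous:
  assumes u: "u \<in> W" and e: "e > 0"
  obtains U where "U \<in> unit_nbhds G \<tau>"
    "\<And>s t. s \<in> U \<Longrightarrow> t \<in> carrier G \<Longrightarrow> cmod (u (s \<otimes> t) - u t) < e"
    "\<And>s t. s \<in> U \<Longrightarrow> t \<in> carrier G \<Longrightarrow> cmod (u (t \<otimes> s) - u t) < e"
proof -
  let ?N = "nhdsin \<tau> \<one>"
  have lim: "limitin \<tau> (\<lambda>s. s \<otimes> t) (\<one> \<otimes> t) ?N" "limitin \<tau> (\<lambda>s. t \<otimes> s) (t \<otimes> \<one>) ?N" if "t \<in> carrier G" for t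
    by (rule limitin_mult[OF limitin_nhdsin_group[OF one_closed] limitin_const_group[OF that]],
        rule limitin_mult[OF limitin_const_group[OF that] limitin_nhdsin_group[OF one_closed]])
  have "((\<lambda>s. u (s \<otimes> t)) \<longlongrightarrow> u t) ?N" "((\<lambda>s. u (t \<otimes> s)) \<longlongrightarrow> u t) ?N" if "t \<in> carrier G" for t
    using tendsto_of_limitin[OF wap_imp(3)[OF u] lim(1)[OF that]]
      tendsto_of_limitin[OF wap_imp(3)[OF u] lim(2)[OF that]] that by simp_all
  note pt = this
  have "eventually (\<lambda>s. \<forall>t\<in>carrier G. cmod (u (s \<otimes> t) - u t) < e) ?N"
    by (rule uniform_left_translation[OF wap_imp(2)[OF u] wap_imp(4)[OF u] eventually_nhdsin_carrier pt(1) e]) simp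
  moreover have "eventually (\<lambda>s. \<forall>t\<in>carrier G. cmod (u (t \<otimes> s) - u t) < e) ?N"
    by (rule uniform_right_translation[OF wap_imp(2)[OF u] wap_imp(4)[OF u] eventually_nhdsin_carrier pt(2) e]) simp
  ultimately have "eventually (\<lambda>s. (\<forall>t\<in>carrier G. cmod (u (s \<otimes> t) - u t) < e) \<and>
      (\<forall>t\<in>carrier G. cmod (u (t \<otimes> s) - u t) < e)) ?N"
    by (rule eventually_conj)
  then show ?thesis unfolding eventually_unit_nbhds using that by blast
qed

lemma wap_close_of_entourage:
  assumes "\<And>s t. s \<in> U \<Longrightarrow> t \<in> carrier G \<Longrightarrow> cmod (u (s \<otimes> t) - u t) < e" "(x, y) \<in> entourage U" "t \<in> carrier G"
  shows "cmod (u (y \<otimes> t) - u (x \<otimes> t)) < e"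
proof -
  have car: "x \<in> carrier G" "y \<in> carrier G" "y \<otimes> inv x \<in> U" using assms(2) by (auto simp: entourage_iff)
  have "y \<otimes> inv x \<otimes> (x \<otimes> t) = y \<otimes> (inv x \<otimes> x) \<otimes> t"
    using car assms(3) by (simp only: m_assoc m_closed inv_closed)
  then show ?thesis using assms(1)[OF car(3), of "x \<otimes> t"] car assms(3) by simp
qed

lemma wap_close_of_entourage_right:
  assumes "\<And>s t. s \<in> U \<Longrightarrow> t \<in> carrier G \<Longrightarrow> cmod (u (t \<otimes> s) - u t) < e" "(x, y) \<in> entourage U" "t \<in> carrier G"
  shows "cmod (u (t \<otimes> y) - u (t \<otimes> x)) < e"
proof -
  have car: "x \<in> carrier G" "y \<in> carrier G" "inv x \<otimes> y \<in> U" using assms(2) by (auto simp: entourage_iff)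
  have "t \<otimes> x \<otimes> (inv x \<otimes> y) = t \<otimes> (x \<otimes> inv x) \<otimes> y"
    using car assms(3) by (simp only: m_assoc m_closed inv_closed)
  then show ?thesis using assms(1)[OF car(3), of "t \<otimes> x"] car assms(3) by simp
qed

definition extend :: "('a \<Rightarrow> complex) \<Rightarrow> 'a filter \<Rightarrow> complex" where
  "extend u F = (if F \<in> points then Lim F u else 0)"

lemma wap_cauchy_small:
  assumes u: "u \<in> W" and F: "F \<in> points" and e: "e > 0"
  obtains A where "eventually (\<lambda>x. x \<in> A) F" "\<And>x y. x \<in> A \<Longrightarrow> y \<in> A \<Longrightarrow> cmod (u x - u y) < e"
proof -
  obtain U where U: "U \<in> unit_nbhds G \<tau>" "\<And>s t. s \<in> U \<Longrightarrow> t \<in> carrier G \<Longrightarrow> cmod (u (s \<otimes> t) - u t) < e"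
    using wap_uniformly_continuous[OF u e] by metis
  obtain A where A: "eventually (\<lambda>x. x \<in> A) F" "\<forall>x\<in>A. \<forall>y\<in>A. (x, y) \<in> entourage U"
    using cauchyD(3)[OF pointsD[OF F] U(1)] by blast
  have "cmod (u x - u y) < e" if "x \<in> A" "y \<in> A" for x y
  proof -
    have xy: "(y, x) \<in> entourage U" using A(2) that by blast
    then show ?thesis using wap_close_of_entourage[OF U(2) xy one_closed] by (simp add: entourage_iff)
  qed
  with A(1) that show ?thesis by blast
qed

lemma extend_tendsto:
  assumes u: "u \<in> W" and F: "F \<in> points"
  shows "(u \<longlongrightarrow> extend u F) F"
proof -
  have nb: "F \<noteq> bot" using cauchyD(1)[OF pointsD[OF F]] .
  obtain B where B: "B \<le> F" "ultrafilter_on UNIV B"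
    by (rule ultrafilter_below[OF nb]) auto
  have limB: "(u \<longlongrightarrow> Lim B u) B" using wap_tendsto[OF u B(2), of "\<lambda>x. x"] by simp
  have "(u \<longlongrightarrow> Lim B u) F"
  proof (rule tendstoI)
    fix e :: real assume e: "e > 0"
    then obtain A where A: "eventually (\<lambda>x. x \<in> A) F" "\<And>x y. x \<in> A \<Longrightarrow> y \<in> A \<Longrightarrow> cmod (u x - u y) < e/2"
      using wap_cauchy_small[OF u F, of "e/2"] by auto
    have "eventually (\<lambda>y. y \<in> A \<and> dist (u y) (Lim B u) < e/2) B"
      using filter_leD[OF B(1) A(1)] tendstoD[OF limB, of "e/2"] e by (auto elim: eventually_elim2)
    then obtain y where y: "y \<in> A" "dist (u y) (Lim B u) < e/2"
      using eventually_happens'[OF ultrafilter_onD(1)[OF B(2)]] by blast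
    from A(1) show "eventually (\<lambda>x. dist (u x) (Lim B u) < e) F"
    proof eventually_elim
      case (elim x)
      have "dist (u x) (u y) < e/2" using A(2)[OF elim y(1)] by (simp add: dist_norm)
      then show ?case using y(2) dist_triangle_half_r[of "u y" "u x" e "Lim B u"] by (simp add: dist_commute)
    qed
  qed
  then show ?thesis using F nb by (simp add: extend_def tendsto_Lim)
qed

lemma extend_nhdsin:
  assumes u: "u \<in> W" and x: "x \<in> carrier G"
  shows "extend u (nhdsin \<tau> x) = u x"
proof -
  have "(u \<longlongrightarrow> u x) (nhdsin \<tau> x)" using wap_imp(3)[OF u] x by (simp add: continuous_map_euclidean_iff)
  then show ?thesis
    using extend_tendsto[OF u nhdsin_in_points[OF x]] tendsto_unique nhdsin_neq_bot[of x \<tau>] x by fastforce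
qed

lemma norm_extend_le:
  assumes u: "u \<in> W" shows "cmod (extend u F) \<le> uniform_norm u"
proof (cases "F \<in> points")
  case True
  show ?thesis
    by (rule tendsto_upperbound[OF tendsto_norm[OF extend_tendsto[OF u True]]])
      (use cauchyD(1)[OF pointsD[OF True]] wap_imp(4)[OF u] in auto)
next
  case False
  then show ?thesis using order_trans[OF norm_ge_zero wap_imp(4)[OF u]] by (simp add: extend_def)
qed

lemma extend_close:
  assumes u: "u \<in> W" and F: "F \<in> points" and "eventually (\<lambda>x. cmod (u x - c) \<le> e) F"
  shows "cmod (extend u F - c) \<le> e"
proof (rule tendsto_upperbound[OF _ assms(3)])
  show "((\<lambda>x. cmod (u x - c)) \<longlongrightarrow> cmod (extend u F - c)) F"
    by (intro tendsto_norm tendsto_diff extend_tendsto[OF u F] tendsto_const)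
qed (use cauchyD(1)[OF pointsD[OF F]] in auto)

lemma extend_continuous:
  assumes u: "u \<in> W" shows "continuous_map Ghat_top euclidean (extend u)"
  unfolding continuous_map_euclidean_iff
proof (intro ballI tendstoI)
  fix F and e :: real assume "F \<in> topspace Ghat_top" and e: "e > 0"
  then have F: "F \<in> points" by simp
  obtain A where A: "eventually (\<lambda>x. x \<in> A) F" "\<And>x y. x \<in> A \<Longrightarrow> y \<in> A \<Longrightarrow> cmod (u x - u y) < e/2"
    using wap_cauchy_small[OF u F, of "e/2"] e by auto
  have "dist (extend u F') (extend u F) < e" if F': "F' \<in> points" "eventually (\<lambda>x. x \<in> A) F'" for F'
  proof -
    have "cmod (extend u F' - extend u F) \<le> e/2"
    proof (rule extend_close[OF u F'(1)])
      show "eventually (\<lambda>x. cmod (u x - extend u F) \<le> e/2) F'"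
        using F'(2)
      proof eventually_elim
        case (elim x)
        have "cmod (extend u F - u x) \<le> e/2"
          using A by (intro extend_close[OF u F]) (auto elim!: eventually_mono intro: less_imp_le elim)
        then show ?case by (simp add: norm_minus_commute)
      qed
    qed
    with e show ?thesis by (simp add: dist_norm)
  qed
  moreover have "eventually (\<lambda>F'. F' \<in> {F'\<in>points. eventually (\<lambda>x. x \<in> A) F'}) (nhdsin Ghat_top F)"
    unfolding eventually_nhdsin using openin_Ghat_basic[of "\<lambda>x. x \<in> A"] F A(1) by blast
  ultimately show "eventually (\<lambda>F'. dist (extend u F') (extend u F) < e) (nhdsin Ghat_top F)"
    by (auto elim: eventually_mono)
qed

text \<open>By uniform continuity on both sides, \<open>extend u (F F')\<close> differs from \<open>u (a F \<otimes> a F')\<close> by at most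
  \<open>e\<close>, where \<open>a F\<close> is an element of a small set of \<open>F\<close>. So the double limit property of \<open>u\<close> passes to
  the extension.\<close>

lemma extend_wap:
  assumes u: "u \<in> W" shows "extend u \<in> wap Ghat Ghat_top"
proof -
  interpret Gh: topgroup Ghat Ghat_top by (rule topgroup_Ghat)
  have "extend u \<in> bounded_continuous Ghat_top"
    by (rule bounded_continuousI[OF extend_continuous[OF u] norm_extend_le[OF u]]) (simp add: extend_def)
  moreover have "double_limit_property Ghat (extend u)"
    unfolding double_limit_property_def
  proof (rule interchange_approx)
    show "cmod (extend u (x \<otimes>\<^bsub>Ghat\<^esub> y)) \<le> uniform_norm u" for x y by (rule norm_extend_le[OF u])
    fix e :: real assume e: "e > 0"
    obtain U where U: "U \<in> unit_nbhds G \<tau>"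
      "\<And>s t. s \<in> U \<Longrightarrow> t \<in> carrier G \<Longrightarrow> cmod (u (s \<otimes> t) - u t) < e/2"
      "\<And>s t. s \<in> U \<Longrightarrow> t \<in> carrier G \<Longrightarrow> cmod (u (t \<otimes> s) - u t) < e/2"
      using wap_uniformly_continuous[OF u, of "e/2"] e by auto
    have "\<exists>c. c \<in> carrier G \<and> eventually (\<lambda>x. (c, x) \<in> entourage U) F" if F: "F \<in> points" for F
    proof -
      obtain A where A: "eventually (\<lambda>x. x \<in> A) F" "\<forall>x\<in>A. \<forall>y\<in>A. (x, y) \<in> entourage U"
        using cauchyD(3)[OF pointsD[OF F] U(1)] by blast
      obtain c where c: "c \<in> A" using eventually_happens'[OF cauchyD(1)[OF pointsD[OF F]] A(1)] by blast
      have "eventually (\<lambda>x. (c, x) \<in> entourage U) F" using A(1) by eventually_elim (use A(2) c in blast)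
      moreover have "(c, c) \<in> entourage U" using A(2) c by blast
      ultimately show ?thesis by (auto simp: entourage_iff)
    qed
    then obtain a where a: "\<And>F. F \<in> points \<Longrightarrow> a F \<in> carrier G"
      "\<And>F. F \<in> points \<Longrightarrow> eventually (\<lambda>x. (a F, x) \<in> entourage U) F" by metis
    have "cmod (extend u (F \<otimes>\<^bsub>Ghat\<^esub> F') - u (a F \<otimes> a F')) \<le> e" if F: "F \<in> points" "F' \<in> points" for F F'
    proof -
      let ?\<Phi> = "F \<times>\<^sub>F F'"
      have nb: "?\<Phi> \<noteq> bot" using F cauchyD(1)[OF pointsD] by (simp add: prod_filter_eq_bot)
      have "filterlim (\<lambda>z. fst z \<otimes> snd z) (F \<otimes>\<^bsub>Ghat\<^esub> F') ?\<Phi>"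
        by (intro filterlim_Ghat_mult F filterlim_fst filterlim_snd)
      from filterlim_compose[OF extend_tendsto[OF u Ghat_mult_closed[OF F]] this]
      have "((\<lambda>z. cmod (u (fst z \<otimes> snd z) - u (a F \<otimes> a F'))) \<longlongrightarrow>
          cmod (extend u (F \<otimes>\<^bsub>Ghat\<^esub> F') - u (a F \<otimes> a F'))) ?\<Phi>"
        by (intro tendsto_norm tendsto_diff tendsto_const)
      moreover have "eventually (\<lambda>z. cmod (u (fst z \<otimes> snd z) - u (a F \<otimes> a F')) \<le> e) ?\<Phi>"
        using eventually_compose_filterlim[OF a(2)[OF F(1)] filterlim_fst[of F F']]
          eventually_compose_filterlim[OF a(2)[OF F(2)] filterlim_snd[of F' F]]
      proof eventually_elim
        case (elim z)
        have z: "snd z \<in> carrier G" using elim(2) by (auto simp: entourage_iff)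
        have "cmod (u (fst z \<otimes> snd z) - u (a F \<otimes> snd z)) < e/2"
          by (rule wap_close_of_entourage[OF U(2) elim(1) z])
        moreover have "cmod (u (a F \<otimes> snd z) - u (a F \<otimes> a F')) < e/2"
          by (rule wap_close_of_entourage_right[OF U(3) elim(2) a(1)[OF F(1)]])
        moreover have "cmod (u (fst z \<otimes> snd z) - u (a F \<otimes> a F')) \<le>
            cmod (u (fst z \<otimes> snd z) - u (a F \<otimes> snd z)) + cmod (u (a F \<otimes> snd z) - u (a F \<otimes> a F'))"
          using norm_triangle_ineq[of "u (fst z \<otimes> snd z) - u (a F \<otimes> snd z)" "u (a F \<otimes> snd z) - u (a F \<otimes> a F')"]
          by simp
        ultimately show ?case by linarith
      qed
      ultimately show ?thesis by (rule tendsto_upperbound[OF _ _ nb])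
    qed
    moreover have "interchange (carrier Ghat) (carrier Ghat) (\<lambda>F F'. u (a F \<otimes> a F'))"
      using interchange_reindex[OF wap_imp(2)[OF u, unfolded double_limit_property_def], of "carrier Ghat" a "carrier Ghat" a]
        a(1) by simp
    ultimately show "\<exists>w'. interchange (carrier Ghat) (carrier Ghat) w' \<and>
        (\<forall>x\<in>carrier Ghat. \<forall>y\<in>carrier Ghat. cmod (extend u (x \<otimes>\<^bsub>Ghat\<^esub> y) - w' x y) \<le> e)"
      by auto
  qed
  ultimately show ?thesis by (simp add: Gh.wap_iff_double_limit_property)
qed

end

section \<open>The separated quotient\<close>

context topgroup
begin

abbreviation N where "N \<equiv> unit_closure G \<tau>"
abbreviation Q where "Q \<equiv> separated_quotient G \<tau>"
abbreviation Qtop where "Qtop \<equiv> quotient_topology G \<tau>"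
abbreviation proj where "proj x \<equiv> N #> x"

lemma mem_N: "x \<in> N \<longleftrightarrow> x \<in> carrier G \<and> (\<forall>U. openin \<tau> U \<longrightarrow> x \<in> U \<longrightarrow> \<one> \<in> U)"
  by (auto simp: unit_closure_def in_closure_of)

lemma openin_preimage_mult:
  assumes "openin \<tau> U" "a \<in> carrier G" "b \<in> carrier G"
  shows "openin \<tau> {z \<in> carrier G. a \<otimes> z \<otimes> b \<in> U}"
    and "openin \<tau> {z \<in> carrier G. inv z \<otimes> b \<in> U}"
proof -
  have "continuous_map \<tau> \<tau> (\<lambda>z. a \<otimes> z \<otimes> b)" "continuous_map \<tau> \<tau> (\<lambda>z. inv z \<otimes> b)"
    unfolding continuous_map_iff_limitin_nhdsin
    using assms(2,3) by (auto intro!: limitin_mult limitin_inv limitin_const_group limitin_nhdsin_id)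
  from this[THEN openin_continuous_map_preimage, OF assms(1)] assms(1)
  show "openin \<tau> {z \<in> carrier G. a \<otimes> z \<otimes> b \<in> U}" "openin \<tau> {z \<in> carrier G. inv z \<otimes> b \<in> U}"
    by simp_all
qed

text \<open>The preimage of \<open>U\<close> under \<open>z \<mapsto> z x\<close>, or under \<open>z \<mapsto> z\<^sup>-\<^sup>1 n x\<close>, is an open set that contains \<open>n\<close>,
  so it contains \<open>1\<close>.\<close>

lemma N_saturated:
  assumes n: "n \<in> N" and U: "openin \<tau> U" and x: "x \<in> carrier G"
  shows "n \<otimes> x \<in> U \<longleftrightarrow> x \<in> U"
proof
  have nG: "n \<in> carrier G" using n by (simp add: mem_N)
  {
    assume "n \<otimes> x \<in> U"
    then have "n \<in> {z \<in> carrier G. \<one> \<otimes> z \<otimes> x \<in> U}" using nG by simp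
    with n openin_preimage_mult(1)[OF U one_closed x] have "\<one> \<in> {z \<in> carrier G. \<one> \<otimes> z \<otimes> x \<in> U}"
      unfolding mem_N by blast
    then show "x \<in> U" using x by simp
  }
  assume "x \<in> U"
  moreover have "inv n \<otimes> (n \<otimes> x) = x" using nG x by (simp add: m_assoc[symmetric])
  ultimately have "n \<in> {z \<in> carrier G. inv z \<otimes> (n \<otimes> x) \<in> U}" using nG by simp
  with n openin_preimage_mult(2)[OF U one_closed, of "n \<otimes> x"] nG x
  have "\<one> \<in> {z \<in> carrier G. inv z \<otimes> (n \<otimes> x) \<in> U}"
    unfolding mem_N by (metis m_closed)
  then show "n \<otimes> x \<in> U" using nG x by simp
qed

lemma N_normal: "N \<lhd> G"
  unfolding normal_inv_iff
proof (intro conjI ballI)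
  have NG: "n \<in> carrier G" if "n \<in> N" for n using that by (simp add: mem_N)
  show "subgroup N G"
  proof (rule subgroupI)
    show "N \<subseteq> carrier G" using NG by blast
    have "\<one> \<in> N" by (simp add: mem_N)
    then show "N \<noteq> {}" by blast
    show "inv n \<in> N" if n: "n \<in> N" for n
      using N_saturated[OF n, of _ "inv n"] NG[OF n] by (simp add: mem_N)
    show "n \<otimes> m \<in> N" if n: "n \<in> N" and m: "m \<in> N" for n m
      using N_saturated[OF n, of _ m] m NG[OF n] NG[OF m] by (auto simp: mem_N)
  qed
  fix x n assume x: "x \<in> carrier G" and n: "n \<in> N"
  have "\<one> \<in> U" if U: "openin \<tau> U" "x \<otimes> n \<otimes> inv x \<in> U" for U
  proof -
    have "n \<in> {z \<in> carrier G. x \<otimes> z \<otimes> inv x \<in> U}" using U NG[OF n] by simp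
    with n openin_preimage_mult(1)[OF U(1) x, of "inv x"] x have "\<one> \<in> {z \<in> carrier G. x \<otimes> z \<otimes> inv x \<in> U}"
      unfolding mem_N by blast
    then show ?thesis using x by simp
  qed
  then show "x \<otimes> n \<otimes> inv x \<in> N" using x NG[OF n] by (simp add: mem_N)
qed

lemma carrier_Q: "carrier Q = proj ` carrier G"
  by (auto simp: separated_quotient_def FactGroup_def RCOSETS_def)

lemma group_Q: "group Q"
  unfolding separated_quotient_def by (rule normal.factorgroup_is_group[OF N_normal])

lemma proj_mult: "x \<in> carrier G \<Longrightarrow> y \<in> carrier G \<Longrightarrow> proj x \<otimes>\<^bsub>Q\<^esub> proj y = proj (x \<otimes> y)"
  by (simp add: separated_quotient_def FactGroup_def normal.rcos_sum[OF N_normal])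

lemma proj_one: "\<one>\<^bsub>Q\<^esub> = proj \<one>"
  using coset_mult_one[OF subgroup.subset[OF normal_imp_subgroup[OF N_normal]]]
  by (simp add: separated_quotient_def FactGroup_def)

lemma proj_inv:
  assumes "x \<in> carrier G" shows "inv\<^bsub>Q\<^esub> proj x = proj (inv x)"
  by (rule group.inv_equality[OF group_Q]) (use assms in \<open>simp_all add: proj_mult proj_one carrier_Q\<close>)

lemma proj_mem_iff:
  assumes U: "openin \<tau> U" and x: "x \<in> carrier G" and y: "y \<in> carrier G" and eq: "proj x = proj y"
  shows "x \<in> U \<longleftrightarrow> y \<in> U"
proof -
  have "x \<in> proj y" using eq rcos_self[OF x normal_imp_subgroup[OF N_normal]] by simp
  then obtain n where "n \<in> N" "x = n \<otimes> y" by (auto simp: r_coset_def)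
  then show ?thesis using N_saturated[OF _ U y] by simp
qed

lemma openin_Qtop: "openin Qtop S \<longleftrightarrow> S \<subseteq> proj ` carrier G \<and> openin \<tau> {x \<in> carrier G. proj x \<in> S}"
  by (simp add: openin_quotient_topology carrier_Q)

lemma openin_proj_image:
  assumes U: "openin \<tau> U" shows "openin Qtop (proj ` U)"
proof -
  have sub: "U \<subseteq> carrier G" using openin_subset[OF U] by simp
  have "{x \<in> carrier G. proj x \<in> proj ` U} = U"
    using sub proj_mem_iff[OF U] by blast
  then show ?thesis using U sub by (auto simp: openin_Qtop)
qed

lemma topspace_Qtop: "topspace Qtop = proj ` carrier G"
proof
  show "topspace Qtop \<subseteq> proj ` carrier G" using openin_topspace[of Qtop] unfolding openin_Qtop by blast
  have "openin \<tau> (carrier G)" using openin_topspace[of \<tau>] by simp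
  from openin_subset[OF openin_proj_image[OF this]] show "proj ` carrier G \<subseteq> topspace Qtop" .
qed

lemma continuous_proj: "continuous_map \<tau> Qtop proj"
  unfolding continuous_map_def by (auto simp: topspace_Qtop openin_Qtop)

lemma topological_group_Q: "topological_group Q Qtop"
proof (rule topological_groupI[OF group_Q])
  show "topspace Qtop = carrier Q" by (simp add: topspace_Qtop carrier_Q)
  fix g h :: "'a set \<times> 'a set \<Rightarrow> 'a set" and X Y \<Phi>
  assume g: "limitin Qtop g X \<Phi>" and h: "limitin Qtop h Y \<Phi>"
  obtain a b where a: "a \<in> carrier G" "X = proj a" and b: "b \<in> carrier G" "Y = proj b"
    using limitin_topspace[OF g] limitin_topspace[OF h] by (auto simp: topspace_Qtop)
  show "limitin Qtop (\<lambda>z. g z \<otimes>\<^bsub>Q\<^esub> h z) (X \<otimes>\<^bsub>Q\<^esub> Y) \<Phi>"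
    unfolding limitin_def
  proof (intro conjI allI impI)
    show "X \<otimes>\<^bsub>Q\<^esub> Y \<in> topspace Qtop" using a b by (simp add: proj_mult topspace_Qtop)
    fix S assume S: "openin Qtop S \<and> X \<otimes>\<^bsub>Q\<^esub> Y \<in> S"
    let ?V = "{x \<in> carrier G. proj x \<in> S}"
    have V: "openin \<tau> ?V" "a \<otimes> b \<in> ?V" using S a b by (auto simp: openin_Qtop proj_mult)
    have "limitin \<tau> (\<lambda>z. fst z \<otimes> snd z) (a \<otimes> b) (nhdsin \<tau> a \<times>\<^sub>F nhdsin \<tau> b)"
      by (rule limitin_mult[OF limitin_compose_filterlim[OF limitin_nhdsin_group[OF a(1)] filterlim_fst]
          limitin_compose_filterlim[OF limitin_nhdsin_group[OF b(1)] filterlim_snd]])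
    then have "eventually (\<lambda>z. fst z \<otimes> snd z \<in> ?V) (nhdsin \<tau> a \<times>\<^sub>F nhdsin \<tau> b)"
      by (rule limitinD[OF _ V])
    from eventually_prod_filter[THEN iffD1, OF this]
    obtain P R where P: "eventually P (nhdsin \<tau> a)" and R: "eventually R (nhdsin \<tau> b)"
      and PR: "\<forall>x y. P x \<longrightarrow> R y \<longrightarrow> fst (x, y) \<otimes> snd (x, y) \<in> ?V"
      by (elim exE conjE) (rule that)
    obtain A where A: "openin \<tau> A" "a \<in> A" "\<forall>x\<in>A. P x" using P a by (auto simp: eventually_nhdsin)
    obtain B where B: "openin \<tau> B" "b \<in> B" "\<forall>x\<in>B. R x" using R b by (auto simp: eventually_nhdsin)
    have sub: "A \<subseteq> carrier G" "B \<subseteq> carrier G" using openin_subset[OF A(1)] openin_subset[OF B(1)] by simp_all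
    have "eventually (\<lambda>z. g z \<in> proj ` A) \<Phi>"
      by (rule limitinD[OF g openin_proj_image[OF A(1)]]) (use a A in blast)
    moreover have "eventually (\<lambda>z. h z \<in> proj ` B) \<Phi>"
      by (rule limitinD[OF h openin_proj_image[OF B(1)]]) (use b B in blast)
    ultimately show "eventually (\<lambda>z. g z \<otimes>\<^bsub>Q\<^esub> h z \<in> S) \<Phi>"
    proof eventually_elim
      case (elim z)
      then obtain x y where xy: "x \<in> A" "g z = proj x" "y \<in> B" "h z = proj y" by blast
      have "x \<otimes> y \<in> ?V" using PR[rule_format, of x y] A(3) B(3) xy by simp
      then show ?case using xy sub by (auto simp: proj_mult subset_iff)
    qed
  qed
next
  fix g :: "'a set \<Rightarrow> 'a set" and X \<Phi>
  assume g: "limitin Qtop g X \<Phi>"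
  obtain a where a: "a \<in> carrier G" "X = proj a" using limitin_topspace[OF g] by (auto simp: topspace_Qtop)
  show "limitin Qtop (\<lambda>z. inv\<^bsub>Q\<^esub> g z) (inv\<^bsub>Q\<^esub> X) \<Phi>"
    unfolding limitin_def
  proof (intro conjI allI impI)
    show "inv\<^bsub>Q\<^esub> X \<in> topspace Qtop" using a by (simp add: proj_inv topspace_Qtop)
    fix S assume S: "openin Qtop S \<and> inv\<^bsub>Q\<^esub> X \<in> S"
    let ?V = "{x \<in> carrier G. proj x \<in> S}"
    have V: "openin \<tau> ?V" "inv a \<in> ?V" using S a by (auto simp: openin_Qtop proj_inv)
    have "limitin \<tau> (\<lambda>z. inv z) (inv a) (nhdsin \<tau> a)"
      by (intro limitin_inv limitin_nhdsin_group a)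
    then have "eventually (\<lambda>z. inv z \<in> ?V) (nhdsin \<tau> a)" by (rule limitinD[OF _ V])
    then obtain A where A: "openin \<tau> A" "a \<in> A" "\<forall>x\<in>A. inv x \<in> ?V" using a by (auto simp: eventually_nhdsin)
    have sub: "A \<subseteq> carrier G" using openin_subset[OF A(1)] by simp
    have "eventually (\<lambda>z. g z \<in> proj ` A) \<Phi>"
      by (rule limitinD[OF g openin_proj_image[OF A(1)]]) (use a A in blast)
    then show "eventually (\<lambda>z. inv\<^bsub>Q\<^esub> g z \<in> S) \<Phi>"
    proof eventually_elim
      case (elim z)
      then obtain x where x: "x \<in> A" "g z = proj x" by blast
      have "inv x \<in> ?V" using A(3) x by blast
      then show ?case using x sub by (auto simp: proj_inv subset_iff)
    qed
  qed
qed

lemma topgroup_Q: "topgroup Q Qtop"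
  by (rule topgroup.intro[OF topological_group_Q])

lemma continuous_eq_of_proj_eq:
  assumes u: "continuous_map \<tau> euclidean (u :: 'a \<Rightarrow> complex)"
    and "x \<in> carrier G" "y \<in> carrier G" "proj x = proj y"
  shows "u x = u y"
proof (rule ccontr)
  assume ne: "u x \<noteq> u y"
  have "openin \<tau> {z \<in> topspace \<tau>. u z \<in> - {u y}}"
    by (rule openin_continuous_map_preimage[OF u]) (simp add: open_Compl)
  from proj_mem_iff[OF this assms(2-4)] ne assms(2,3) show False by simp
qed

text \<open>The double limit property is transported by any choice of representatives, because the function is
  constant on cosets.\<close>

lemma wap_descends:
  assumes u: "u \<in> W"
  obtains v where "v \<in> wap Q Qtop" "\<And>x. x \<in> carrier G \<Longrightarrow> v (proj x) = u x"
proof -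
  interpret Q: topgroup Q Qtop by (rule topgroup_Q)
  define r where "r X = (SOME x. x \<in> carrier G \<and> X = proj x)" for X
  have r: "r X \<in> carrier G" "X = proj (r X)" if "X \<in> carrier Q" for X
    using that someI_ex[of "\<lambda>x. x \<in> carrier G \<and> X = proj x"] unfolding r_def carrier_Q by blast+
  define v where "v X = (if X \<in> carrier Q then u (r X) else 0)" for X
  have v: "v (proj x) = u x" if x: "x \<in> carrier G" for x
  proof -
    have X: "proj x \<in> carrier Q" using x by (simp add: carrier_Q)
    have "u (r (proj x)) = u x"
      by (rule continuous_eq_of_proj_eq[OF wap_imp(3)[OF u] r(1)[OF X] x r(2)[OF X, symmetric]])
    then show ?thesis using X by (simp add: v_def)
  qed
  have "v \<in> bounded_continuous Qtop"
  proof (rule bounded_continuousI[where B = "uniform_norm u"])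
    show "continuous_map Qtop euclidean v"
      unfolding continuous_map_def
    proof (intro conjI allI impI)
      fix O' :: "complex set" assume "openin euclidean O'"
      then have "openin \<tau> {x \<in> topspace \<tau>. u x \<in> O'}"
        by (rule openin_continuous_map_preimage[OF wap_imp(3)[OF u]])
      moreover have "{x \<in> carrier G. proj x \<in> {X \<in> topspace Qtop. v X \<in> O'}} = {x \<in> topspace \<tau>. u x \<in> O'}"
        using v by (auto simp: topspace_Qtop carrier_Q)
      ultimately show "openin Qtop {X \<in> topspace Qtop. v X \<in> O'}"
        unfolding openin_Qtop by (auto simp: topspace_Qtop carrier_Q)
    qed simp
    show "cmod (v X) \<le> uniform_norm u" if "X \<in> topspace Qtop" for X
      using that v wap_imp(4)[OF u] by (auto simp: topspace_Qtop carrier_Q)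
    show "v X = 0" if "X \<notin> topspace Qtop" for X
      using that by (simp add: v_def)
  qed
  moreover have "double_limit_property Q v"
  proof -
    have "interchange (carrier Q) (carrier Q) (\<lambda>X Y. u (r X \<otimes> r Y))"
      using interchange_reindex[OF wap_imp(2)[OF u, unfolded double_limit_property_def], of "carrier Q" r "carrier Q" r]
        r(1) by simp
    moreover have "u (r X \<otimes> r Y) = v (X \<otimes>\<^bsub>Q\<^esub> Y)" if "X \<in> carrier Q" "Y \<in> carrier Q" for X Y
    proof -
      have "X \<otimes>\<^bsub>Q\<^esub> Y = proj (r X) \<otimes>\<^bsub>Q\<^esub> proj (r Y)" using r(2)[OF that(1)] r(2)[OF that(2)] by simp
      also have "\<dots> = proj (r X \<otimes> r Y)" by (rule proj_mult[OF r(1)[OF that(1)] r(1)[OF that(2)]])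
      finally show ?thesis using v[of "r X \<otimes> r Y"] r(1)[OF that(1)] r(1)[OF that(2)] by simp
    qed
    ultimately show ?thesis
      unfolding double_limit_property_def by (rule interchange_cong[THEN iffD1, rotated])
  qed
  ultimately show ?thesis using that v by (simp add: Q.wap_iff_double_limit_property)
qed

section \<open>The canonical map into the completion\<close>

abbreviation \<eta> where "\<eta> \<equiv> eta G \<tau>"
abbreviation C where "C \<equiv> G_completion G \<tau>"
abbreviation Ctop where "Ctop \<equiv> G_completion_topology G \<tau>"

lemma topgroup_C: "topgroup C Ctop"
  by (rule topgroup.topgroup_Ghat[OF topgroup_Q])

lemma eta_in: "x \<in> carrier G \<Longrightarrow> \<eta> x \<in> carrier C"
  unfolding eta_def topgroup.Ghat_simps(1)[OF topgroup_Q]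
  by (rule topgroup.nhdsin_in_points[OF topgroup_Q]) (simp add: carrier_Q)

lemma eta_mult:
  assumes "x \<in> carrier G" "y \<in> carrier G" shows "\<eta> (x \<otimes> y) = \<eta> x \<otimes>\<^bsub>C\<^esub> \<eta> y"
  unfolding eta_def proj_mult[OF assms, symmetric]
  by (rule topgroup.nhdsin_hom[OF topgroup_Q]) (use assms in \<open>simp_all add: carrier_Q\<close>)

lemma eta_one: "\<eta> \<one> = \<one>\<^bsub>C\<^esub>"
  unfolding eta_def topgroup.Ghat_simps(2)[OF topgroup_Q] proj_one ..

lemma continuous_eta: "continuous_map \<tau> Ctop \<eta>"
  using continuous_map_compose[OF continuous_proj topgroup.continuous_nhdsin[OF topgroup_Q]]
  by (simp add: comp_def eta_def[abs_def])

definition pullback :: "('a set filter \<Rightarrow> complex) \<Rightarrow> 'a \<Rightarrow> complex" where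
  "pullback f s = (if s \<in> carrier G then f (\<eta> s) else 0)"

lemma pullback_wap:
  assumes f: "f \<in> wap C Ctop" shows "pullback f \<in> W"
proof -
  interpret C: topgroup C Ctop by (rule topgroup_C)
  have "pullback f \<in> bounded_continuous \<tau>"
  proof (rule bounded_continuousI[where B = "uniform_norm f"])
    have "continuous_map \<tau> euclidean (\<lambda>s. f (\<eta> s))"
      using continuous_map_compose[OF continuous_eta C.wap_imp(3)[OF f]] by (simp add: comp_def)
    then show "continuous_map \<tau> euclidean (pullback f)"
      by (rule continuous_map_eq) (simp add: pullback_def)
  qed (auto simp: pullback_def C.wap_imp(4)[OF f])
  moreover have "double_limit_property G (pullback f)"
  proof -
    have "interchange (carrier G) (carrier G) (\<lambda>s t. f (\<eta> s \<otimes>\<^bsub>C\<^esub> \<eta> t))"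
      by (rule interchange_reindex[OF C.wap_imp(2)[OF f, unfolded double_limit_property_def] eta_in eta_in])
    moreover have "f (\<eta> s \<otimes>\<^bsub>C\<^esub> \<eta> t) = pullback f (s \<otimes> t)" if "s \<in> carrier G" "t \<in> carrier G" for s t
      using that by (simp add: pullback_def eta_mult)
    ultimately show ?thesis
      unfolding double_limit_property_def by (rule interchange_cong[THEN iffD1, rotated])
  qed
  ultimately show ?thesis by (simp add: wap_iff_double_limit_property)
qed

lemma pullback_surj:
  assumes u: "u \<in> W" obtains f where "f \<in> wap C Ctop" "pullback f = u"
proof -
  obtain v where v: "v \<in> wap Q Qtop" "\<And>x. x \<in> carrier G \<Longrightarrow> v (proj x) = u x"
    by (rule wap_descends[OF u]) (rule that)
  have "pullback (topgroup.extend Q Qtop v) s = u s" for s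
    using wap_imp(5)[OF u, of s] v(2)
    by (simp add: pullback_def eta_def topgroup.extend_nhdsin[OF topgroup_Q v(1)] carrier_Q)
  then have "pullback (topgroup.extend Q Qtop v) = u" by (rule ext)
  with topgroup.extend_wap[OF topgroup_Q v(1)] show ?thesis by (rule that)
qed

end

section \<open>The map from topologies to central idempotents\<close>

context topgroup
begin

text \<open>The two sides differ only in the topology that enters weak compactness of the orbit, and the
  double limit property is independent of it.\<close>

lemma wap_at_eq:
  assumes "topological_group G \<tau>'" "continuous_map \<tau> \<tau>' (\<lambda>x. x)"
  shows "wap_at G \<tau> \<tau>' = wap G \<tau>'"
proof -
  interpret T: topgroup G \<tau>' by (rule topgroup.intro[OF assms(1)])
  have "u \<in> wap_at G \<tau> \<tau>' \<longleftrightarrow> u \<in> wap G \<tau>'" for u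
  proof
    assume "u \<in> wap_at G \<tau> \<tau>'"
    then have u: "u \<in> W" "continuous_map \<tau>' euclidean u" by (simp_all add: wap_at_def)
    have "u \<in> bounded_continuous \<tau>'"
      using u(2) wap_imp(4,5)[OF u(1)] by (intro bounded_continuousI[where B = "uniform_norm u"]) simp_all
    with wap_imp(2)[OF u(1)] show "u \<in> wap G \<tau>'" by (simp add: T.wap_iff_double_limit_property)
  next
    assume u: "u \<in> wap G \<tau>'"
    have "continuous_map \<tau> euclidean u"
      using continuous_map_compose[OF assms(2) T.wap_imp(3)[OF u]] by (simp add: comp_def)
    then have "u \<in> bounded_continuous \<tau>"
      using T.wap_imp(4,5)[OF u] by (intro bounded_continuousI[where B = "uniform_norm u"]) simp_all
    with T.wap_imp(2,3)[OF u] show "u \<in> wap_at G \<tau> \<tau>'"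
      by (simp add: wap_at_def wap_iff_double_limit_property)
  qed
  then show ?thesis by blast
qed

text \<open>Composition with the pullback sends the point of an ultrafilter to the point of its image
  under \<open>\<eta>\<close>. Products of points are iterated limits, so this is a homomorphism; as the evaluations
  are dense, there is no other continuous map that extends \<open>\<eta>\<close>.\<close>

lemma eta_wap_eq:
  assumes \<tau>': "topological_group G \<tau>'" "continuous_map \<tau> \<tau>' (\<lambda>x. x)" and p: "p \<in> wap_points G \<tau>"
  shows "eta_wap G \<tau> \<tau>' p = (\<lambda>f\<in>wap (G_completion G \<tau>') (G_completion_topology G \<tau>'). p (topgroup.pullback G \<tau>' f))"
proof -
  interpret T: topgroup G \<tau>' by (rule topgroup.intro[OF \<tau>'(1)])
  interpret C: topgroup T.C T.Ctop by (rule T.topgroup_C)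
  have pull: "T.pullback f \<in> W" if "f \<in> C.W" for f
    using T.pullback_wap[OF that] wap_at_eq[OF \<tau>'] by (auto simp: wap_at_def)
  define h where "h = (\<lambda>p\<in>wap_points G \<tau>. \<lambda>f\<in>C.W. p (T.pullback f))"
  have eta_ultra: "ultrafilter_on (carrier T.C) (filtermap T.\<eta> F)" if "ultrafilter_on (carrier G) F" for F
    using that T.eta_in by (rule ultrafilter_on_filtermap)
  have h_ultra: "h (ultrafilter_point G \<tau> F) = ultrafilter_point T.C T.Ctop (filtermap T.\<eta> F)"
    if F: "ultrafilter_on (carrier G) F" for F
  proof -
    have "Lim F (T.pullback f) = Lim F (\<lambda>s. f (T.\<eta> s))" for f
      by (rule Lim_cong_on[OF F]) (simp add: T.pullback_def)
    then show ?thesis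
      using pull ultrafilter_point_in_points[OF F]
      by (auto simp: h_def ultrafilter_point_def Lim_filtermap)
  qed
  have h_in: "h p \<in> wap_points T.C T.Ctop" if p: "p \<in> wap_points G \<tau>" for p
    using wap_pointE[OF p] h_ultra C.ultrafilter_point_in_points[OF eta_ultra] by metis
  have h_mult: "h (p \<otimes>\<^bsub>K\<^esub> q) = h p \<otimes>\<^bsub>C.K\<^esub> h q" if p: "p \<in> wap_points G \<tau>" and q: "q \<in> wap_points G \<tau>" for p q
  proof (rule C.wap_point_eqI)
    obtain F where F: "ultrafilter_on (carrier G) F" and p_eq: "p = ultrafilter_point G \<tau> F" using wap_pointE[OF p] .
    obtain B where B: "ultrafilter_on (carrier G) B" and q_eq: "q = ultrafilter_point G \<tau> B" using wap_pointE[OF q] .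
    show "h (p \<otimes>\<^bsub>K\<^esub> q) \<in> wap_points T.C T.Ctop" by (intro h_in mult_K_closed p q)
    show "h p \<otimes>\<^bsub>C.K\<^esub> h q \<in> wap_points T.C T.Ctop" by (intro C.mult_K_closed h_in p q)
    fix f assume f: "f \<in> C.W"
    have "h (p \<otimes>\<^bsub>K\<^esub> q) f = Lim (tensor_filter (\<otimes>) F B) (T.pullback f)"
    proof -
      have "h (p \<otimes>\<^bsub>K\<^esub> q) f = (p \<otimes>\<^bsub>K\<^esub> q) (T.pullback f)"
        using mult_K_closed[OF p q] f by (simp add: h_def)
      also have "\<dots> = Lim (tensor_filter (\<otimes>) F B) (T.pullback f)"
        unfolding p_eq q_eq mult_K_ultrafilter[OF F B] using pull[OF f] by (simp add: ultrafilter_point_def)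
      finally show ?thesis .
    qed
    also have "\<dots> = Lim B (\<lambda>t. Lim F (\<lambda>s. T.pullback f (s \<otimes> t)))"
      by (rule Lim_tensor_filter[OF F B _ wap_imp(4)[OF pull[OF f]], where Z = UNIV]) simp
    also have "\<dots> = Lim B (\<lambda>t. Lim F (\<lambda>s. f (T.\<eta> s \<otimes>\<^bsub>T.C\<^esub> T.\<eta> t)))"
      by (intro Lim_cong_on[OF B] Lim_cong_on[OF F]) (simp add: T.pullback_def T.eta_mult)
    also have "\<dots> = Lim (tensor_filter (\<otimes>\<^bsub>T.C\<^esub>) (filtermap T.\<eta> F) (filtermap T.\<eta> B)) f"
      by (subst Lim_tensor_filter[OF eta_ultra[OF F] eta_ultra[OF B] _ C.wap_imp(4)[OF f], where Z = UNIV])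
        (simp_all add: Lim_filtermap)
    also have "\<dots> = (h p \<otimes>\<^bsub>C.K\<^esub> h q) f"
      unfolding p_eq q_eq h_ultra[OF F] h_ultra[OF B] C.mult_K_ultrafilter[OF eta_ultra[OF F] eta_ultra[OF B]]
      using f by (simp add: ultrafilter_point_def)
    finally show "h (p \<otimes>\<^bsub>K\<^esub> q) f = (h p \<otimes>\<^bsub>C.K\<^esub> h q) f" .
  qed
  have h_eval: "h (wap_eval G \<tau> s) = wap_eval T.C T.Ctop (T.\<eta> s)" if s: "s \<in> carrier G" for s
    using wap_eval_in_points[OF s] pull s by (auto simp: h_def wap_eval_def T.pullback_def)
  have h_cont: "continuous_map (wap_topology G \<tau>) (wap_topology T.C T.Ctop) h"
    unfolding C.continuous_map_into_wap_topology
  proof (intro conjI ballI)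
    fix f assume f: "f \<in> C.W"
    have id: "continuous_map (wap_topology G \<tau>) (wap_topology G \<tau>) (\<lambda>q. q)" by simp
    have "continuous_map (wap_topology G \<tau>) euclidean (\<lambda>q. q (T.pullback f))"
      using id pull[OF f] unfolding continuous_map_into_wap_topology by blast
    then show "continuous_map (wap_topology G \<tau>) euclidean (\<lambda>q. h q f)"
      by (rule continuous_map_eq) (use f in \<open>simp add: h_def\<close>)
  qed (use h_in in simp)
  have "eta_wap G \<tau> \<tau>' = h"
    unfolding eta_wap_def Let_def
  proof (rule the_equality, intro conjI ballI)
    show "h \<in> extensional (carrier K)" by (simp add: h_def)
    show "h \<in> hom K C.K" using h_in h_mult by (auto simp: hom_def)
    fix g assume g: "g \<in> extensional (carrier K) \<and> g \<in> hom K C.K \<and>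
      continuous_map (wap_topology G \<tau>) (wap_topology T.C T.Ctop) g \<and>
      (\<forall>s\<in>carrier G. g (wap_eval G \<tau> s) = wap_eval T.C T.Ctop (T.\<eta> s))"
    show "g = h"
    proof (rule extensionalityI[of _ "wap_points G \<tau>"])
      show "g \<in> extensional (wap_points G \<tau>)" using g by simp
      show "h \<in> extensional (wap_points G \<tau>)" by (simp add: h_def)
      fix q assume q: "q \<in> wap_points G \<tau>"
      then obtain F where F: "ultrafilter_on (carrier G) F" and q_eq: "q = ultrafilter_point G \<tau> F" using wap_pointE by blast
      have "limitin (wap_topology G \<tau>) (wap_eval G \<tau>) q F"
        unfolding limitin_wap_topology
      proof (intro conjI ballI q)
        show "eventually (\<lambda>s. wap_eval G \<tau> s \<in> wap_points G \<tau>) F"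
          using ultrafilter_onD(2)[OF F] by eventually_elim (rule wap_eval_in_points)
        show "((\<lambda>s. wap_eval G \<tau> s u) \<longlongrightarrow> q u) F" if "u \<in> W" for u
          using wap_tendsto[OF that F, of "\<lambda>x. x"] that by (simp add: q_eq wap_eval_def ultrafilter_point_def)
      qed
      moreover have "continuous_map (wap_topology G \<tau>) (wap_topology T.C T.Ctop) g" using g by blast
      ultimately have lim: "limitin (wap_topology T.C T.Ctop) (\<lambda>s. g (wap_eval G \<tau> s)) (g q) F"
        by (rule limitin_compose_continuous[rotated])
      show "g q = h q"
      proof (rule C.wap_point_eqI[OF _ h_in[OF q]])
        show "g q \<in> wap_points T.C T.Ctop" using limitin_topspace[OF lim] by simp
        fix f assume f: "f \<in> C.W"
        have "((\<lambda>s. g (wap_eval G \<tau> s) f) \<longlongrightarrow> g q f) F" using lim f by (simp add: C.limitin_wap_topology)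
        moreover have "eventually (\<lambda>s. g (wap_eval G \<tau> s) f = f (T.\<eta> s)) F"
          using ultrafilter_onD(2)[OF F] by eventually_elim (use g f in \<open>simp add: wap_eval_def\<close>)
        ultimately have "((\<lambda>s. f (T.\<eta> s)) \<longlongrightarrow> g q f) F" by (rule Lim_transform_eventually)
        then show "g q f = h q f"
          using f ultrafilter_Lim_eqI[OF F]
          by (simp add: q_eq h_ultra[OF F]) (simp add: ultrafilter_point_def Lim_filtermap)
      qed
    qed
  qed (use h_cont h_eval in auto)
  then show ?thesis using p by (simp add: h_def)
qed

text \<open>Every w.a.p. function that is continuous for \<open>\<tau>'\<close> is a pullback from the completion, so testing on
  pullbacks is testing on all of them.\<close>

lemma S_semigroup_eq:
  assumes \<tau>': "topological_group G \<tau>'" "continuous_map \<tau> \<tau>' (\<lambda>x. x)"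
  shows "S_semigroup G \<tau> \<tau>' = {s \<in> wap_points G \<tau>. \<forall>u\<in>wap_at G \<tau> \<tau>'. s u = u \<one>}"
proof -
  interpret T: topgroup G \<tau>' by (rule topgroup.intro[OF \<tau>'(1)])
  have pull: "wap_at G \<tau> \<tau>' = T.pullback ` wap T.C T.Ctop"
  proof
    show "T.pullback ` wap T.C T.Ctop \<subseteq> wap_at G \<tau> \<tau>'" using T.pullback_wap by (auto simp: wap_at_eq[OF \<tau>'])
    show "wap_at G \<tau> \<tau>' \<subseteq> T.pullback ` wap T.C T.Ctop"
    proof
      fix u assume "u \<in> wap_at G \<tau> \<tau>'"
      then have "u \<in> wap G \<tau>'" by (simp add: wap_at_eq[OF \<tau>'])
      from T.pullback_surj[OF this] show "u \<in> T.pullback ` wap T.C T.Ctop" by blast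
    qed
  qed
  have "eta_wap G \<tau> \<tau>' s = \<one>\<^bsub>wap_compactification T.C T.Ctop\<^esub> \<longleftrightarrow>
      (\<forall>f\<in>wap T.C T.Ctop. s (T.pullback f) = T.pullback f \<one>)" if "s \<in> wap_points G \<tau>" for s
    unfolding eta_wap_eq[OF \<tau>' that]
    by (auto simp: wap_compactification_def wap_eval_def T.pullback_def T.eta_one fun_eq_iff restrict_def split: if_splits)
  then show ?thesis unfolding S_semigroup_def pull by auto
qed

text \<open>As \<open>s (u \<cdot> e) = (e s)(u)\<close> and \<open>(u \<cdot> e)(1) = e(u)\<close>, the semigroup is \<open>{s. e s = e}\<close>. It contains \<open>e\<close>, and
  \<open>e f = e = f e\<close> for every idempotent \<open>f\<close> in it, so \<open>e\<close> is below all of them.\<close>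

theorem E_map_T_map:
  assumes e: "e \<in> central_idempotents G \<tau>"
  shows "E_map G \<tau> (T_map G \<tau> e) = e"
proof -
  note e' = central_idempotentsD[OF e]
  have S: "S_semigroup G \<tau> (T_map G \<tau> e) = {s \<in> wap_points G \<tau>. e \<otimes>\<^bsub>K\<^esub> s = e}"
  proof -
    have "(\<forall>u\<in>wap_at G \<tau> (T_map G \<tau> e). s u = u \<one>) \<longleftrightarrow> e \<otimes>\<^bsub>K\<^esub> s = e" if s: "s \<in> wap_points G \<tau>" for s
    proof -
      have "(\<forall>u\<in>wap_at G \<tau> (T_map G \<tau> e). s u = u \<one>) \<longleftrightarrow>
          (\<forall>u\<in>W. s (wap_translate G \<tau> u e) = wap_translate G \<tau> u e \<one>)"
        unfolding wap_at_T_map(1)[OF e] by blast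
      also have "\<dots> \<longleftrightarrow> (\<forall>u\<in>W. (e \<otimes>\<^bsub>K\<^esub> s) u = e u)"
        by (rule ball_cong[OF refl]) (simp add: mult_K_apply wap_translate_at_one e'(1))
      also have "\<dots> \<longleftrightarrow> e \<otimes>\<^bsub>K\<^esub> s = e"
        using wap_point_eqI[OF mult_K_closed[OF e'(1) s] e'(1)] by auto
      finally show ?thesis .
    qed
    then show ?thesis
      unfolding S_semigroup_eq[OF topological_group_T_map[OF e] T_map_coarser[OF e'(1)]] by blast
  qed
  show ?thesis
    unfolding E_map_def
  proof (rule the_equality)
    show "minimal_idempotent K (S_semigroup G \<tau> (T_map G \<tau> e)) e"
      unfolding minimal_idempotent_def S using e'(1,2) by auto
    fix f assume f: "minimal_idempotent K (S_semigroup G \<tau> (T_map G \<tau> e)) f"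
    then have "f \<in> wap_points G \<tau>" "e \<otimes>\<^bsub>K\<^esub> f = e" unfolding minimal_idempotent_def S by auto
    moreover from this have "f \<otimes>\<^bsub>K\<^esub> e = e" using e'(3) by metis
    ultimately show "f = e" using f e'(1,2) unfolding minimal_idempotent_def S by auto
  qed
qed

section \<open>Decompositions and central idempotents\<close>

definition annihilator :: "(('a \<Rightarrow> complex) \<Rightarrow> complex) \<Rightarrow> ('a \<Rightarrow> complex) set" where
  "annihilator e = {u \<in> W. wap_translate G \<tau> u e = (\<lambda>t. 0)}"

text \<open>The projection \<open>u \<mapsto> u \<cdot> e\<close> is multiplicative and commutes with translations; the decomposition
  is \<open>u = u \<cdot> e + (u - u \<cdot> e)\<close>.\<close>

theorem EdLG_decomposition_of_central_idempotent:
  assumes e: "e \<in> central_idempotents G \<tau>"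
  shows "EdLG_decomposition G \<tau> (wap_at G \<tau> (T_map G \<tau> e)) (annihilator e)"
proof -
  note e' = central_idempotentsD[OF e]
  let ?A = "wap_at G \<tau> (T_map G \<tau> e)" and ?J = "annihilator e"
  interpret T: topgroup G "T_map G \<tau> e" by (rule topgroup.intro[OF topological_group_T_map[OF e]])
  have A_eq: "?A = wap G (T_map G \<tau> e)"
    by (rule wap_at_eq[OF topological_group_T_map[OF e] T_map_coarser[OF e'(1)]])
  have A_sub: "?A \<subseteq> W" by (auto simp: wap_at_def)
  have lin_J: "linear_subspace ?J"
    unfolding linear_subspace_def annihilator_def
  proof (intro conjI ballI allI)
    have "wap_translate G \<tau> (\<lambda>t. 0) e = (\<lambda>t. 0)"
      using wap_translate_fun(3)[OF e'(1) wap_zero wap_zero, of 0] by simp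
    then show "(\<lambda>t. 0) \<in> {u \<in> W. wap_translate G \<tau> u e = (\<lambda>t. 0)}" using wap_zero by simp
  qed (auto simp: wap_add wap_scale wap_translate_fun[OF e'(1)])
  have lin_A: "linear_subspace ?A" unfolding A_eq by (rule T.linear_subspace_wap)
  have closed_J: "norm_closed ?J"
    unfolding norm_closed_def
  proof (intro allI impI, elim conjE)
    fix f :: "nat \<Rightarrow> 'a \<Rightarrow> complex" and u
    assume f: "\<forall>n. f n \<in> ?J" and lim: "uniform_limit UNIV f u sequentially"
    have fW: "f n \<in> W" "wap_translate G \<tau> (f n) e = (\<lambda>t. 0)" for n using f by (auto simp: annihilator_def)
    have u: "u \<in> W" using norm_closed_wap lim fW(1) unfolding norm_closed_def by blast
    have "cmod (wap_translate G \<tau> u e t) \<le> 0" for t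
    proof (rule field_le_epsilon)
      fix d :: real assume d: "d > 0"
      have "eventually (\<lambda>n. \<forall>t\<in>UNIV. dist (f n t) (u t) < d) sequentially" using uniform_limitD[OF lim d] .
      then obtain n where n: "\<And>t. dist (f n t) (u t) < d" unfolding eventually_sequentially by blast
      have "cmod (wap_translate G \<tau> (\<lambda>t. u t - f n t) e t) \<le> d"
        using n by (intro norm_wap_translate_le e' wap_diff u fW) (auto simp: dist_norm norm_minus_commute intro: less_imp_le)
      then show "cmod (wap_translate G \<tau> u e t) \<le> 0 + d"
        by (simp add: wap_translate_fun(4)[OF e'(1) u fW(1)] fW(2))
    qed
    then show "u \<in> ?J" using u by (auto simp: annihilator_def)
  qed
  have ideal_J: "closed_ideal W ?J"
    unfolding closed_ideal_def
  proof (intro conjI ballI lin_J closed_J)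
    show "?J \<subseteq> W" by (auto simp: annihilator_def)
    show "(\<lambda>t. u t * v t) \<in> ?J" if "u \<in> W" "v \<in> ?J" for u v
      using that by (auto simp: annihilator_def wap_mult wap_translate_fun(2)[OF e'(1)])
  qed
  have proper: "?J \<noteq> W"
  proof
    assume eq: "?J = W"
    let ?one = "\<lambda>t. if t \<in> carrier G then 1 else 0 :: complex"
    obtain F where F: "ultrafilter_on (carrier G) F" "e = ultrafilter_point G \<tau> F" using wap_pointE[OF e'(1)] .
    have "Lim F ?one = Lim F (\<lambda>_. 1 :: complex)" by (rule Lim_cong_on[OF F(1)]) simp
    then have "e ?one = 1" using wap_const[of 1] by (simp add: F(2) ultrafilter_point_def Lim_const_ultrafilter[OF F(1)])
    moreover have "?one \<in> ?J" unfolding eq by (rule wap_const)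
    then have "wap_translate G \<tau> ?one e \<one> = 0" by (simp add: annihilator_def)
    ultimately show False using wap_translate_at_one[OF wap_const[of 1] e'(1)] by simp
  qed
  have inv_J: "translation_invariant G ?J"
    unfolding translation_invariant_def
  proof (intro ballI)
    fix u s assume "u \<in> ?J" and s: "s \<in> carrier G"
    then have u: "u \<in> W" "wap_translate G \<tau> u e = (\<lambda>t. 0)" by (auto simp: annihilator_def)
    have "translate_r G (\<lambda>t. 0) s = (\<lambda>t. 0)" "translate_l G s (\<lambda>t. 0) = (\<lambda>t. 0)"
      by (auto simp: translate_r_def translate_l_def)
    then have "wap_translate G \<tau> (translate_r G u s) e = (\<lambda>t. 0)"
      "wap_translate G \<tau> (translate_l G s u) e = (\<lambda>t. 0)"
      unfolding translate_r_wap_translate_central[OF e u(1) s, symmetric] wap_translate_translate_l[OF u(1) e'(1) s] u(2)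
      by simp_all
    then show "translate_r G u s \<in> ?J \<and> translate_l G s u \<in> ?J"
      by (simp add: annihilator_def wap_translate_r_closed wap_translate_l_closed u(1) s)
  qed
  have alg_A: "cstar_subalgebra W ?A"
    unfolding cstar_subalgebra_def
  proof (intro conjI A_sub lin_A)
    show "norm_closed ?A" unfolding A_eq by (rule T.norm_closed_wap)
    show "\<forall>u\<in>?A. \<forall>v\<in>?A. (\<lambda>t. u t * v t) \<in> ?A" unfolding A_eq using T.wap_mult by blast
    show "\<forall>u\<in>?A. (\<lambda>t. cnj (u t)) \<in> ?A" unfolding A_eq using T.wap_cnj by blast
  qed
  have inv_A: "translation_invariant G ?A"
    unfolding translation_invariant_def A_eq using T.wap_translate_r_closed T.wap_translate_l_closed by blast
  have "direct_sum W ?A ?J"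
    unfolding direct_sum_def
  proof (intro conjI lin_A lin_J)
    show "?A \<inter> ?J = {\<lambda>t. 0}"
    proof
      show "?A \<inter> ?J \<subseteq> {\<lambda>t. 0}" using wap_at_T_map(2)[OF e] by (auto simp: annihilator_def)
      show "{\<lambda>t. 0} \<subseteq> ?A \<inter> ?J" using lin_A lin_J by (simp add: linear_subspace_def)
    qed
    show "W = {\<lambda>t. a t + j t |a j. a \<in> ?A \<and> j \<in> ?J}"
    proof
      show "{\<lambda>t. a t + j t |a j. a \<in> ?A \<and> j \<in> ?J} \<subseteq> W"
        using A_sub by (auto simp: annihilator_def intro!: wap_add)
      show "W \<subseteq> {\<lambda>t. a t + j t |a j. a \<in> ?A \<and> j \<in> ?J}"
      proof
        fix u assume u: "u \<in> W"
        let ?a = "wap_translate G \<tau> u e"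
        have a: "?a \<in> ?A" using u unfolding wap_at_T_map(1)[OF e] by blast
        define j where "j = (\<lambda>t. u t - ?a t)"
        have "j \<in> ?J"
          using u wap_translate_closed[OF u e'(1)]
          by (simp add: j_def annihilator_def wap_diff wap_translate_fun(4)[OF e'(1)] wap_translate_idempotent[OF e u])
        moreover have "u = (\<lambda>t. ?a t + j t)" by (simp add: j_def)
        ultimately show "u \<in> {\<lambda>t. a t + j t |a j. a \<in> ?A \<and> j \<in> ?J}"
          using a by (intro CollectI exI[of _ ?a] exI[of _ j] conjI)
      qed
    qed
  qed
  with ideal_J proper inv_J alg_A inv_A show ?thesis by (simp add: EdLG_decomposition_def)
qed

text \<open>It suffices that finitely many functions can be brought close to their values under \<open>e\<close> at a common
  element of the group: an ultrafilter refining these approximations then represents \<open>e\<close>. If no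
  element did, \<open>\<Sum>|u - e(u)|\<^sup>2\<close> would be bounded away from \<open>0\<close>. It would then be invertible in the algebra,
  although it is in the kernel of \<open>e\<close>.\<close>

lemma character_is_wap_point:
  fixes e :: "('a \<Rightarrow> complex) \<Rightarrow> complex"
  assumes ext: "e \<in> extensional W"
    and add: "\<And>u v. u \<in> W \<Longrightarrow> v \<in> W \<Longrightarrow> e (\<lambda>t. u t + v t) = e u + e v"
    and scale: "\<And>c u. u \<in> W \<Longrightarrow> e (\<lambda>t. c * u t) = c * e u"
    and mult: "\<And>u v. u \<in> W \<Longrightarrow> v \<in> W \<Longrightarrow> e (\<lambda>t. u t * v t) = e u * e v"
    and one: "e (\<lambda>t. if t \<in> carrier G then 1 else 0) = 1"
  shows "e \<in> wap_points G \<tau>"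
proof -
  let ?one = "\<lambda>t. if t \<in> carrier G then 1 else 0 :: complex"
  define S where "S \<Phi> d = {s \<in> carrier G. \<forall>u\<in>\<Phi>. cmod (u s - e u) < d}" for \<Phi> and d :: real
  have S_ne: "S \<Phi> d \<noteq> {}" if \<Phi>: "finite \<Phi>" "\<Phi> \<subseteq> W" and d: "d > 0" for \<Phi> d
  proof
    assume empty: "S \<Phi> d = {}"
    \<comment> \<open>sums over subfamilies, so that membership in the kernel follows by induction\<close>
    define w where "w \<Psi> t = (if t \<in> carrier G then (\<Sum>u\<in>\<Psi>. (u t - e u) * cnj (u t - e u)) else 0)"
      for \<Psi> :: "('a \<Rightarrow> complex) set" and t
    have w: "w \<Psi> \<in> W \<and> e (w \<Psi>) = 0" if "finite \<Psi>" "\<Psi> \<subseteq> W" for \<Psi>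
      using that
    proof induction
      case empty
      have "e (\<lambda>t. 0) = 0" using scale[OF wap_zero, of 0] by simp
      moreover have "w {} = (\<lambda>t. 0)" by (auto simp: w_def)
      ultimately show ?case using wap_zero by simp
    next
      case (insert u \<Psi>)
      then have u: "u \<in> W" and IH: "w \<Psi> \<in> W" "e (w \<Psi>) = 0" by auto
      define d where "d = (\<lambda>t. u t + (- e u) * ?one t)"
      have dW: "d \<in> W" unfolding d_def by (intro wap_add u wap_scale wap_const)
      have "e d = e u + e (\<lambda>t. (- e u) * ?one t)" unfolding d_def by (rule add[OF u wap_scale[OF wap_const]])
      also have "\<dots> = 0" unfolding scale[OF wap_const] one by simp
      finally have "e (\<lambda>t. d t * cnj (d t)) = 0" using mult[OF dW wap_cnj[OF dW]] by simp
      moreover have "w (insert u \<Psi>) = (\<lambda>t. d t * cnj (d t) + w \<Psi> t)"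
        using insert.hyps wap_imp(5)[OF u] by (auto simp: w_def d_def fun_eq_iff)
      moreover have "(\<lambda>t. d t * cnj (d t)) \<in> W" by (intro wap_mult dW wap_cnj)
      ultimately show ?case using IH by (simp add: add wap_add)
    qed
    have w_ge: "d^2 \<le> cmod (w \<Phi> t)" if t: "t \<in> carrier G" for t
    proof -
      obtain u where u: "u \<in> \<Phi>" "d \<le> cmod (u t - e u)" using empty t by (auto simp: S_def not_less)
      have "w \<Phi> t = of_real (\<Sum>u\<in>\<Phi>. (cmod (u t - e u))^2)"
        unfolding w_def of_real_sum complex_norm_square using t by simp
      moreover have "d^2 \<le> (\<Sum>u\<in>\<Phi>. (cmod (u t - e u))^2)"
      proof -
        have "d^2 \<le> (cmod (u t - e u))^2" using u(2) d by (intro power_mono) auto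
        also have "\<dots> \<le> (\<Sum>u\<in>\<Phi>. (cmod (u t - e u))^2)" using u(1) \<Phi>(1) by (intro member_le_sum) auto
        finally show ?thesis .
      qed
      ultimately show ?thesis by (simp only: norm_of_real)
    qed
    define r where "r = (\<lambda>t. if t \<in> carrier G then 1 / w \<Phi> t else 0)"
    have rW: "r \<in> W" unfolding r_def using w[OF \<Phi>] w_ge d by (intro wap_reciprocal[where d = "d^2"]) auto
    have "w \<Phi> t * r t = ?one t" for t
      using w_ge[of t] d by (auto simp: r_def)
    then have "e ?one = e (w \<Phi>) * e r" using mult[of "w \<Phi>" r] w[OF \<Phi>] rW by simp
    with one w[OF \<Phi>] show False by simp
  qed
  define I where "I = {\<Phi>. finite \<Phi> \<and> \<Phi> \<subseteq> W} \<times> {0::real<..}"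
  define F0 where "F0 = (INF p\<in>I. principal (S (fst p) (snd p)))"
  have ev: "eventually P F0 \<longleftrightarrow> (\<exists>p\<in>I. \<forall>s\<in>S (fst p) (snd p). P s)" for P
    unfolding F0_def
  proof (subst eventually_INF_base)
    show "I \<noteq> {}" by (auto simp: I_def intro: exI[of _ 1] exI[of _ "{}"])
    fix p q assume "p \<in> I" "q \<in> I"
    then show "\<exists>x\<in>I. principal (S (fst x) (snd x)) \<le> inf (principal (S (fst p) (snd p))) (principal (S (fst q) (snd q)))"
      by (intro bexI[of _ "(fst p \<union> fst q, min (snd p) (snd q))"]) (auto simp: I_def S_def)
  qed (simp add: eventually_principal)
  have "\<not> eventually (\<lambda>_. False) F0" unfolding ev using S_ne by (auto simp: I_def)
  then have nb: "F0 \<noteq> bot" by (simp add: eventually_False)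
  have in_I: "(\<Phi>, d) \<in> I" if "finite \<Phi>" "\<Phi> \<subseteq> W" "d > 0" for \<Phi> d using that by (simp add: I_def)
  have "eventually (\<lambda>s. s \<in> carrier G) F0"
    unfolding ev using in_I[of "{}" 1] by (intro bexI[of _ "({}, 1)"]) (auto simp: S_def)
  then have "F0 \<le> principal (carrier G)" by (simp add: le_principal)
  then obtain F where F: "F \<le> F0" "ultrafilter_on (carrier G) F" using ultrafilter_below[OF nb] by metis
  have "Lim F u = e u" if u: "u \<in> W" for u
  proof (rule ultrafilter_Lim_eqI[OF F(2)], rule tendstoI)
    fix d :: real assume d: "d > 0"
    have "eventually (\<lambda>s. dist (u s) (e u) < d) F0"
      unfolding ev using in_I[of "{u}" d] u d by (intro bexI[of _ "({u}, d)"]) (auto simp: S_def dist_norm)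
    then show "eventually (\<lambda>s. dist (u s) (e u) < d) F" by (rule filter_leD[OF F(1)])
  qed
  then have "e = ultrafilter_point G \<tau> F"
    using ext by (auto simp: ultrafilter_point_def extensional_def fun_eq_iff)
  then show ?thesis using ultrafilter_point_in_points[OF F(2)] by simp
qed

text \<open>Let \<open>P\<close> be the projection onto \<open>A\<close> along \<open>J\<close> and \<open>e(u) = (P u)(1)\<close>. As \<open>P\<close> commutes with
  \<open>u \<mapsto> t \<cdot> u\<close>, \<open>(u \<cdot> e)(t) = e(t \<cdot> u) = (P u)(t)\<close>, so \<open>J = ker P\<close> is the annihilator of \<open>e\<close>; and \<open>P P = P\<close>
  gives \<open>e e = e\<close>. As \<open>P\<close> commutes with \<open>u \<mapsto> u \<cdot> t\<close>, \<open>e\<close> commutes with evaluations, and by separate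
  continuity with every point.\<close>

theorem EdLG_ideal_annihilator:
  assumes dec: "EdLG_decomposition G \<tau> A J"
  obtains e where "e \<in> central_idempotents G \<tau>" "J = annihilator e"
proof -
  let ?one = "\<lambda>t. if t \<in> carrier G then 1 else 0 :: complex"
  have JW: "J \<subseteq> W" and AW: "A \<subseteq> W" and J_proper: "J \<noteq> W"
    and J_ideal: "\<And>u v. u \<in> W \<Longrightarrow> v \<in> J \<Longrightarrow> (\<lambda>t. u t * v t) \<in> J"
    and A_mult: "\<And>u v. u \<in> A \<Longrightarrow> v \<in> A \<Longrightarrow> (\<lambda>t. u t * v t) \<in> A"
    and A_lin: "linear_subspace A" and J_lin: "linear_subspace J" and AJ: "A \<inter> J = {\<lambda>t. 0}"
    and W_sum: "W = {\<lambda>t. a t + j t | a j. a \<in> A \<and> j \<in> J}"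
    and A_tr: "\<And>u s. u \<in> A \<Longrightarrow> s \<in> carrier G \<Longrightarrow> translate_r G u s \<in> A"
    and A_tl: "\<And>u s. u \<in> A \<Longrightarrow> s \<in> carrier G \<Longrightarrow> translate_l G s u \<in> A"
    and J_tr: "\<And>u s. u \<in> J \<Longrightarrow> s \<in> carrier G \<Longrightarrow> translate_r G u s \<in> J"
    and J_tl: "\<And>u s. u \<in> J \<Longrightarrow> s \<in> carrier G \<Longrightarrow> translate_l G s u \<in> J"
    using dec unfolding EdLG_decomposition_def closed_ideal_def cstar_subalgebra_def direct_sum_def
      translation_invariant_def by blast+
  have A_add: "(\<lambda>t. u t + v t) \<in> A" if "u \<in> A" "v \<in> A" for u v using A_lin that by (simp add: linear_subspace_def)
  have J_add: "(\<lambda>t. u t + v t) \<in> J" if "u \<in> J" "v \<in> J" for u v using J_lin that by (simp add: linear_subspace_def)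
  have A_scale: "(\<lambda>t. c * u t) \<in> A" if "u \<in> A" for c u using A_lin that by (simp add: linear_subspace_def)
  have J_scale: "(\<lambda>t. c * u t) \<in> J" if "u \<in> J" for c u using J_lin that by (simp add: linear_subspace_def)
  have A_diff: "(\<lambda>t. u t - v t) \<in> A" if "u \<in> A" "v \<in> A" for u v
    using A_add[OF that(1) A_scale[OF that(2), of "-1"]] by simp
  have J_diff: "(\<lambda>t. u t - v t) \<in> J" if "u \<in> J" "v \<in> J" for u v
    using J_add[OF that(1) J_scale[OF that(2), of "-1"]] by simp
  define P where "P u = (SOME a. a \<in> A \<and> (\<lambda>t. u t - a t) \<in> J)" for u
  have P: "P u \<in> A" "(\<lambda>t. u t - P u t) \<in> J" if "u \<in> W" for u
  proof -
    have "\<exists>a j. u = (\<lambda>t. a t + j t) \<and> a \<in> A \<and> j \<in> J"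
      using that unfolding W_sum by (rule CollectD)
    then obtain a j where aj: "u = (\<lambda>t. a t + j t)" "a \<in> A" "j \<in> J" by (elim exE conjE)
    then have "a \<in> A \<and> (\<lambda>t. u t - a t) \<in> J" by simp
    then have "P u \<in> A \<and> (\<lambda>t. u t - P u t) \<in> J" unfolding P_def
      by (rule someI[of "\<lambda>a. a \<in> A \<and> (\<lambda>t. u t - a t) \<in> J"])
    then show "P u \<in> A" "(\<lambda>t. u t - P u t) \<in> J" by auto
  qed
  have P_eqI: "P u = a" if u: "u \<in> W" and a: "a \<in> A" "(\<lambda>t. u t - a t) \<in> J" for u a
  proof -
    have "(\<lambda>t. P u t - a t) \<in> A" by (rule A_diff[OF P(1)[OF u] a(1)])
    moreover have "(\<lambda>t. (u t - a t) - (u t - P u t)) \<in> J" by (rule J_diff[OF a(2) P(2)[OF u]])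
    then have "(\<lambda>t. P u t - a t) \<in> J" by simp
    ultimately have "(\<lambda>t. P u t - a t) = (\<lambda>t. 0)" using AJ by blast
    then show ?thesis by (simp add: fun_eq_iff)
  qed
  have PW: "P u \<in> W" if "u \<in> W" for u using P(1)[OF that] AW by blast
  have zero_J: "(\<lambda>t. 0) \<in> J" using J_lin by (simp add: linear_subspace_def)
  have P_A: "P a = a" if "a \<in> A" for a
    using that AW zero_J by (intro P_eqI) auto
  have P_add: "P (\<lambda>t. u t + v t) = (\<lambda>t. P u t + P v t)" if u: "u \<in> W" and v: "v \<in> W" for u v
  proof (rule P_eqI[OF wap_add[OF u v] A_add[OF P(1)[OF u] P(1)[OF v]]])
    have "(\<lambda>t. (u t - P u t) + (v t - P v t)) \<in> J" by (rule J_add[OF P(2)[OF u] P(2)[OF v]])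
    then show "(\<lambda>t. u t + v t - (P u t + P v t)) \<in> J" by (simp add: algebra_simps)
  qed
  have P_scale: "P (\<lambda>t. c * u t) = (\<lambda>t. c * P u t)" if u: "u \<in> W" for c u
  proof (rule P_eqI[OF wap_scale[OF u] A_scale[OF P(1)[OF u]]])
    have "(\<lambda>t. c * (u t - P u t)) \<in> J" by (rule J_scale[OF P(2)[OF u]])
    then show "(\<lambda>t. c * u t - c * P u t) \<in> J" by (simp add: algebra_simps)
  qed
  have P_mult: "P (\<lambda>t. u t * v t) = (\<lambda>t. P u t * P v t)" if u: "u \<in> W" and v: "v \<in> W" for u v
  proof (rule P_eqI[OF wap_mult[OF u v] A_mult[OF P(1)[OF u] P(1)[OF v]]])
    have "(\<lambda>t. v t * (u t - P u t) + P u t * (v t - P v t)) \<in> J"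
      by (intro J_add J_ideal P(2) u v PW)
    then show "(\<lambda>t. u t * v t - P u t * P v t) \<in> J" by (simp add: algebra_simps)
  qed
  have P_tr: "P (translate_r G u s) = translate_r G (P u) s" if u: "u \<in> W" and s: "s \<in> carrier G" for u s
  proof (rule P_eqI[OF wap_translate_r_closed[OF u s] A_tr[OF P(1)[OF u] s]])
    have "(\<lambda>t. translate_r G u s t - translate_r G (P u) s t) = translate_r G (\<lambda>t. u t - P u t) s"
      by (auto simp: translate_r_def)
    then show "(\<lambda>t. translate_r G u s t - translate_r G (P u) s t) \<in> J" using J_tr[OF P(2)[OF u] s] by simp
  qed
  have P_tl: "P (translate_l G s u) = translate_l G s (P u)" if u: "u \<in> W" and s: "s \<in> carrier G" for u s
  proof (rule P_eqI[OF wap_translate_l_closed[OF u s] A_tl[OF P(1)[OF u] s]])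
    have "(\<lambda>t. translate_l G s u t - translate_l G s (P u) t) = translate_l G s (\<lambda>t. u t - P u t)"
      by (auto simp: translate_l_def)
    then show "(\<lambda>t. translate_l G s u t - translate_l G s (P u) t) \<in> J" using J_tl[OF P(2)[OF u] s] by simp
  qed
  have P_zero: "P u = (\<lambda>t. 0) \<longleftrightarrow> u \<in> J" if u: "u \<in> W" for u
  proof
    show "u \<in> J" if "P u = (\<lambda>t. 0)" using P(2)[OF u] that by simp
    show "P u = (\<lambda>t. 0)" if "u \<in> J"
      using that A_lin by (intro P_eqI[OF u]) (auto simp: linear_subspace_def)
  qed
  have one_W: "?one \<in> W" by (rule wap_const)
  \<comment> \<open>\<open>P 1\<close> is an idempotent translation invariant function, so it is the constant \<open>0\<close> or \<open>1\<close>\<close>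
  have P_one: "P ?one \<one> = 1"
  proof (rule ccontr)
    assume ne: "P ?one \<one> \<noteq> 1"
    have "(\<lambda>t. ?one t * ?one t) = ?one" by auto
    then have "P ?one \<one> * P ?one \<one> = P ?one \<one>" using P_mult[OF one_W one_W] by (metis (no_types, lifting))
    with ne have zero: "P ?one \<one> = 0" by simp
    have "P ?one s = 0" for s
    proof (cases "s \<in> carrier G")
      case True
      then have "translate_l G s ?one = ?one" by (auto simp: translate_l_def)
      then have "translate_l G s (P ?one) \<one> = P ?one \<one>" using P_tl[OF one_W True] by simp
      then show ?thesis using True zero by (simp add: translate_l_def)
    qed (use wap_imp(5)[OF PW[OF one_W]] in auto)
    then have "?one \<in> J" using P_zero[OF one_W] by (auto simp: fun_eq_iff)
    have "u \<in> J" if u: "u \<in> W" for u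
    proof -
      have "(\<lambda>t. u t * ?one t) = u" using wap_imp(5)[OF u] by (auto simp: fun_eq_iff)
      then show ?thesis using J_ideal[OF u \<open>?one \<in> J\<close>] by simp
    qed
    with JW J_proper show False by blast
  qed
  define e where "e = (\<lambda>u\<in>W. P u \<one>)"
  have e_in: "e \<in> wap_points G \<tau>"
  proof (rule character_is_wap_point)
    show "e ?one = 1" using one_W P_one by (simp add: e_def)
  qed (simp_all add: e_def wap_add wap_scale wap_mult P_add P_scale P_mult)
  have ue: "wap_translate G \<tau> u e = P u" if u: "u \<in> W" for u
  proof
    fix t
    show "wap_translate G \<tau> u e t = P u t"
    proof (cases "t \<in> carrier G")
      case True
      have "wap_translate G \<tau> u e t = P (translate_l G t u) \<one>"
        using wap_translate_eq[OF u e_in True] wap_translate_l_closed[OF u True] by (simp add: e_def)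
      also have "\<dots> = P u t" unfolding P_tl[OF u True] using True by (simp add: translate_l_def)
      finally show ?thesis .
    next
      case False
      then show ?thesis using wap_imp(5)[OF PW[OF u]] by (simp add: wap_translate_outside)
    qed
  qed
  have "e \<in> central_idempotents G \<tau>"
    unfolding central_idempotents_def Let_def carrier_K
  proof (intro CollectI conjI ballI e_in)
    show "e \<otimes>\<^bsub>K\<^esub> e = e"
    proof (rule wap_point_eqI[OF mult_K_closed[OF e_in e_in] e_in])
      show "(e \<otimes>\<^bsub>K\<^esub> e) u = e u" if u: "u \<in> W" for u
        using u PW[OF u] P_A[OF P(1)[OF u]] by (simp add: mult_K_apply ue) (simp add: e_def)
    qed
    fix s assume s: "s \<in> wap_points G \<tau>"
    obtain F where F: "ultrafilter_on (carrier G) F" and s_eq: "s = ultrafilter_point G \<tau> F" using wap_pointE[OF s] .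
    show "e \<otimes>\<^bsub>K\<^esub> s = s \<otimes>\<^bsub>K\<^esub> e"
    proof (rule wap_point_eqI[OF mult_K_closed[OF e_in s] mult_K_closed[OF s e_in]])
      fix u assume u: "u \<in> W"
      have "(s \<otimes>\<^bsub>K\<^esub> e) u = Lim F (\<lambda>r. (wap_eval G \<tau> r \<otimes>\<^bsub>K\<^esub> e) u)"
        unfolding s_eq by (rule mult_K_ultrafilter_left[OF F e_in u])
      also have "\<dots> = Lim F (P u)"
      proof (rule Lim_cong_on[OF F])
        fix r assume r: "r \<in> carrier G"
        have "(wap_eval G \<tau> r \<otimes>\<^bsub>K\<^esub> e) u = P (translate_r G u r) \<one>"
          using mult_K_eval(2)[OF u r e_in] wap_translate_r_closed[OF u r] by (simp add: e_def)
        also have "\<dots> = P u r" unfolding P_tr[OF u r] using r by (simp add: translate_r_def)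
        finally show "(wap_eval G \<tau> r \<otimes>\<^bsub>K\<^esub> e) u = P u r" .
      qed
      also have "\<dots> = (e \<otimes>\<^bsub>K\<^esub> s) u"
        using u PW[OF u] by (simp add: mult_K_apply ue s_eq ultrafilter_point_def)
      finally show "(e \<otimes>\<^bsub>K\<^esub> s) u = (s \<otimes>\<^bsub>K\<^esub> e) u" ..
    qed
  qed
  moreover have "J = annihilator e"
    using JW P_zero ue by (auto simp: annihilator_def)
  ultimately show ?thesis using that by blast
qed

end

theorem theorem3p2:
  fixes G :: "('a, 'm) monoid_scheme" and \<tau>\<^sub>G :: "'a topology"
  assumes "weakly_almost_periodic_group G \<tau>\<^sub>G"
  shows "(\<forall>\<tau>\<in>T_bar G \<tau>\<^sub>G.
            wap_at G \<tau>\<^sub>G \<tau> = {wap_translate G \<tau>\<^sub>G u (E_map G \<tau>\<^sub>G \<tau>) | u. u \<in> wap G \<tau>\<^sub>G} \<and>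
            EdLG_ideal G \<tau>\<^sub>G (I_ideal G \<tau>\<^sub>G \<tau>) \<and>
            EdLG_decomposition G \<tau>\<^sub>G (wap_at G \<tau>\<^sub>G \<tau>) (I_ideal G \<tau>\<^sub>G \<tau>) \<and>
            direct_sum (wap G \<tau>\<^sub>G) (wap_at G \<tau>\<^sub>G \<tau>) (I_ideal G \<tau>\<^sub>G \<tau>))
       \<and> (\<forall>J. EdLG_ideal G \<tau>\<^sub>G J \<longrightarrow> (\<exists>\<tau>\<in>T_bar G \<tau>\<^sub>G. J = I_ideal G \<tau>\<^sub>G \<tau>))"
proof -
  interpret topgroup G \<tau>\<^sub>G
    using assms by (intro topgroup.intro) (simp add: weakly_almost_periodic_group_def)
  have I: "I_ideal G \<tau>\<^sub>G (T_map G \<tau>\<^sub>G e) = annihilator e" if "e \<in> central_idempotents G \<tau>\<^sub>G" for e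
    by (simp add: I_ideal_def annihilator_def E_map_T_map[OF that])
  show ?thesis
  proof (intro conjI ballI allI impI)
    fix \<tau> assume "\<tau> \<in> T_bar G \<tau>\<^sub>G"
    then obtain e where e: "e \<in> central_idempotents G \<tau>\<^sub>G" "\<tau> = T_map G \<tau>\<^sub>G e" by (auto simp: T_bar_def)
    show "wap_at G \<tau>\<^sub>G \<tau> = {wap_translate G \<tau>\<^sub>G u (E_map G \<tau>\<^sub>G \<tau>) | u. u \<in> wap G \<tau>\<^sub>G}"
      unfolding e(2) E_map_T_map[OF e(1)] by (rule wap_at_T_map(1)[OF e(1)])
    show dec: "EdLG_decomposition G \<tau>\<^sub>G (wap_at G \<tau>\<^sub>G \<tau>) (I_ideal G \<tau>\<^sub>G \<tau>)"
      unfolding e(2) I[OF e(1)] by (rule EdLG_decomposition_of_central_idempotent[OF e(1)])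
    then show "EdLG_ideal G \<tau>\<^sub>G (I_ideal G \<tau>\<^sub>G \<tau>)" unfolding EdLG_ideal_def by blast
    from dec show "direct_sum (wap G \<tau>\<^sub>G) (wap_at G \<tau>\<^sub>G \<tau>) (I_ideal G \<tau>\<^sub>G \<tau>)"
      by (simp add: EdLG_decomposition_def)
  next
    fix J assume "EdLG_ideal G \<tau>\<^sub>G J"
    then obtain A where "EdLG_decomposition G \<tau>\<^sub>G A J" unfolding EdLG_ideal_def by blast
    then obtain e where e: "e \<in> central_idempotents G \<tau>\<^sub>G" "J = annihilator e" by (rule EdLG_ideal_annihilator)
    then have "J = I_ideal G \<tau>\<^sub>G (T_map G \<tau>\<^sub>G e)" by (simp add: I)
    with e(1) show "\<exists>\<tau>\<in>T_bar G \<tau>\<^sub>G. J = I_ideal G \<tau>\<^sub>G \<tau>" by (auto simp: T_bar_def)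
  qed
qed

end
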